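(* For every positive integer $n$, \[ W_{(2,13)}(n)=\tfrac1{2040}\sigma_3(n)+\tfrac1{510}\sigma_3(\tfrac n2)+\tfrac{169}{2040}\sigma_3(\tfrac n{13})+\tfrac{169}{510}\sigma_3(\tfrac n{26})+(\tfrac1{24}-\tfrac n{52})\sigma(\tfrac n2)+(\tfrac1{24}-\tfrac n8)\sigma(\tfrac n{13})-\tfrac1{2040}c_1(n)-\tfrac{127}{5304}c_2(n)-\tfrac{181}{1768}c_3(n)-\tfrac{947}{13260}c_4(n)-\tfrac{127}{408}c_5(n)-\tfrac{13}{2040}c_7(n)+\tfrac{46}{3315}c_8(n)+\tfrac{863}{26520}c_9(n). \]
   Context: $\sigma_k(n)=\sum_{d\mid n}d^k$ for $n\in\mathbb{N}$, $\sigma_k(x)=0$ for $x\notin\mathbb{N}$, $\sigma=\sigma_1$. $W_{(\alpha,\beta)}(n)=\sum_{(l,m)\in\mathbb{N}_0^2,\ \alpha l+\beta m=n}\sigma(l)\sigma(m)$. With $q=e^{2\pi iz}$ and $\eta(z)=q^{1/24}\prod_{n\ge1}(1-q^n)$, the integers $c_i(n)$ are defined by $C_i=\sum_{n\ge1}c_i(n)q^n$ where $C_1=\frac{\eta(z)\eta^5(2z)\eta^3(13z)}{\eta(26z)}$, $C_2=\eta^3(z)\eta^3(2z)\eta(13z)\eta(26z)$, $C_3=\eta(z)\eta^3(2z)\eta^3(13z)\eta(26z)$, $C_4=\eta^3(z)\eta(2z)\eta(13z)\eta^3(26z)$, $C_5=\eta(z)\eta(2z)\eta^3(13z)\eta^6(26z)$,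 $C_7=\frac{\eta^3(2z)\eta^5(13z)\eta(26z)}{\eta(z)}$, $C_8=\frac{\eta^5(2z)\eta^5(13z)}{\eta(z)\eta(26z)}$, $C_9=\frac{\eta^7(z)\eta^7(26z)}{\eta^3(2z)\eta^3(13z)}$.
   Formalization: C_5 is taken as η(z)η(2z)η^3(13z)η^3(26z); with the printed factor η^6(26z) the quotient begins at q^{33/4}, has no expansion in integral powers of q, and c_5(n) would be undefined. *)

theory Defs
  imports "HOL-Computational_Algebra.Formal_Power_Series"
begin

definition sigma_nat :: "nat \<Rightarrow> nat \<Rightarrow> nat" where
  "sigma_nat k n = (\<Sum>d \<in> {d \<in> {1..n}. d dvd n}. d ^ k)"

definition sigmaQ :: "nat \<Rightarrow> rat \<Rightarrow> rat" where
  "sigmaQ k x = (if x \<in> \<nat> \<and> x > 0 then of_nat (sigma_nat k (nat \<lfloor>x\<rfloor>)) else 0)"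

definition W :: "nat \<Rightarrow> nat \<Rightarrow> nat \<Rightarrow> nat" where
  "W a b n = (\<Sum>(l, m) \<in> {(l, m). l \<le> n \<and> m \<le> n \<and> a * l + b * m = n}.
                 sigma_nat 1 l * sigma_nat 1 m)"

text \<open>Truncated product  prod_{k=1}^{N} (1 - q^(d k))^r  as a formal power series
  (negative r via the fps inverse, which is the true inverse since the constant term is 1).\<close>
definition eta_factor :: "nat \<Rightarrow> int \<Rightarrow> nat \<Rightarrow> rat fps" where
  "eta_factor d r N =
     (let P = (\<Prod>k\<in>{1..N}. (1 - fps_X ^ (d * k)) :: rat fps)
      in if r \<ge> 0 then P ^ nat r else inverse (P ^ nat (- r)))"

text \<open>The eta quotient prod_{(d,r)} eta(d z)^r is q^(S/24) times
  prod_{(d,r)} prod_{k \<ge> 1} (1 - q^(d k))^r, with S = sum d r.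
  The coefficient of q^n (n a natural number) only involves the factors with k \<le> n,
  so truncating the infinite product at N = n is exact.  If S/24 is not an integer
  there are no integral powers of q, so the coefficient is 0.\<close>
definition eta_coeff :: "(nat \<times> int) list \<Rightarrow> nat \<Rightarrow> rat" where
  "eta_coeff l n =
     (let S = (\<Sum>(d, r) \<leftarrow> l. int d * r)
      in if 24 dvd S \<and> S div 24 \<le> int n
         then fps_nth (prod_list (map (\<lambda>(d, r). eta_factor d r n) l)) (nat (int n - S div 24))
         else 0)"

definition c1 :: "nat \<Rightarrow> rat" where "c1 = eta_coeff [(1, 1), (2, 5), (13, 3), (26, -1)]"
definition c2 :: "nat \<Rightarrow> rat" where "c2 = eta_coeff [(1, 3), (2, 3), (13, 1), (26, 1)]"
definition c3 :: "nat \<Rightarrow> rat" where "c3 = eta_coeff [(1, 1), (2, 3), (13, 3), (26, 1)]"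
definition c4 :: "nat \<Rightarrow> rat" where "c4 = eta_coeff [(1, 3), (2, 1), (13, 1), (26, 3)]"
definition c5 :: "nat \<Rightarrow> rat" where "c5 = eta_coeff [(1, 1), (2, 1), (13, 3), (26, 3)]"
definition c7 :: "nat \<Rightarrow> rat" where "c7 = eta_coeff [(1, -1), (2, 3), (13, 5), (26, 1)]"
definition c8 :: "nat \<Rightarrow> rat" where "c8 = eta_coeff [(1, -1), (2, 5), (13, 5), (26, -1)]"
definition c9 :: "nat \<Rightarrow> rat" where "c9 = eta_coeff [(1, 7), (2, -3), (13, -3), (26, 7)]"

end

theory Submission
  imports Defs "HOL-Complex_Analysis.Complex_Analysis" "HOL-Number_Theory.Cong"
begin

text \<open>Let \<open>P = 1 - 24 \<Sum> \<sigma>(n) q\<^sup>n\<close> and \<open>Q = 1 + 240 \<Sum> \<sigma>\<^sub>3(n) q\<^sup>n\<close>.  Ramanujan's relation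
  \<open>12 q P' = P\<^sup>2 - Q\<close>, a consequence of an elementary identity of Liouville, turns the generating
  function of \<open>W\<^bsub>(2,13)\<^esub>\<close> minus the divisor sums of the claim into a combination \<open>A\<close> of
  \<open>(2 P(2z) - 13 P(13z))\<^sup>2\<close> and the \<open>Q(dz)\<close> with \<open>d\<close> dividing \<open>26\<close>, which is a modular form of weight 4 for
  \<open>\<Gamma>\<^sub>0(26)\<close>.  The quasimodularity of \<open>P\<close> comes from Serre's comparison of the two orders of summation
  of a double series; as \<open>P\<close> is the logarithmic derivative of \<open>\<eta>\<close>, it yields the transformation law
  of \<open>\<eta>\<^sup>2\<close>.  The eta quotients have odd exponents, but products of two of them are products of
  values of \<open>\<eta>\<^sup>2\<close>.  Hence, with \<open>B\<close> the combination of the \<open>C\<^sub>i\<close>, the form \<open>A\<^sup>2 - B\<^sup>2\<close> has weight 8 and trivial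
  character, and it vanishes by Sturm's bound once the coefficients of \<open>A\<close> and \<open>B\<close> agree up to
  \<open>q\<^sup>2\<^sup>8\<close>: the index of \<open>\<Gamma>\<^sub>0(26)\<close> is 42, and \<open>8 \<cdot> 42 / 12 = 28\<close>.  Comparing one coefficient rules
  out \<open>A = - B\<close>.\<close>

section \<open>Convolution sums of divisor functions\<close>

text \<open>The square in \<open>A\<close> comes from \<open>52 P(2z) P(13z) = 4 P(2z)^2 + 169
  P(13z)^2 - (2 P(2z) - 13 P(13z))^2\<close>: the coefficients of \<open>n \<sigma>(n/2)\<close> and
  \<open>n \<sigma>(n/13)\<close> in the claim are those for which the derivatives turn the two pure
  squares into \<open>Q(2z)\<close> and \<open>Q(13z)\<close>. The law of \<open>Q\<close> needs no
  lattice sum of its own: differentiate the law of \<open>P\<close> and apply Ramanujan's relation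
  again. The multiplier of a single \<open>\<eta>\<close> involves Dedekind sums. That of
  \<open>\<eta>^2\<close> is a 12th root of unity whose exponent is a polynomial modulo 12, so all
  identities between multipliers reduce to finite checks modulo 3 and 4. A second gap separates
  \<open>\<eta>\<close> as an analytic function from the truncated formal products defining the
  \<open>c_i\<close>. Both obey the recurrence \<open>m a(m) = \<Sum> h(k) a(m - k)\<close> given by
  the logarithmic derivative, which determines the coefficients from \<open>a(0) = 1\<close>; the
  same recurrence certifies the tables of the first 29 coefficients.\<close>

definition divisors_upto :: "nat \<Rightarrow> nat set" where
  "divisors_upto n = {d \<in> {1..n}. d dvd n}"

lemma finite_divisors_upto [simp]: "finite (divisors_upto n)"
  by (simp add: divisors_upto_def)

lemma sigma_nat_altdef: "sigma_nat k n = (\<Sum>d\<in>divisors_upto n. d ^ k)"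
  by (simp add: sigma_nat_def divisors_upto_def)

lemma sigma_nat_0_right [simp]: "sigma_nat k 0 = 0"
  by (simp add: sigma_nat_def)

section \<open>Liouville's method on the solutions of \<open>a x + b y = n\<close>\<close>

definition prod_sum_reps :: "nat \<Rightarrow> (nat \<times> nat \<times> nat \<times> nat) set" where
  "prod_sum_reps n = {(a, b, x, y). a \<ge> 1 \<and> b \<ge> 1 \<and> x \<ge> 1 \<and> y \<ge> 1 \<and> a * x + b * y = n}"

lemma finite_prod_sum_reps [simp]: "finite (prod_sum_reps n)"
proof (rule finite_subset)
  show "prod_sum_reps n \<subseteq> {..n} \<times> {..n} \<times> {..n} \<times> {..n}"
  proof
    fix v assume "v \<in> prod_sum_reps n"
    then obtain a b x y where v: "v = (a, b, x, y)" and *: "a \<ge> 1" "b \<ge> 1" "x \<ge> 1" "y \<ge> 1" "a * x + b * y = n"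
      by (auto simp: prod_sum_reps_def)
    then have "a * 1 \<le> a * x" "1 * x \<le> a * x" "b * 1 \<le> b * y" "1 * y \<le> b * y"
      by (auto intro!: mult_le_mono)
    with *(5) have "a \<le> n \<and> b \<le> n \<and> x \<le> n \<and> y \<le> n"
      unfolding mult_1 mult_1_right by linarith
    with v show "v \<in> {..n} \<times> {..n} \<times> {..n} \<times> {..n}"
      by simp
  qed
qed auto

text \<open>The condition \<open>p\<close> sees all four variables but the weight \<open>h\<close>
  only \<open>a\<close> and \<open>b\<close>: the shear below trades a condition on
  \<open>x\<close>, \<open>y\<close> for one on \<open>a\<close>, \<open>b\<close>, so weights in
  \<open>x\<close>, \<open>y\<close> never occur.\<close>

abbreviation rep_sum :: "nat \<Rightarrow> (nat \<Rightarrow> nat \<Rightarrow> nat \<Rightarrow> nat \<Rightarrow> bool) \<Rightarrow> (nat \<Rightarrow> nat \<Rightarrow> int) \<Rightarrow> int" where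
  "rep_sum n p h \<equiv> (\<Sum>(a, b, x, y) \<in> {(a, b, x, y) \<in> prod_sum_reps n. p a b x y}. h a b)"

lemma rep_sum_swap:
  "rep_sum n p h = rep_sum n (\<lambda>a b x y. p b a y x) (\<lambda>a b. h b a)"
  by (rule sum.reindex_bij_witness[where i = "\<lambda>(a, b, x, y). (b, a, y, x)"
        and j = "\<lambda>(a, b, x, y). (b, a, y, x)"])
     (auto simp: prod_sum_reps_def add.commute)

text \<open>The Euclidean step \<open>a x + b y = a (x - y) + (a + b) y\<close>.\<close>
lemma rep_sum_shear:
  "rep_sum n (\<lambda>a b x y. x > y) h = rep_sum n (\<lambda>a b x y. a > b) (\<lambda>a b. h b (a - b))"
proof (rule sum.reindex_bij_witness[where i = "\<lambda>(a, b, x, y). (b, a - b, x + y, x)"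
        and j = "\<lambda>(a, b, x, y). (a + b, a, y, x - y)"], goal_cases)
  case (2 v)
  then obtain a b x y where v: "v = (a, b, x, y)" "a \<ge> 1" "b \<ge> 1" "y \<ge> 1" "x > y"
    "a * x + b * y = n"
    by (auto simp: prod_sum_reps_def)
  have "a * (y + (x - y)) + b * y = n" using v by simp
  then have "(a + b) * y + a * (x - y) = n"
    by (simp only: algebra_simps)
  then show ?case using v by (auto simp: prod_sum_reps_def)
next
  case (4 v)
  then obtain a b x y where v: "v = (a, b, x, y)" "b \<ge> 1" "x \<ge> 1" "y \<ge> 1" "a > b"
    "a * x + b * y = n"
    by (auto simp: prod_sum_reps_def)
  have "(b + (a - b)) * x + b * y = n" using v by simp
  then have "b * (x + y) + (a - b) * x = n"
    by (simp only: algebra_simps)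
  then show ?case using v by (auto simp: prod_sum_reps_def)
qed auto

lemma rep_sum_split3:
  fixes h :: "nat \<Rightarrow> nat \<Rightarrow> int" and u v :: "nat \<Rightarrow> nat \<Rightarrow> nat \<Rightarrow> nat \<Rightarrow> nat"
  shows "rep_sum n (\<lambda>a b x y. True) h =
    rep_sum n (\<lambda>a b x y. u a b x y > v a b x y) h +
    rep_sum n (\<lambda>a b x y. u a b x y < v a b x y) h +
    rep_sum n (\<lambda>a b x y. u a b x y = v a b x y) h"
proof -
  have *: "finite {(a, b, x, y) \<in> prod_sum_reps n. p a b x y}" for p
    by (rule finite_subset[OF _ finite_prod_sum_reps[of n]]) auto
  have "{(a, b, x, y) \<in> prod_sum_reps n. True} =
     ({(a, b, x, y) \<in> prod_sum_reps n. u a b x y > v a b x y} \<union>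
      {(a, b, x, y) \<in> prod_sum_reps n. u a b x y < v a b x y}) \<union>
      {(a, b, x, y) \<in> prod_sum_reps n. u a b x y = v a b x y}"
    by auto
  then show ?thesis
    using * by (subst \<open>_ = _\<close>, subst sum.union_disjoint, simp, simp, force,
        subst sum.union_disjoint) auto
qed

text \<open>Under the shear, \<open>f (a + b)\<close> on \<open>x > y\<close> becomes
  \<open>f a\<close> on \<open>a > b\<close>, and \<open>f\<close> of the distance of
  \<open>a\<close> and \<open>b\<close> on \<open>a > b\<close> comes from \<open>f b\<close> on
  \<open>x > y\<close>. The sums of \<open>f a\<close> over strict regions are then compared by
  splitting its full sum once by \<open>a\<close> against \<open>b\<close> and once by
  \<open>x\<close> against \<open>y\<close>, so only the two diagonals survive. Evaluating
  \<open>f\<close> at an absolute value replaces Liouville's condition that \<open>f\<close> be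
  even.\<close>

lemma liouville_identity:
  fixes f :: "nat \<Rightarrow> int"
  shows "rep_sum n (\<lambda>a b x y. True) (\<lambda>a b. f (a + b) - f (nat \<bar>int a - int b\<bar>)) =
     rep_sum n (\<lambda>a b x y. x = y) (\<lambda>a b. f (a + b) + 2 * f a)
     - rep_sum n (\<lambda>a b x y. a = b) (\<lambda>a b. f 0 + 2 * f a)"
proof -
  note sh = rep_sum_shear[where n = n]
  let ?all = "\<lambda>a b x y :: nat. True" and ?ag = "\<lambda>a b x y :: nat. a > b" and ?al = "\<lambda>a b x y :: nat. a < b"
    and ?xg = "\<lambda>a b x y :: nat. x > y" and ?xl = "\<lambda>a b x y :: nat. x < y"
    and ?ae = "\<lambda>a b x y :: nat. a = b" and ?xe = "\<lambda>a b x y :: nat. x = y"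
  have sa: "rep_sum n ?all h = rep_sum n ?ag h + rep_sum n ?al h + rep_sum n ?ae h" for h
    by (rule rep_sum_split3)
  have sx: "rep_sum n ?all h = rep_sum n ?xg h + rep_sum n ?xl h + rep_sum n ?xe h" for h
    by (rule rep_sum_split3)
  have swx: "rep_sum n ?xl h = rep_sum n ?xg (\<lambda>a b. h b a)" for h
    by (rule rep_sum_swap)
  have swa: "rep_sum n ?al h = rep_sum n ?ag (\<lambda>a b. h b a)" for h
    by (rule rep_sum_swap)
  have 1: "rep_sum n ?xg (\<lambda>a b. f (a + b)) = rep_sum n ?ag (\<lambda>a b. f a)"
    by (subst sh) (auto intro!: sum.cong)
  have 2: "rep_sum n ?all (\<lambda>a b. f (a + b)) = 2 * rep_sum n ?ag (\<lambda>a b. f a) + rep_sum n ?xe (\<lambda>a b. f (a + b))"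
    using sx[of "\<lambda>a b. f (a + b)"] swx[of "\<lambda>a b. f (a + b)"] 1 by (simp add: add.commute)
  have 3: "rep_sum n ?ag (\<lambda>a b. f (nat \<bar>int a - int b\<bar>)) = rep_sum n ?xg (\<lambda>a b. f b)"
    by (subst sh) (auto intro!: sum.cong arg_cong[where f = f])
  have 4: "rep_sum n ?ae (\<lambda>a b. f (nat \<bar>int a - int b\<bar>)) = rep_sum n ?ae (\<lambda>a b. f 0)"
    by (rule sum.cong) auto
  have 5: "rep_sum n ?all (\<lambda>a b. f (nat \<bar>int a - int b\<bar>)) =
      2 * rep_sum n ?xl (\<lambda>a b. f a) + rep_sum n ?ae (\<lambda>a b. f 0)"
    using sa[of "\<lambda>a b. f (nat \<bar>int a - int b\<bar>)"] swa[of "\<lambda>a b. f (nat \<bar>int a - int b\<bar>)"] 3 4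
       swx[of "\<lambda>a b. f a"]
    by (simp add: abs_minus_commute)
  have 6: "rep_sum n ?xg (\<lambda>a b. f a) = rep_sum n ?al (\<lambda>a b. f a)"
    by (subst sh, subst swa) simp
  have 7: "rep_sum n ?xl (\<lambda>a b. f a) + rep_sum n ?xe (\<lambda>a b. f a) =
        rep_sum n ?ag (\<lambda>a b. f a) + rep_sum n ?ae (\<lambda>a b. f a)"
    using sa[of "\<lambda>a b. f a"] sx[of "\<lambda>a b. f a"] 6 by simp
  have d: "rep_sum n p (\<lambda>a b. g a b - h a b) = rep_sum n p g - rep_sum n p h" for p g h
    by (simp add: case_prod_unfold sum_subtractf)
  have s: "rep_sum n p (\<lambda>a b. g a b + 2 * h a b) = rep_sum n p g + 2 * rep_sum n p h" for p g h
    by (simp add: case_prod_unfold sum.distrib sum_distrib_left)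
  show ?thesis
    unfolding d s using 2 5 7 by simp
qed

text \<open>On \<open>a = b = d\<close> the equation reads \<open>d (x + y) = n\<close>, so
  \<open>d\<close> divides \<open>n\<close> and \<open>x\<close> has \<open>n div d - 1\<close>
  choices.\<close>

lemma rep_sum_eq_left:
  "rep_sum n (\<lambda>a b x y. a = b) h = (\<Sum>d\<in>divisors_upto n. (int n div int d - 1) * h d d)"
proof -
  have "rep_sum n (\<lambda>a b x y. a = b) h = (\<Sum>(d, l)\<in>Sigma (divisors_upto n) (\<lambda>d. {1..<n div d}). h d d)"
  proof (rule sum.reindex_bij_witness[where i = "\<lambda>(d, l). (d, d, l, n div d - l)"
        and j = "\<lambda>(a, b, x, y). (a, x)"], goal_cases)
    case (1 v)
    then obtain a x y where v: "v = (a, a, x, y)" "a \<ge> 1" "x \<ge> 1" "y \<ge> 1" "a * x + a * y = n"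
      by (auto simp: prod_sum_reps_def)
    have "n = a * (x + y)" using v by (simp add: algebra_simps)
    then have "n div a = x + y" using v by simp
    then show ?case using v by simp
  next
    case (2 v)
    then obtain a x y where v: "v = (a, a, x, y)" "a \<ge> 1" "x \<ge> 1" "y \<ge> 1" "a * x + a * y = n"
      by (auto simp: prod_sum_reps_def)
    have *: "n = a * (x + y)" using v by (simp add: algebra_simps)
    then have "n div a = x + y" using v by simp
    moreover have "a \<le> a * (x + y)" using v by simp
    ultimately show ?case using v * by (auto simp: divisors_upto_def)
  next
    case (4 v)
    then obtain d l where v: "v = (d, l)" "d \<ge> 1" "d dvd n" "l \<ge> 1" "l < n div d"
      by (auto simp: divisors_upto_def)
    have "d * (l + (n div d - l)) = n" using v by simp
    then show ?case using v by (auto simp: prod_sum_reps_def algebra_simps)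
  qed (auto simp: divisors_upto_def)
  also have "\<dots> = (\<Sum>d\<in>divisors_upto n. \<Sum>l\<in>{1..<n div d}. h d d)"
    by (subst sum.Sigma) auto
  also have "\<dots> = (\<Sum>d\<in>divisors_upto n. (int n div int d - 1) * h d d)"
  proof (rule sum.cong[OF refl])
    fix d assume "d \<in> divisors_upto n"
    then have "d \<ge> 1" "d dvd n" "n \<ge> 1" by (auto simp: divisors_upto_def)
    then have "n div d \<ge> 1"
      by (metis One_nat_def Suc_leI dvd_div_eq_0_iff not_gr0 not_one_le_zero)
    then show "(\<Sum>l\<in>{1..<n div d}. h d d) = (int n div int d - 1) * h d d"
      by (simp add: of_nat_diff zdiv_int)
  qed
  finally show ?thesis .
qed

text \<open>Dually, \<open>x = y\<close> makes \<open>d = a + b\<close> a divisor of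
  \<open>n\<close>, and \<open>a\<close> runs through \<open>1, ..., d - 1\<close>.\<close>

lemma rep_sum_eq_right:
  "rep_sum n (\<lambda>a b x y. x = y) h = (\<Sum>d\<in>divisors_upto n. \<Sum>l\<in>{1..<d}. h l (d - l))"
proof -
  have "rep_sum n (\<lambda>a b x y. x = y) h = (\<Sum>(d, l)\<in>Sigma (divisors_upto n) (\<lambda>d. {1..<d}). h l (d - l))"
  proof (rule sum.reindex_bij_witness[where i = "\<lambda>(d, l). (l, d - l, n div d, n div d)"
        and j = "\<lambda>(a, b, x, y). (a + b, a)"], goal_cases)
    case (1 v)
    then obtain a b x where v: "v = (a, b, x, x)" "a \<ge> 1" "x \<ge> 1" "b \<ge> 1" "a * x + b * x = n"
      by (auto simp: prod_sum_reps_def)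
    have "n = (a + b) * x" using v by (simp add: algebra_simps)
    then have "n div (a + b) = x" using v by (metis add_gr_0 div_mult_self1_is_m less_le_trans zero_less_one)
    then show ?case using v by simp
  next
    case (2 v)
    then obtain a b x where v: "v = (a, b, x, x)" "a \<ge> 1" "x \<ge> 1" "b \<ge> 1" "a * x + b * x = n"
      by (auto simp: prod_sum_reps_def)
    have *: "n = (a + b) * x" using v by (simp add: algebra_simps)
    moreover have "a + b \<le> (a + b) * x" using v by simp
    ultimately show ?case using v unfolding divisors_upto_def by simp
  next
    case (4 v)
    then obtain d l where v: "v = (d, l)" "d \<ge> 1" "d dvd n" "l \<ge> 1" "l < d" "d \<le> n"
      by (auto simp: divisors_upto_def)
    have "(l + (d - l)) * (n div d) = n" using v by simp
    then have "l * (n div d) + (d - l) * (n div d) = n"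
      by (simp only: add_mult_distrib)
    moreover have "n div d \<ge> 1" using v by (simp add: div_greater_zero_iff Suc_leI)
    ultimately show ?case using v by (auto simp: prod_sum_reps_def)
  qed (auto simp: divisors_upto_def)
  then show ?thesis by (subst sum.Sigma) auto
qed

text \<open>Group the solutions by \<open>k = a x\<close>: then \<open>a\<close> is any divisor of
  \<open>k\<close> and \<open>b\<close> any divisor of \<open>n - k\<close>, and these determine
  \<open>x\<close> and \<open>y\<close>.\<close>

lemma rep_sum_prod:
  "rep_sum n (\<lambda>a b x y. True) (\<lambda>a b. int a * int b) = (\<Sum>k\<le>n. int (sigma_nat 1 k * sigma_nat 1 (n - k)))"
proof -
  have "rep_sum n (\<lambda>a b x y. True) (\<lambda>a b. int a * int b) =
      (\<Sum>(k, a, b)\<in>Sigma {..n} (\<lambda>k. divisors_upto k \<times> divisors_upto (n - k)). int a * int b)"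
  proof (rule sum.reindex_bij_witness[where i = "\<lambda>(k, a, b). (a, b, k div a, (n - k) div b)"
        and j = "\<lambda>(a, b, x, y). (a * x, a, b)"], goal_cases)
    case (1 v)
    then show ?case by (auto simp: prod_sum_reps_def)
  next
    case (2 v)
    then show ?case by (auto simp: prod_sum_reps_def divisors_upto_def)
  next
    case (4 v)
    then obtain k a b where v: "v = (k, a, b)" "k \<le> n" "a \<ge> 1" "a dvd k" "a \<le> k" "b \<ge> 1" "b \<le> n - k" "b dvd n - k"
      by (auto simp: divisors_upto_def)
    then show ?case by (auto simp: prod_sum_reps_def div_greater_zero_iff Suc_leI)
  qed (auto simp: divisors_upto_def)
  also have "\<dots> = (\<Sum>k\<le>n. \<Sum>(a, b)\<in>divisors_upto k \<times> divisors_upto (n - k). int a * int b)"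
    by (subst sum.Sigma) auto
  also have "\<dots> = (\<Sum>k\<le>n. int (sigma_nat 1 k * sigma_nat 1 (n - k)))"
    by (intro sum.cong refl)
       (simp add: sigma_nat_altdef sum_product sum.cartesian_product case_prod_unfold)
  finally show ?thesis .
qed

lemma sum_squares_below: "6 * (\<Sum>l = 1..<d. int l ^ 2) = 2 * int d ^ 3 - 3 * int d ^ 2 + int d"
proof (induction d)
  case (Suc d)
  then show ?case
    by (cases d) (auto simp: power2_eq_square power3_eq_cube algebra_simps)
qed simp

text \<open>Liouville's identity for \<open>f t = t^2\<close>, where the left side is the sum of
  \<open>4 a b\<close>. Both diagonals produce sums of squares of divisors, and these
  cancel.\<close>

theorem sigma_convolution:
  "12 * (\<Sum>k\<le>n. int (sigma_nat 1 k * sigma_nat 1 (n - k))) =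
     5 * int (sigma_nat 3 n) + (1 - 6 * int n) * int (sigma_nat 1 n)"
proof -
  let ?D = "divisors_upto n"
  let ?S = "\<lambda>k. \<Sum>d\<in>?D. int d ^ k"
  have sg: "int (sigma_nat k n) = ?S k" for k by (simp add: sigma_nat_altdef)
  have "rep_sum n (\<lambda>a b x y. True) (\<lambda>a b. 4 * (int a * int b)) =
     rep_sum n (\<lambda>a b x y. True) (\<lambda>a b. int (a + b) ^ 2 - int (nat \<bar>int a - int b\<bar>) ^ 2)"
    by (intro sum.cong) (auto simp: power2_eq_square algebra_simps)
  then have "rep_sum n (\<lambda>a b x y. True) (\<lambda>a b. 4 * (int a * int b)) =
     rep_sum n (\<lambda>a b x y. x = y) (\<lambda>a b. int (a + b) ^ 2 + 2 * int a ^ 2)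
     - rep_sum n (\<lambda>a b x y. a = b) (\<lambda>a b. 2 * int a ^ 2)"
    using liouville_identity[where f = "\<lambda>t. int t ^ 2" and n = n] by simp
  moreover have "rep_sum n (\<lambda>a b x y. True) (\<lambda>a b. 4 * (int a * int b)) =
       4 * rep_sum n (\<lambda>a b x y. True) (\<lambda>a b. int a * int b)"
    by (simp add: case_prod_unfold sum_distrib_left)
  moreover have "3 * rep_sum n (\<lambda>a b x y. x = y) (\<lambda>a b. int (a + b) ^ 2 + 2 * int a ^ 2) =
      5 * ?S 3 - 6 * ?S 2 + ?S 1"
  proof -
    have "3 * (\<Sum>l = 1..<d. int (l + (d - l)) ^ 2 + 2 * int l ^ 2) = 5 * int d ^ 3 - 6 * int d ^ 2 + int d"
      if "d \<in> ?D" for d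
    proof -
      have "(\<Sum>l = 1..<d. int (l + (d - l)) ^ 2 + 2 * int l ^ 2) = (\<Sum>l = 1..<d. int d ^ 2 + 2 * int l ^ 2)"
        by (intro sum.cong) auto
      also have "\<dots> = (int d - 1) * int d ^ 2 + 2 * (\<Sum>l = 1..<d. int l ^ 2)"
        using that by (simp add: sum.distrib sum_distrib_left divisors_upto_def of_nat_diff)
      finally show ?thesis using sum_squares_below[of d]
        by (simp add: algebra_simps power2_eq_square power3_eq_cube)
    qed
    then show ?thesis
      unfolding rep_sum_eq_right sum_distrib_left[of 3]
      by (simp add: sum.distrib sum_subtractf sum_distrib_left)
  qed
  moreover have "rep_sum n (\<lambda>a b x y. a = b) (\<lambda>a b. 2 * int a ^ 2) = 2 * int n * ?S 1 - 2 * ?S 2"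
  proof -
    have "(int n div int d - 1) * (2 * int d ^ 2) = 2 * int n * int d - 2 * int d ^ 2"
      if "d \<in> ?D" for d
    proof -
      from that obtain k where "n = d * k" "d \<ge> 1" by (auto simp: divisors_upto_def)
      then show ?thesis by (simp add: algebra_simps power2_eq_square)
    qed
    then show ?thesis
      unfolding rep_sum_eq_left by (simp add: sum_subtractf sum_distrib_left)
  qed
  ultimately show ?thesis
    unfolding rep_sum_prod[symmetric] sg by (simp add: algebra_simps)
qed

section \<open>Partial fractions of the cotangent\<close>

text \<open>The logarithmic derivative of Euler's reflection formula
  \<open>Gamma w * Gamma (1 - w) = pi / sin (pi * w)\<close>.\<close>

lemma Digamma_reflection:
  fixes w :: complex
  assumes w: "w \<notin> \<int>"
  shows "Digamma w - Digamma (1 - w) = - (pi * cot (pi * w))"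
proof -
  have 1: "w \<notin> \<int>\<^sub>\<le>\<^sub>0" using w by (auto simp: nonpos_Ints_def)
  have 2: "1 - w \<notin> \<int>\<^sub>\<le>\<^sub>0"
  proof
    assume "1 - w \<in> \<int>\<^sub>\<le>\<^sub>0"
    then obtain n where "1 - w = of_int n" by (elim nonpos_Ints_cases)
    then have "w = of_int (1 - n)" by (simp add: algebra_simps)
    then show False using w by (metis Ints_of_int)
  qed
  have s: "sin (of_real pi * w) \<noteq> 0"
  proof
    assume "sin (of_real pi * w) = 0"
    then obtain n where "of_real pi * w = of_real (real_of_int n * pi)"
      unfolding sin_eq_0 by auto
    then have "w = of_int n" by simp
    then show False using w by simp
  qed
  have "((\<lambda>u. Gamma u * Gamma (1 - u)) has_field_derivative
      (Gamma w * Gamma (1 - w) * (Digamma w - Digamma (1 - w)))) (at w)"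
    using 1 2 by (auto intro!: derivative_eq_intros simp: algebra_simps)
  moreover have "((\<lambda>u. of_real pi / sin (of_real pi * u)) has_field_derivative
      (of_real pi / sin (of_real pi * w) * - (pi * cot (pi * w)))) (at w)"
    using s by (auto intro!: derivative_eq_intros simp: cot_def power2_eq_square field_simps)
  ultimately have "Gamma w * Gamma (1 - w) * (Digamma w - Digamma (1 - w)) =
       of_real pi / sin (of_real pi * w) * - (pi * cot (pi * w))"
    unfolding Gamma_reflection_complex by (rule DERIV_unique)
  then have "of_real pi / sin (of_real pi * w) * (Digamma w - Digamma (1 - w)) =
       of_real pi / sin (of_real pi * w) * - (pi * cot (pi * w))"
    unfolding Gamma_reflection_complex .
  then show ?thesis
    using s unfolding mult_cancel_left by simp
qed

lemma sums_cot_pfd: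
  fixes w :: complex
  assumes w: "w \<notin> \<int>"
  shows "(\<lambda>k. inverse (w + of_nat (Suc k)) + inverse (w - of_nat (Suc k))) sums (pi * cot (pi * w) - inverse w)"
proof -
  have w0: "w \<noteq> 0" "1 - w \<noteq> 0" using w by auto
  have D: "(\<lambda>n. inverse (of_nat (n + 1)) - inverse (u + of_nat n)) sums (Digamma u + euler_mascheroni)"
    if "u \<noteq> 0" for u :: complex
    using summable_Digamma[OF that] by (simp add: Digamma_def summable_sums)
  have "(\<lambda>n. inverse (1 - w + of_nat n) - inverse (w + of_nat n)) sums (- (pi * cot (pi * w)))"
    using sums_diff[OF D[OF w0(1)] D[OF w0(2)]] Digamma_reflection[OF w] by simp
  have 1: "(\<lambda>n. inverse (w + of_nat n) + inverse (w - of_nat (Suc n))) sums (pi * cot (pi * w))"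
  proof -
    have "- (inverse (1 - w + of_nat n) - inverse (w + of_nat n)) =
       inverse (w + of_nat n) + inverse (w - of_nat (Suc n))" for n
    proof -
      have "1 - w + of_nat n = - (w - of_nat (Suc n))" by simp
      then show ?thesis by (metis inverse_minus_eq add.commute minus_diff_eq diff_minus_eq_add)
    qed
    with sums_minus[OF \<open>_ sums (- (pi * cot (pi * w)))\<close>] show ?thesis by (simp only: minus_minus)
  qed
  \<comment> \<open>The two Digamma series pair \<open>w + n\<close> with
    \<open>w - (n + 1)\<close>. Adding a telescoping series with sum \<open>- 1 / w\<close> shifts
    the first index by one and removes the term at \<open>0\<close>.\<close>
  have "(\<lambda>n. inverse (w + of_nat n)) \<longlonglongrightarrow> 0"
    by (intro tendsto_inverse_0[THEN filterlim_compose]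
          tendsto_add_filterlim_at_infinity[OF tendsto_const] tendsto_of_nat)
  then have "(\<lambda>n. inverse (w + of_nat (Suc n)) - inverse (w + of_nat n)) sums (0 - inverse (w + of_nat 0))"
    by (rule telescope_sums)
  from sums_add[OF 1 this] show ?thesis
    by (simp add: algebra_simps)
qed

lemma norm_summable_cot_pfd:
  fixes w :: complex
  shows "summable (\<lambda>k. norm (inverse (w + of_nat (Suc k)) + inverse (w - of_nat (Suc k))))"
proof (rule summable_comparison_test_ev)
  have "summable (\<lambda>n. inverse (real n ^ 2))"
    by (rule inverse_power_summable) auto
  then have "summable (\<lambda>n. inverse (real (Suc n) ^ 2))"
    by (subst summable_Suc_iff)
  then show "summable (\<lambda>n. 4 * norm w * inverse (real (Suc n) ^ 2))"
    by (rule summable_mult)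
  show "\<forall>\<^sub>F n in sequentially. norm (norm (inverse (w + of_nat (Suc n)) + inverse (w - of_nat (Suc n))))
      \<le> 4 * norm w * inverse (real (Suc n) ^ 2)"
    using eventually_gt_at_top[of "nat \<lceil>2 * norm w\<rceil>"]
  proof eventually_elim
    case (elim n)
    define N where "N = Suc n"
    have N: "real N \<ge> 2 * norm w" "N > 0" using elim unfolding N_def by linarith+
    have ne: "w + of_nat N \<noteq> 0" "w - of_nat N \<noteq> 0"
    proof -
      have "norm w < real N" using N by (smt (verit) norm_ge_zero of_nat_0_less_iff)
      then have "norm w \<noteq> norm (of_nat N :: complex)" by simp
      then show "w + of_nat N \<noteq> 0" "w - of_nat N \<noteq> 0"
        by (metis add_eq_0_iff2 norm_minus_cancel, metis eq_iff_diff_eq_0)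
    qed
    have "norm (w ^ 2) \<le> real N ^ 2 / 4"
      using power_mono[OF N(1), of 2] by (simp add: norm_power power_mult_distrib)
    moreover have "real N ^ 2 - norm (w ^ 2) \<le> norm (w ^ 2 - of_nat N ^ 2)"
      using norm_triangle_ineq2[of "of_nat N ^ 2" "w ^ 2"] by (simp add: norm_minus_commute norm_power)
    ultimately have *: "norm (w ^ 2 - of_nat N ^ 2) \<ge> real N ^ 2 / 2" 
      using zero_le_power2[of "real N"] by linarith
    have "inverse (w + of_nat N) + inverse (w - of_nat N) = 2 * w / (w ^ 2 - of_nat N ^ 2)"
    proof -
      have "w ^ 2 - of_nat N ^ 2 = (w + of_nat N) * (w - of_nat N)"
        by (simp add: power2_eq_square algebra_simps)
      moreover have "inverse a + inverse b = (a + b) / (a * b)" if "a \<noteq> 0" "b \<noteq> 0" for a b :: complex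
        using that by (simp add: field_simps)
      ultimately show ?thesis using ne by simp
    qed
    also have "norm \<dots> \<le> 2 * norm w / (real N ^ 2 / 2)"
      unfolding norm_divide norm_mult using * N by (intro frac_le) auto
    finally show ?case by (simp add: N_def field_simps)
  qed
qed

section \<open>Unordered sums over the positive integers and over all integers\<close>

lemma has_sum_from_1_iff:
  "(f has_sum S) {1::nat..} \<longleftrightarrow> ((\<lambda>k. f (Suc k)) has_sum S) UNIV"
proof -
  have "bij_betw Suc UNIV {1..}"
    by (rule bij_betwI[of _ _ _ "\<lambda>k. k - 1"]) auto
  from has_sum_reindex_bij_betw[OF this, of f S] show ?thesis by simp
qed

lemma has_sum_cot_pfd:
  fixes w :: complex
  assumes w: "w \<notin> \<int>"
  shows "((\<lambda>m. inverse (w + of_nat m) + inverse (w - of_nat m)) has_sum (pi * cot (pi * w) - inverse w)) {1..}"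
  unfolding has_sum_from_1_iff
  by (rule norm_summable_imp_has_sum[OF norm_summable_cot_pfd sums_cot_pfd[OF w]])

lemma has_sum_UNIV_int:
  fixes f :: "int \<Rightarrow> 'a :: real_normed_vector"
  assumes "((\<lambda>n. f (int n)) has_sum A) UNIV" "((\<lambda>n. f (- int n - 1)) has_sum B) UNIV"
  shows "(f has_sum (A + B)) UNIV"
proof -
  have "bij_betw int UNIV {0..}"
    by (rule bij_betwI[of _ _ _ nat]) auto
  from has_sum_reindex_bij_betw[OF this, of f A] have "(f has_sum A) {0..}" using assms by simp
  moreover have "bij_betw (\<lambda>n. - int n - 1) UNIV {..<0}"
    by (rule bij_betwI[of _ _ _ "\<lambda>n. nat (- n - 1)"]) auto
  from has_sum_reindex_bij_betw[OF this, of f B] have "(f has_sum B) {..<0}" using assms by simp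
  ultimately have "(f has_sum (A + B)) ({0..} \<union> {..<0})"
    by (intro has_sum_Un_disjoint) auto
  also have "{0..} \<union> {..<0::int} = UNIV" by auto
  finally show ?thesis .
qed

text \<open>Limits at both ends alone give only conditional convergence, hence the summability
  hypothesis; granted it, both half sums are read off from partial sums.\<close>

lemma has_sum_telescope_int:
  fixes g :: "int \<Rightarrow> complex"
  assumes sum: "(\<lambda>n. g n - g (n + 1)) summable_on UNIV"
    and R: "(\<lambda>n. g (int n)) \<longlonglongrightarrow> R" and L: "(\<lambda>n. g (- int n)) \<longlonglongrightarrow> L"
  shows "((\<lambda>n. g n - g (n + 1)) has_sum (L - R)) UNIV"
proof -
  let ?f = "\<lambda>n. g n - g (n + 1)"
  have "((\<lambda>n. ?f (int n)) has_sum (g 0 - R)) UNIV"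
  proof -
    have "?f summable_on range int" using sum by (rule summable_on_subset) auto
    then have "(\<lambda>n. ?f (int n)) summable_on UNIV"
      using summable_on_reindex[of int UNIV ?f] by (simp add: o_def)
    then obtain S where S: "((\<lambda>n. ?f (int n)) has_sum S) UNIV" by (auto simp: summable_on_def)
    have "(\<lambda>n. g (int n) - g (int (Suc n))) sums (g (int 0) - R)"
      by (rule telescope_sums'[OF R])
    then have "(\<lambda>n. ?f (int n)) sums (g 0 - R)"
      by (simp add: add.commute)
    with has_sum_imp_sums[OF S] have "S = g 0 - R" by (rule sums_unique2)
    with S show ?thesis by simp
  qed
  moreover have "((\<lambda>n. ?f (- int n - 1)) has_sum (L - g 0)) UNIV"
  proof -
    have "?f summable_on range (\<lambda>n. - int n - 1)" using sum by (rule summable_on_subset) auto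
    then have "(\<lambda>n. ?f (- int n - 1)) summable_on UNIV"
      using summable_on_reindex[of "\<lambda>n. - int n - 1" UNIV ?f] by (simp add: o_def inj_on_def)
    then obtain S where S: "((\<lambda>n. ?f (- int n - 1)) has_sum S) UNIV" by (auto simp: summable_on_def)
    have "(\<lambda>n. g (- int (Suc n)) - g (- int n)) sums (L - g (- int 0))"
      by (rule telescope_sums[OF L])
    moreover have "g (- int (Suc n)) - g (- int n) = ?f (- int n - 1)" for n
      by (intro arg_cong2[where f = "(-)"] arg_cong[where f = g]) auto
    ultimately have "(\<lambda>n. ?f (- int n - 1)) sums (L - g (- int 0))"
      by (simp only:)
    then have "(\<lambda>n. ?f (- int n - 1)) sums (L - g 0)"
      by (simp only: of_nat_0 minus_zero)
    with has_sum_imp_sums[OF S] have "S = L - g 0" by (rule sums_unique2)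
    with S show ?thesis by simp
  qed
  ultimately have "(?f has_sum (g 0 - R + (L - g 0))) UNIV"
    by (rule has_sum_UNIV_int)
  then show ?thesis by (simp add: algebra_simps)
qed

lemma Im_not_0_not_Ints: "Im w \<noteq> 0 \<Longrightarrow> w \<notin> \<int>"
  by (auto elim!: Ints_cases)

section \<open>The nome and Lipschitz's formula\<close>

definition nome :: "complex \<Rightarrow> complex" where "nome z = exp (2 * pi * \<i> * z)"

lemma norm_nome: "norm (nome z) = exp (- 2 * pi * Im z)"
  by (simp add: nome_def)

lemma nome_nonzero [simp]: "nome z \<noteq> 0"
  by (simp add: nome_def)

lemma norm_nome_less_1: "Im z > 0 \<Longrightarrow> norm (nome z) < 1"
  by (simp add: norm_nome)

lemma nome_of_nat_mult: "nome (of_nat m * z) = nome z ^ m"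
  unfolding nome_def exp_of_nat_mult[symmetric] by (simp add: mult_ac)

lemma cot_eq_nome:
  fixes w :: complex
  assumes "Im w > 0"
  shows "cot (pi * w) = - \<i> * (1 + nome w) / (1 - nome w)"
proof -
  define E where "E = exp (\<i> * (pi * w))"
  have E: "E \<noteq> 0" "nome w = E ^ 2"
    by (simp_all add: E_def nome_def flip: exp_of_nat_mult) (simp add: mult_ac)
  have "E ^ 2 \<noteq> 1" using norm_nome_less_1[OF assms] E by auto
  then have *: "E * E - 1 \<noteq> 0" "1 - E ^ 2 \<noteq> 0" by (auto simp: power2_eq_square)
  have "cot (pi * w) = cos (pi * w) / sin (pi * w)" by (simp add: cot_def)
  also have "\<dots> = ((E + inverse E) / 2) / ((E - inverse E) / (2 * \<i>))"
    by (simp add: cos_exp_eq sin_exp_eq E_def exp_minus field_simps)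
  also have "\<dots> = \<i> * (E * E + 1) / (E * E - 1)"
    using E(1) * by (simp add: divide_simps)
  also have "\<dots> = - \<i> * (1 + nome w) / (1 - nome w)"
    using * unfolding E(2) by (simp add: divide_simps power2_eq_square) (simp add: algebra_simps)
  finally show ?thesis .
qed

text \<open>The closed form of \<open>(2 \<pi> i)^2 \<Sum> k q^k\<close> over
  \<open>k \<ge> 1\<close>, with \<open>q = nome w\<close>.\<close>

definition lipschitz2 :: "complex \<Rightarrow> complex" where
  "lipschitz2 w = - 4 * pi ^ 2 * nome w / (1 - nome w) ^ 2"

text \<open>Differentiate the reflection formula of \<open>Digamma\<close>: its left side gives two
  Polygamma series, the halves \<open>n \<ge> 0\<close> and \<open>n < 0\<close> of the sum, and its
  right side becomes rational in the nome.\<close>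

lemma has_sum_lipschitz2:
  assumes w: "Im w > 0"
  shows "((\<lambda>n. inverse ((w + of_int n) ^ 2)) has_sum lipschitz2 w) UNIV"
proof -
  have op: "open {w. Im w > 0}" by (simp add: open_halfspace_Im_gt)
  have ni: "u \<notin> \<int>\<^sub>\<le>\<^sub>0 \<and> 1 - u \<notin> \<int>\<^sub>\<le>\<^sub>0" if "Im u > 0" for u
    using that by (auto elim!: nonpos_Ints_cases simp: complex_eq_iff)
  have "((\<lambda>u. Digamma u - Digamma (1 - u)) has_field_derivative (Polygamma 1 w + Polygamma 1 (1 - w))) (at w)"
    using ni[OF w] by (auto intro!: derivative_eq_intros)
  moreover have "((\<lambda>u. - (pi * cot (pi * u))) has_field_derivative (lipschitz2 w)) (at w)"
  proof -
    have ne: "1 - nome w \<noteq> 0" using norm_nome_less_1[OF w] by auto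
    have "((\<lambda>u. - (pi * (- \<i> * (1 + nome u) / (1 - nome u)))) has_field_derivative lipschitz2 w) (at w)"
      unfolding nome_def lipschitz2_def using ne[unfolded nome_def]
      by (auto intro!: derivative_eq_intros simp: field_simps power2_eq_square)
    then show ?thesis
      by (rule DERIV_cong_ev[THEN iffD1, OF refl _ refl, rotated])
         (use eventually_nhds_in_open[OF op, of w] w in \<open>auto elim!: eventually_mono simp: cot_eq_nome\<close>)
  qed
  then have "((\<lambda>u. Digamma u - Digamma (1 - u)) has_field_derivative (lipschitz2 w)) (at w)"
    by (rule DERIV_cong_ev[THEN iffD1, OF refl _ refl, rotated])
       (use eventually_nhds_in_open[OF op, of w] w in
         \<open>auto elim!: eventually_mono simp: Digamma_reflection Im_not_0_not_Ints\<close>)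
  ultimately have eq: "Polygamma 1 w + Polygamma 1 (1 - w) = lipschitz2 w"
    by (rule DERIV_unique)
  have P: "((\<lambda>k. inverse ((u + of_nat k) ^ 2)) has_sum Polygamma 1 u) UNIV" if "Im u \<noteq> 0" for u :: complex
  proof (rule norm_summable_imp_has_sum)
    have u: "u \<noteq> 0" using that by auto
    show "(\<lambda>k. inverse ((u + of_nat k) ^ 2)) sums Polygamma 1 u"
      using Polygamma_LIMSEQ[OF u, of 1] by (simp add: numeral_2_eq_2)
    have "summable (\<lambda>k. norm (inverse (u + of_nat k) ^ 2))"
    proof (rule summable_comparison_test_ev)
      have "summable (\<lambda>n. inverse (real n ^ 2))" by (rule inverse_power_summable) auto
      then show "summable (\<lambda>n. 4 * inverse (real n ^ 2))" by (rule summable_mult)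
      show "\<forall>\<^sub>F n in sequentially. norm (norm (inverse (u + of_nat n) ^ 2)) \<le> 4 * inverse (real n ^ 2)"
        using eventually_gt_at_top[of "nat \<lceil>2 * norm u\<rceil>"]
      proof eventually_elim
        case (elim n)
        then have n: "real n \<ge> 2 * norm u" "n > 0" by linarith+
        have "norm (u + of_nat n) \<ge> norm (of_nat n :: complex) - norm u"
          by (metis add.commute norm_diff_ineq)
        then have *: "norm (u + of_nat n) \<ge> real n / 2" using n by simp
        have "norm (inverse (u + of_nat n) ^ 2) = inverse (norm (u + of_nat n) ^ 2)"
          by (simp add: norm_inverse norm_power power_inverse)
        also have "\<dots> \<le> inverse ((real n / 2) ^ 2)"
          using n * by (intro le_imp_inverse_le power_mono) auto
        finally show ?case by (simp add: field_simps)
      qed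
    qed
    then show "summable (\<lambda>k. norm (inverse ((u + of_nat k) ^ 2)))" by (simp add: power_inverse)
  qed
  have "((\<lambda>n. inverse ((w + of_int n) ^ 2)) has_sum (Polygamma 1 w + Polygamma 1 (1 - w))) UNIV"
  proof (rule has_sum_UNIV_int)
    show "((\<lambda>n. inverse ((w + of_int (int n)) ^ 2)) has_sum Polygamma 1 w) UNIV"
      using P[of w] w by simp
    have "(w + of_int (- int n - 1)) ^ 2 = (1 - w + of_nat n) ^ 2" for n
      by (simp add: power2_eq_square algebra_simps)
    then show "((\<lambda>n. inverse ((w + of_int (- int n - 1)) ^ 2)) has_sum Polygamma 1 (1 - w)) UNIV"
      using P[of "1 - w"] w by simp
  qed
  then show ?thesis unfolding eq .
qed

section \<open>Serre's double series\<close>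

definition sigma_series :: "complex \<Rightarrow> complex" where
  "sigma_series q = (\<Sum>\<^sub>\<infinity>n. of_nat (sigma_nat 1 n) * q ^ n)"

section \<open>Lambert series\<close>

lemma has_sum_geometric_deriv:
  fixes q :: "'a :: {real_normed_field, banach}"
  assumes q: "norm q < 1"
  shows "((\<lambda>k. of_nat k * q ^ k) has_sum (q / (1 - q) ^ 2)) UNIV"
proof (rule norm_summable_imp_has_sum)
  have *: "(\<lambda>k. of_nat k * q ^ k) sums (q / (1 - q) ^ 2)" if "norm q < 1" for q :: "'b :: {real_normed_field, banach}"
  proof -
    have "(\<lambda>n. q * (of_nat (Suc n) * q ^ n)) sums (q * (1 / (1 - q) ^ 2))"
      by (rule sums_mult[OF geometric_deriv_sums[OF that]])
    then have "(\<lambda>n. of_nat (Suc n) * q ^ Suc n) sums (q / (1 - q) ^ 2)"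
      by (simp add: algebra_simps)
    then show ?thesis by (subst (asm) sums_Suc_iff) simp
  qed
  show "(\<lambda>k. of_nat k * q ^ k) sums (q / (1 - q) ^ 2)" using *[OF q] .
  show "summable (\<lambda>k. norm (of_nat k * q ^ k))"
    using *[of "norm q"] q by (simp add: norm_mult norm_power sums_iff)
qed

lemma lambert_series_summable:
  fixes r :: real
  assumes r: "0 \<le> r" "r < 1"
  shows "(\<lambda>(m, k). real k * r ^ (m * k)) summable_on ({1..} \<times> UNIV)"
proof (rule summable_on_SigmaI)
  fix m :: nat assume m: "m \<in> {1..}"
  have "r ^ m < 1" using r m by (simp add: power_less_one_iff)
  then show "((\<lambda>k. case (m, k) of (m, k) \<Rightarrow> real k * r ^ (m * k)) has_sum (r ^ m / (1 - r ^ m) ^ 2)) UNIV"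
    using has_sum_geometric_deriv[of "r ^ m"] r by (simp add: power_mult)
next
  show "(\<lambda>m. r ^ m / (1 - r ^ m) ^ 2) summable_on {1..}"
  proof (rule summable_on_comparison_test)
    have "summable (\<lambda>m. r ^ m / (1 - r) ^ 2)"
      using r by (intro summable_divide summable_geometric) auto
    then have "(\<lambda>m. r ^ m / (1 - r) ^ 2) summable_on UNIV"
      using r by (subst summable_on_UNIV_nonneg_real_iff) auto
    then show "(\<lambda>m. r ^ m / (1 - r) ^ 2) summable_on {1..}"
      by (rule summable_on_subset_banach) auto
    show "r ^ m / (1 - r ^ m) ^ 2 \<le> r ^ m / (1 - r) ^ 2" if "m \<in> {1..}" for m
    proof -
      have "r ^ m \<le> r ^ 1" using r that by (intro power_decreasing) auto
      then show ?thesis using r by (intro divide_left_mono power_mono mult_pos_pos zero_less_power) auto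
    qed
  qed (use r in auto)
qed (use r in auto)

text \<open>Both sums rearrange the absolutely convergent double series of \<open>k q^(m k)\<close>:
  summing over \<open>k\<close> first gives the Lambert form, and collecting the terms with
  \<open>m k = n\<close> gives the divisor sum.\<close>

lemma lambert_series:
  assumes q: "norm q < (1::real)"
  shows "((\<lambda>n. of_nat (sigma_nat 1 n) * q ^ n) has_sum sigma_series q) UNIV" (is ?th1)
    and "((\<lambda>m. q ^ m / (1 - q ^ m) ^ 2) has_sum sigma_series q) {1..}" (is ?th2)
proof -
  let ?f = "\<lambda>(m::nat, k::nat). of_nat k * q ^ (m * k)"
  have sum0: "?f summable_on ({1..} \<times> UNIV)"
  proof (rule abs_summable_summable)
    have "(\<lambda>(m, k). real k * norm q ^ (m * k)) summable_on ({1..} \<times> UNIV)"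
      by (rule lambert_series_summable) (use q in auto)
    then show "(\<lambda>x. norm (?f x)) summable_on ({1..} \<times> UNIV)"
      by (simp add: case_prod_unfold norm_mult norm_power)
  qed
  then obtain S where S: "(?f has_sum S) ({1..} \<times> UNIV)" by (auto simp: summable_on_def)
  have m: "((\<lambda>k. ?f (m, k)) has_sum (q ^ m / (1 - q ^ m) ^ 2)) UNIV" if "m \<in> {1..}" for m
  proof -
    have "norm (q ^ m) < 1" using that q by (simp add: norm_power power_less_one_iff)
    from has_sum_geometric_deriv[OF this] show ?thesis by (simp add: power_mult)
  qed
  have 2: "((\<lambda>m. q ^ m / (1 - q ^ m) ^ 2) has_sum S) {1..}"
    by (rule has_sum_Sigma'[OF S m])
  have "(?f has_sum S) ({1..} \<times> {1..}) \<longleftrightarrow> (?f has_sum S) ({1..} \<times> UNIV)"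
    by (rule has_sum_cong_neutral) (auto simp: not_le)
  with S have S1: "(?f has_sum S) ({1..} \<times> {1..})" by blast
  have bij: "bij_betw (\<lambda>(n, d). (n div d, d)) (Sigma {1..} divisors_upto) ({1..} \<times> {1..})"
    by (rule bij_betwI[of _ _ _ "\<lambda>(m, k). (m * k, k)"])
       (auto simp: divisors_upto_def div_greater_zero_iff Suc_leI)
  have "((\<lambda>x. ?f ((\<lambda>(n, d). (n div d, d)) x)) has_sum S) (Sigma {1..} divisors_upto)"
    by (rule has_sum_reindex_bij_betw[OF bij, THEN iffD2, OF S1])
  moreover have "((\<lambda>d. ?f ((\<lambda>(n, d). (n div d, d)) (n, d))) has_sum (of_nat (sigma_nat 1 n) * q ^ n)) (divisors_upto n)"
    if "n \<in> {1..}" for n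
  proof -
    have "(\<Sum>d\<in>divisors_upto n. ?f ((\<lambda>(n, d). (n div d, d)) (n, d))) = of_nat (sigma_nat 1 n) * q ^ n"
      unfolding sigma_nat_altdef of_nat_sum sum_distrib_right
      by (intro sum.cong) (auto simp: divisors_upto_def)
    then show ?thesis
      using has_sum_finite[OF finite_divisors_upto[of n], of "\<lambda>d. ?f ((\<lambda>(n, d). (n div d, d)) (n, d))"]
      by (simp only:)
  qed
  ultimately have "((\<lambda>n. of_nat (sigma_nat 1 n) * q ^ n) has_sum S) {1..}"
    by (rule has_sum_Sigma')
  moreover have "((\<lambda>n. of_nat (sigma_nat 1 n) * q ^ n) has_sum S) {1..} \<longleftrightarrow>
      ((\<lambda>n. of_nat (sigma_nat 1 n) * q ^ n) has_sum S) UNIV"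
    by (rule has_sum_cong_neutral) (auto simp: not_le)
  ultimately have 1: "((\<lambda>n. of_nat (sigma_nat 1 n) * q ^ n) has_sum S) UNIV"
    by blast
  then have "sigma_series q = S" unfolding sigma_series_def by (rule infsumI)
  with 1 2 show ?th1 ?th2 by simp_all
qed

lemma has_sum_lipschitz2_multiples:
  assumes "Im z > 0"
  shows "((\<lambda>m. lipschitz2 (of_nat m * z)) has_sum (- 4 * pi ^ 2 * sigma_series (nome z))) {1..}"
proof -
  have "lipschitz2 (of_nat m * z) = - 4 * pi ^ 2 * (nome z ^ m / (1 - nome z ^ m) ^ 2)" for m
    by (simp add: lipschitz2_def nome_of_nat_mult)
  then show ?thesis
    using has_sum_cmult_right[OF lambert_series(2)[OF norm_nome_less_1[OF assms]], of "- 4 * pi ^ 2"]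
    by simp
qed

text \<open>Two norms on the plane are equivalent. Explicitly, the imaginary part controls
  \<open>m\<close>, and then the triangle inequality controls \<open>n\<close>.\<close>

lemma lattice_norm_bound:
  assumes z: "Im z > 0"
  obtains \<delta> where "\<delta> > 0"
    "\<And>m n. norm (of_int m * z + of_int n) \<ge> \<delta> * (\<bar>real_of_int m\<bar> + \<bar>real_of_int n\<bar>)"
proof
  define K where "K = 1 + (1 + norm z) / Im z"
  have K: "K > 0" using z by (simp add: K_def add_pos_nonneg)
  show "inverse K > 0" using K by simp
  fix m n :: int
  let ?w = "of_int m * z + of_int n"
  have "\<bar>Im ?w\<bar> \<le> norm ?w" by (rule abs_Im_le_cmod)
  then have 1: "\<bar>real_of_int m\<bar> \<le> norm ?w / Im z" using z by (simp add: abs_mult field_simps)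
  have "norm (of_int n :: complex) \<le> norm ?w + norm (of_int m * z)"
    using norm_triangle_ineq4[of ?w "of_int m * z"] by simp
  then have "\<bar>real_of_int n\<bar> \<le> norm ?w + \<bar>real_of_int m\<bar> * norm z"
    by (simp add: norm_mult)
  also have "\<dots> \<le> norm ?w + norm ?w / Im z * norm z"
    using 1 by (intro add_left_mono mult_right_mono) auto
  finally have "\<bar>real_of_int m\<bar> + \<bar>real_of_int n\<bar> \<le> norm ?w * K"
    using 1 by (simp add: K_def algebra_simps add_divide_distrib)
  then show "norm ?w \<ge> inverse K * (\<bar>real_of_int m\<bar> + \<bar>real_of_int n\<bar>)"
    using K by (simp add: field_simps)
qed

text \<open>The exponent is half of \<open>3\<close>: the cubic decay of \<open>serre_term\<close>
  splits into a factor in \<open>m\<close> and a factor in \<open>n\<close>, each still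
  summable.\<close>

lemma summable_powr_3_2: "(\<lambda>n. (1 + real n) powr (-3/2)) summable_on UNIV"
proof -
  have "summable (\<lambda>n. real n powr (-3/2))"
    by (subst summable_real_powr_iff) simp
  then have "summable (\<lambda>n. real (Suc n) powr (-3/2))" by (subst summable_Suc_iff)
  then have "summable (\<lambda>n. (1 + real n) powr (-3/2))" by (simp add: add.commute)
  then show ?thesis by (subst summable_on_UNIV_nonneg_real_iff) auto
qed

text \<open>Written as a difference, both iterated sums are computable; the product form of
  \<open>serre_term_altdef\<close> is absolutely summable.  Comparing the two orders of summation gives the
  transformation law of \<open>P\<close>.\<close>
definition serre_term :: "complex \<Rightarrow> int \<Rightarrow> int \<Rightarrow> complex" where
  "serre_term z m n = inverse ((of_int m * z + of_int n) ^ 2)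
     - (inverse (of_int m * z + of_int n) - inverse (of_int m * z + of_int (n + 1)))"

lemma serre_term_altdef:
  assumes "of_int m * z + of_int n \<noteq> 0" "of_int m * z + of_int (n + 1) \<noteq> 0"
  shows "serre_term z m n =
    inverse ((of_int m * z + of_int n) ^ 2) * inverse (of_int m * z + of_int (n + 1))"
proof -
  define x where "x = of_int m * z + of_int n"
  have *: "inverse (x ^ 2) - (inverse x - inverse (x + 1)) = inverse (x ^ 2) * inverse (x + 1)"
    if nz: "x \<noteq> 0" "x + 1 \<noteq> 0"
  proof -
    have d: "inverse x - inverse y = (y - x) * (inverse x * inverse y)" if "x \<noteq> 0" "y \<noteq> 0" for x y :: complex
      using that by (simp add: field_simps)
    have "inverse x - inverse (x + 1) = inverse x * inverse (x + 1)"
      using d[OF nz] by simp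
    then have "inverse (x ^ 2) - (inverse x - inverse (x + 1)) = inverse x * (inverse x - inverse (x + 1))"
      by (simp add: power2_eq_square algebra_simps)
    also have "\<dots> = inverse (x ^ 2) * inverse (x + 1)"
      unfolding \<open>inverse x - inverse (x + 1) = _\<close> by (simp add: power2_eq_square)
    finally show ?thesis .
  qed
  have e: "of_int m * z + of_int (n + 1) = x + 1" by (simp add: x_def)
  show ?thesis
    using assms * unfolding serre_term_def e x_def[symmetric] by blast
qed

lemma lattice_nonzero:
  assumes "Im z > 0" "m \<noteq> 0"
  shows "of_int m * z + of_int n \<noteq> 0"
proof
  assume "of_int m * z + of_int n = 0"
  then have "Im (of_int m * z + of_int n) = 0" by simp
  then show False using assms by simp
qed

lemma summable_int_from_nat:
  fixes h :: "nat \<Rightarrow> real"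
  assumes "h summable_on UNIV"
  shows "(\<lambda>n::int. h (nat \<bar>n\<bar>)) summable_on UNIV"
proof -
  obtain S where S: "(h has_sum S) UNIV" using assms by (auto simp: summable_on_def)
  have "(\<lambda>n. h (Suc n)) summable_on UNIV"
    using summable_on_reindex[of Suc UNIV h] summable_on_subset_banach[OF assms, of "range Suc"]
    by (simp add: o_def)
  then obtain T where T: "((\<lambda>n. h (Suc n)) has_sum T) UNIV" by (auto simp: summable_on_def)
  have eq: "nat \<bar>- int n - 1\<bar> = Suc n" "nat (1 + int n) = Suc n" for n by simp_all
  have "((\<lambda>n::int. h (nat \<bar>n\<bar>)) has_sum (S + T)) UNIV"
    by (rule has_sum_UNIV_int) (use S T in \<open>simp_all add: eq\<close>)
  then show ?thesis by (auto simp: summable_on_def)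
qed

text \<open>The row \<open>m = 0\<close> is left out because it meets the poles of the summand. The
  rows \<open>m\<close> and \<open>- m\<close> are added at once, since in a column the reciprocals
  \<open>1 / (m z + n)\<close> are summable only in this symmetric form.\<close>

lemma serre_term_summable:
  assumes z: "Im z > 0"
  shows "(\<lambda>(m, n). serre_term z (int m) n + serre_term z (- int m) n) summable_on ({1..} \<times> UNIV)"
proof -
  obtain \<delta> where \<delta>: "\<delta> > 0"
    "\<And>m n. norm (of_int m * z + of_int n) \<ge> \<delta> * (\<bar>real_of_int m\<bar> + \<bar>real_of_int n\<bar>)"
    using lattice_norm_bound[OF z] by metis
  define h where "h = (\<lambda>n::nat. (1 + real n) powr (-3/2))"
  define C where "C = inverse ((\<delta> / 2) ^ 3)"
  have hs: "h summable_on UNIV" using summable_powr_3_2 by (simp add: h_def)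
  have "(\<lambda>n::int. h (nat \<bar>n\<bar>)) summable_on UNIV" by (rule summable_int_from_nat[OF hs])
  then obtain T where T: "((\<lambda>n::int. h (nat \<bar>n\<bar>)) has_sum T) UNIV" by (auto simp: summable_on_def)
  have h1: "(\<lambda>m::nat. h (m - 1)) summable_on {1..}"
    using summable_on_reindex_bij_betw[of Suc UNIV "{1..}" "\<lambda>m. h (m - 1)"] hs
       bij_betwI[of Suc UNIV "{1..}" "\<lambda>k. k - 1"] by auto
  have "(\<lambda>(m::nat, n::int). h (m - 1) * h (nat \<bar>n\<bar>)) summable_on ({1..} \<times> UNIV)"
  proof (rule summable_on_SigmaI)
    show "((\<lambda>n. case (m, n) of (m, n) \<Rightarrow> h (m - 1) * h (nat \<bar>n\<bar>)) has_sum (h (m - 1) * T)) UNIV" for m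
      using has_sum_cmult_right[OF T, of "h (m - 1)"] by simp
    show "(\<lambda>m. h (m - 1) * T) summable_on {1..}"
      using h1 by (rule summable_on_cmult_left)
  qed (auto simp: h_def)
  then have major: "(\<lambda>x. (2 * C) * (case x of (m::nat, n::int) \<Rightarrow> h (m - 1) * h (nat \<bar>n\<bar>))) summable_on ({1..} \<times> UNIV)"
    by (rule summable_on_cmult_right)
  have bound: "norm (serre_term z m n) \<le> C * (h (nat \<bar>m\<bar> - 1) * h (nat \<bar>n\<bar>))" if m: "m \<noteq> 0" for m n
  proof -
    let ?N = "\<bar>real_of_int m\<bar> + \<bar>real_of_int n\<bar>"
    have m1: "\<bar>real_of_int m\<bar> \<ge> 1" using m by linarith
    have N: "?N \<ge> 1" using m1 by linarith
    have 1: "norm (of_int m * z + of_int n) \<ge> \<delta> / 2 * ?N"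
    proof -
      have "\<delta> / 2 * ?N \<le> \<delta> * ?N" using \<delta>(1) N by (intro mult_right_mono) auto
      then show ?thesis using \<delta>(2)[of m n] by linarith
    qed
    have 2: "norm (of_int m * z + of_int (n + 1)) \<ge> \<delta> / 2 * ?N"
    proof -
      \<comment> \<open>Passing from \<open>n\<close> to \<open>n + 1\<close> changes the absolute
        value by at most \<open>1\<close>, which the bound \<open>1\<close> on that of
        \<open>m\<close> absorbs at the price of a factor \<open>2\<close>.\<close>
      have "?N \<le> 2 * (\<bar>real_of_int m\<bar> + \<bar>real_of_int (n + 1)\<bar>)"
      proof -
        have "b + a \<le> 2 * (b + c)" if "a \<le> c + 1" "1 \<le> b" "0 \<le> c" for a b c :: real
          using that unfolding distrib_left by linarith
        from this[OF _ m1 abs_ge_zero] show ?thesis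
          using abs_triangle_ineq4[of "real_of_int n + 1" 1] by simp
      qed
      then have "\<delta> / 2 * ?N \<le> \<delta> / 2 * (2 * (\<bar>real_of_int m\<bar> + \<bar>real_of_int (n + 1)\<bar>))"
        using \<delta>(1) by (intro mult_left_mono) auto
      also have "\<dots> = \<delta> * (\<bar>real_of_int m\<bar> + \<bar>real_of_int (n + 1)\<bar>)" by simp
      finally show ?thesis using \<delta>(2)[of m "n + 1"] by (rule order_trans)
    qed
    have pos: "\<delta> / 2 * ?N > 0" using \<delta>(1) N by simp
    have "norm (serre_term z m n) =
       inverse (norm (of_int m * z + of_int n) ^ 2) * inverse (norm (of_int m * z + of_int (n + 1)))"
      using lattice_nonzero[OF z m] by (subst serre_term_altdef) (simp_all add: norm_mult norm_inverse norm_power del: of_int_add)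
    also have "\<dots> \<le> inverse ((\<delta> / 2 * ?N) ^ 2) * inverse (\<delta> / 2 * ?N)"
      using 1 2 pos by (intro mult_mono le_imp_inverse_le power_mono zero_less_power) auto
    also have "\<dots> = C * inverse (?N ^ 3)"
      by (simp add: C_def power_mult_distrib power2_eq_square power3_eq_cube field_simps)
    also have "inverse (?N ^ 3) \<le> h (nat \<bar>m\<bar> - 1) * h (nat \<bar>n\<bar>)"
    proof -
      have h1: "h (nat \<bar>m\<bar> - 1) = \<bar>real_of_int m\<bar> powr (-3/2)"
        using m by (simp add: h_def of_nat_diff)
      have h2: "h (nat \<bar>n\<bar>) = (1 + \<bar>real_of_int n\<bar>) powr (-3/2)"
        by (simp add: h_def)
      have "inverse (?N ^ 3) = ?N powr (-3)" using N by (simp add: powr_minus powr_numeral)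
      also have "\<dots> = ?N powr (-3/2) * ?N powr (-3/2)" by (simp flip: powr_add)
      also have "\<dots> \<le> h (nat \<bar>m\<bar> - 1) * h (nat \<bar>n\<bar>)"
        unfolding h1 h2 using m1 by (intro mult_mono powr_mono2') auto
      finally show ?thesis .
    qed
    finally show ?thesis using \<delta>(1) by (simp add: C_def)
  qed
  have le: "norm (case x of (m, n) \<Rightarrow> serre_term z (int m) n + serre_term z (- int m) n) \<le>
      2 * C * (case x of (m::nat, n::int) \<Rightarrow> h (m - 1) * h (nat \<bar>n\<bar>))"
    if x: "x \<in> {1..} \<times> (UNIV :: int set)" for x
  proof -
    obtain m n where mn: "x = (m, n)" by (cases x)
    have "norm (serre_term z (int m) n + serre_term z (- int m) n) \<le>
        norm (serre_term z (int m) n) + norm (serre_term z (- int m) n)" by (rule norm_triangle_ineq)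
    also have "\<dots> \<le> 2 * C * (h (m - 1) * h (nat \<bar>n\<bar>))"
      using bound[of "int m" n] bound[of "- int m" n] x mn by simp
    finally show ?thesis using mn by simp
  qed
  show ?thesis
    by (rule abs_summable_summable, rule Infinite_Sum.abs_summable_on_comparison_test'[OF major le])
qed

lemma has_sum_diff:
  fixes f g :: "'a \<Rightarrow> 'b :: real_normed_vector"
  assumes "(f has_sum a) A" "(g has_sum b) A"
  shows "((\<lambda>x. f x - g x) has_sum (a - b)) A"
  using has_sum_add[OF assms(1) has_sum_uminus[THEN iffD2], of g "- b"] assms(2) by simp

lemma summable_on_diff:
  fixes f g :: "'a \<Rightarrow> 'b :: real_normed_vector"
  assumes "f summable_on A" "g summable_on A"
  shows "(\<lambda>x. f x - g x) summable_on A"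
  using assms has_sum_diff unfolding summable_on_def by blast

lemma basel_has_sum: "((\<lambda>m. inverse (of_nat m ^ 2) :: complex) has_sum (pi ^ 2 / 6)) {1..}"
proof -
  have s: "(\<lambda>n. inverse (real (Suc n) ^ 2)) sums (pi\<^sup>2 / 6)"
    using inverse_squares_sums by (simp add: field_simps)
  have "((\<lambda>n. inverse (real (Suc n) ^ 2)) has_sum (pi\<^sup>2 / 6)) UNIV"
    by (rule norm_summable_imp_has_sum) (use s in \<open>simp_all add: sums_iff\<close>)
  from has_sum_of_real[OF this, where 'a = complex] show ?thesis
    unfolding has_sum_from_1_iff by (simp add: of_real_inverse)
qed

section \<open>The law of \<open>P\<close> under inversion\<close>

definition P_eis :: "complex \<Rightarrow> complex" where "P_eis z = 1 - 24 * sigma_series (nome z)"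

lemma Im_minus_inverse: "Im z > 0 \<Longrightarrow> Im (- 1 / z) > 0"
  by (cases z) (auto simp: Im_divide power2_eq_square add_pos_nonneg add_nonneg_pos)

context
  fixes z :: complex
  assumes z: "Im z > 0"
begin

text \<open>Along a row the telescoping part sums to \<open>0\<close>, since
  \<open>1 / (m z + n)\<close> tends to \<open>0\<close> at both ends; Lipschitz's formula is left,
  once for \<open>m\<close> and once for \<open>- m\<close>.\<close>

lemma serre_rows:
  assumes m: "m \<ge> 1"
  shows "((\<lambda>n. serre_term z (int m) n + serre_term z (- int m) n) has_sum (2 * lipschitz2 (of_nat m * z))) UNIV"
proof -
  have mz: "Im (of_nat m * z) > 0" using z m by simp
  have 1: "((\<lambda>n. inverse ((of_nat m * z + of_int n) ^ 2)) has_sum lipschitz2 (of_nat m * z)) UNIV"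
    by (rule has_sum_lipschitz2[OF mz])
  have bij: "bij_betw (\<lambda>n::int. - n) UNIV UNIV" by (rule bij_betwI[of _ _ _ "\<lambda>n. - n"]) auto
  have "((\<lambda>n. inverse ((of_nat m * z + of_int (- n)) ^ 2)) has_sum lipschitz2 (of_nat m * z)) UNIV"
    using has_sum_reindex_bij_betw[OF bij, THEN iffD2, OF 1] .
  moreover have "(of_nat m * z + of_int (- n)) ^ 2 = (- of_nat m * z + of_int n) ^ 2" for n
    by (simp add: power2_eq_square algebra_simps)
  ultimately have 2: "((\<lambda>n. inverse ((- of_nat m * z + of_int n) ^ 2)) has_sum lipschitz2 (of_nat m * z)) UNIV"
    by simp
  define g where "g = (\<lambda>n::int. inverse (of_nat m * z + of_int n) + inverse (- of_nat m * z + of_int n))"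
  have serre: "serre_term z (int m) n + serre_term z (- int m) n =
     inverse ((of_nat m * z + of_int n) ^ 2) + inverse ((- of_nat m * z + of_int n) ^ 2) - (g n - g (n + 1))" for n
    by (simp add: serre_term_def g_def)
  have sq: "(\<lambda>n. inverse ((of_nat m * z + of_int n) ^ 2) + inverse ((- of_nat m * z + of_int n) ^ 2)) summable_on UNIV"
    using 1 2 by (intro summable_on_add) (auto simp: summable_on_def)
  have "(\<lambda>n. serre_term z (int m) n + serre_term z (- int m) n) summable_on UNIV"
    using summable_on_SigmaD1[OF serre_term_summable[OF z], of m] m by simp
  from summable_on_diff[OF sq this]
  have "(\<lambda>n. g n - g (n + 1)) summable_on UNIV" unfolding serre by simp
  then have "((\<lambda>n. g n - g (n + 1)) has_sum ((0 + 0) - (0 + 0))) UNIV"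
  proof (rule has_sum_telescope_int)
    have lim: "(\<lambda>n. inverse (u + of_nat n)) \<longlonglongrightarrow> 0" for u :: complex
      by (intro tendsto_inverse_0[THEN filterlim_compose]
          tendsto_add_filterlim_at_infinity[OF tendsto_const] tendsto_of_nat)
    show "(\<lambda>n. g (int n)) \<longlonglongrightarrow> 0 + 0"
      unfolding g_def of_int_of_nat_eq by (intro tendsto_add lim)
    have "(\<lambda>n. - inverse (- of_nat m * z + of_nat n) + - inverse (of_nat m * z + of_nat n)) \<longlonglongrightarrow> - 0 + - 0"
      by (intro tendsto_add tendsto_minus lim)
    moreover have "- inverse (- of_nat m * z + of_nat n) + - inverse (of_nat m * z + of_nat n) = g (- int n)" for n
      unfolding g_def inverse_minus_eq[symmetric] by simp
    ultimately show "(\<lambda>n. g (- int n)) \<longlonglongrightarrow> 0 + 0" by simp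
  qed
  from has_sum_diff[OF has_sum_add[OF 1 2] this] show ?thesis
    unfolding serre by simp
qed

text \<open>The column sums are even in \<open>n\<close>, and \<open>- \<bar>n\<bar> / z\<close> is the point \<open>\<plusminus> n / z\<close> in the upper half plane.\<close>
definition serre_col :: "int \<Rightarrow> complex" where
  "serre_col n = (if n = 0 then inverse (z ^ 2) * (pi ^ 2 / 3)
     else inverse (z ^ 2) * lipschitz2 (- of_nat (nat \<bar>n\<bar>) / z) - inverse (of_int n ^ 2))"

text \<open>At \<open>n = 0\<close> the terms for \<open>m\<close> and \<open>- m\<close> cancel,
  whereas the cotangent expression has a pole.\<close>

definition serre_cot :: "int \<Rightarrow> complex" where
  "serre_cot n = (if n = 0 then 0 else inverse z * (pi * cot (pi * (of_int n / z))) - inverse (of_int n))"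

text \<open>Pulling \<open>z^2\<close> out of the denominators turns a column into Lipschitz's sum
  at the point \<open>w\<close> of the upper half plane, without its term \<open>k = 0\<close>. The
  column \<open>n = 0\<close> is the Basel series.\<close>

lemma serre_col_has_sum:
  "((\<lambda>m. inverse ((of_nat m * z + of_int n) ^ 2) + inverse ((- of_nat m * z + of_int n) ^ 2))
      has_sum serre_col n) {1..}"
proof (cases "n = 0")
  case True
  have "((\<lambda>m. 2 * inverse (z ^ 2) * inverse (of_nat m ^ 2)) has_sum (2 * inverse (z ^ 2) * (pi ^ 2 / 6))) {1..}"
    by (rule has_sum_cmult_right[OF basel_has_sum])
  then show ?thesis
    using True by (simp add: serre_col_def power_mult_distrib mult_ac)
next
  case False
  define N where "N = nat \<bar>n\<bar>"
  have N: "N \<ge> 1" "(of_int n :: complex) ^ 2 = of_nat N ^ 2"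
    using False by (auto simp: N_def simp flip: of_int_power)
  have nN: "of_int n = (of_nat N :: complex) \<or> of_int n = - (of_nat N :: complex)"
    unfolding N_def by (cases "n \<ge> 0") auto
  define w where "w = - of_nat N / z"
  have w: "Im w > 0"
  proof -
    have "w = of_real (real N) * (- 1 / z)" by (simp add: w_def)
    then have "Im w = real N * Im (- 1 / z)"
      by (simp only: times_complex.sel Re_complex_of_real Im_complex_of_real)
    moreover have "real N * Im (- 1 / z) > 0"
      using Im_minus_inverse[OF z] N by (intro mult_pos_pos) auto
    ultimately show ?thesis by (simp only:)
  qed
  have z0: "z \<noteq> 0" using z by auto
  have nz: "of_nat N \<noteq> (0 :: complex)" using N by simp
  have "((\<lambda>k. inverse ((w + of_int k) ^ 2)) has_sum lipschitz2 w) UNIV"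
    by (rule has_sum_lipschitz2[OF w])
  then have S: "((\<lambda>k. inverse ((w + of_int k) ^ 2)) has_sum (lipschitz2 w - inverse (w ^ 2))) (UNIV - {0})"
    using has_sum_Diff[OF _ has_sum_finite[of "{0::int}" "\<lambda>k. inverse ((w + of_int k) ^ 2)"]]
    by auto
  have bp: "bij_betw int {1..} {1..}" by (rule bij_betwI[of _ _ _ nat]) auto
  have bm: "bij_betw (\<lambda>m. - int m) {1..} {..-1}" by (rule bij_betwI[of _ _ _ "\<lambda>k. nat (- k)"]) auto
  have sp: "(\<lambda>k. inverse ((w + of_int k) ^ 2)) summable_on {1..}" "(\<lambda>k. inverse ((w + of_int k) ^ 2)) summable_on {..-1}"
    by (rule summable_on_subset_banach[of _ "UNIV - {0}"]; use S in \<open>auto simp: summable_on_def\<close>)+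
  then obtain A B where AB: "((\<lambda>k. inverse ((w + of_int k) ^ 2)) has_sum A) {1..}"
    "((\<lambda>k. inverse ((w + of_int k) ^ 2)) has_sum B) {..-1}"
    by (auto simp: summable_on_def)
  then have "((\<lambda>k. inverse ((w + of_int k) ^ 2)) has_sum (A + B)) ({1..} \<union> {..-1})"
    by (intro has_sum_Un_disjoint) auto
  moreover have "{1..} \<union> {..-1} = UNIV - {0::int}" by auto
  ultimately have AB': "A + B = lipschitz2 w - inverse (w ^ 2)"
    using has_sum_unique[OF _ S] by simp
  have "((\<lambda>m. inverse ((w + of_nat m) ^ 2)) has_sum A) {1..}"
    using has_sum_reindex_bij_betw[OF bp, THEN iffD2, OF AB(1)] by simp
  moreover have "((\<lambda>m. inverse ((w - of_nat m) ^ 2)) has_sum B) {1..}"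
    using has_sum_reindex_bij_betw[OF bm, THEN iffD2, OF AB(2)] by simp
  ultimately have "((\<lambda>m. inverse ((w + of_nat m) ^ 2) + inverse ((w - of_nat m) ^ 2)) has_sum
      (lipschitz2 w - inverse (w ^ 2))) {1..}"
    unfolding AB'[symmetric] by (rule has_sum_add)
  from has_sum_cmult_right[OF this, of "inverse (z ^ 2)"]
  have *: "((\<lambda>m. inverse ((z * (w + of_nat m)) ^ 2) + inverse ((z * (w - of_nat m)) ^ 2)) has_sum
      (inverse (z ^ 2) * lipschitz2 w - inverse ((z * w) ^ 2))) {1..}"
    by (simp only: power_mult_distrib[of z] inverse_mult_distrib[of "z ^ 2"]
        distrib_left[of "inverse (z ^ 2)"] right_diff_distrib[of "inverse (z ^ 2)"])
  have zw: "z * (w + of_nat m) = of_nat m * z - of_nat N" "z * (w - of_nat m) = - of_nat m * z - of_nat N"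
     "z * w = - of_nat N" for m
    using z0 by (simp_all add: w_def algebra_simps)
  have sq: "(of_nat m * z + of_int n) ^ 2 = (if of_int n = (of_nat N :: complex) then (- of_nat m * z - of_nat N) ^ 2
       else (of_nat m * z - of_nat N) ^ 2)"
    "(- of_nat m * z + of_int n) ^ 2 = (if of_int n = (of_nat N :: complex) then (of_nat m * z - of_nat N) ^ 2
       else (- of_nat m * z - of_nat N) ^ 2)" for m
    using nN by (auto simp: power2_eq_square algebra_simps)
  have "inverse ((of_nat m * z + of_int n) ^ 2) + inverse ((- of_nat m * z + of_int n) ^ 2) =
     inverse ((of_nat m * z - of_nat N) ^ 2) + inverse ((- of_nat m * z - of_nat N) ^ 2)" for m
    unfolding sq by auto
  then show ?thesis
    using * False N(2) unfolding zw by (simp add: serre_col_def w_def N_def[symmetric])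
qed

lemma serre_cot_has_sum:
  "((\<lambda>m. inverse (of_nat m * z + of_int n) + inverse (- of_nat m * z + of_int n)) has_sum serre_cot n) {1..}"
proof (cases "n = 0")
  case True
  then show ?thesis by (simp add: serre_cot_def)
next
  case False
  have z0: "z \<noteq> 0" using z by auto
  define w where "w = of_int n / z"
  have "Im w \<noteq> 0"
    using z False by (auto simp: w_def Im_divide complex_eq_iff)
  then have "w \<notin> \<int>" by (rule Im_not_0_not_Ints)
  from has_sum_cmult_right[OF has_sum_cot_pfd[OF this], of "inverse z"]
  have "((\<lambda>m. inverse (z * (w + of_nat m)) + inverse (z * (w - of_nat m))) has_sum
     (inverse z * (pi * cot (pi * w)) - inverse (z * w))) {1..}"
    by (simp only: inverse_mult_distrib[of z] distrib_left[of "inverse z"] right_diff_distrib[of "inverse z"])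
  moreover have zw: "z * (w + of_nat m) = of_nat m * z + of_int n" "z * (w - of_nat m) = - of_nat m * z + of_int n"
     "z * w = of_int n" for m
    using z0 by (simp_all add: w_def algebra_simps)
  ultimately show ?thesis
    using False unfolding zw by (simp add: serre_cot_def w_def)
qed

lemma serre_cols:
  "((\<lambda>m. serre_term z (int m) n + serre_term z (- int m) n) has_sum
     (serre_col n - (serre_cot n - serre_cot (n + 1)))) {1..}"
proof -
  have "serre_term z (int m) n + serre_term z (- int m) n =
     (inverse ((of_nat m * z + of_int n) ^ 2) + inverse ((- of_nat m * z + of_int n) ^ 2)) -
     ((inverse (of_nat m * z + of_int n) + inverse (- of_nat m * z + of_int n)) -
      (inverse (of_nat m * z + of_int (n + 1)) + inverse (- of_nat m * z + of_int (n + 1))))" for m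
    by (simp add: serre_term_def)
  then show ?thesis
    using has_sum_diff[OF serre_col_has_sum[of n] has_sum_diff[OF serre_cot_has_sum[of n] serre_cot_has_sum[of "n + 1"]]]
    by (simp only:)
qed

text \<open>The terms \<open>- 1 / n^2\<close> add up to \<open>- \<pi>^2 / 3\<close>, and the
  column \<open>n = 0\<close> supplies the constant term of \<open>P\<close> at
  \<open>- 1 / z\<close>.\<close>

lemma serre_col_total:
  "(serre_col has_sum (inverse (z ^ 2) * (pi ^ 2 / 3) * P_eis (- 1 / z) - pi ^ 2 / 3)) UNIV"
proof -
  let ?L = "- 4 * pi ^ 2 * sigma_series (nome (- 1 / z))"
  have "((\<lambda>n. lipschitz2 (of_nat n * (- 1 / z))) has_sum ?L) {1..}"
    by (rule has_sum_lipschitz2_multiples[OF Im_minus_inverse[OF z]])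
  from has_sum_diff[OF has_sum_cmult_right[OF this, of "inverse (z ^ 2)"] basel_has_sum]
  have "((\<lambda>n. inverse (z ^ 2) * lipschitz2 (- of_nat n / z) - inverse (of_nat n ^ 2)) has_sum
     (inverse (z ^ 2) * ?L - pi ^ 2 / 6)) {1..}"
    by simp
  then have 1: "((\<lambda>n. serre_col (int n)) has_sum (inverse (z ^ 2) * ?L - pi ^ 2 / 6)) {1..}"
    by (rule has_sum_cong[THEN iffD1, rotated]) (auto simp: serre_col_def)
  have bij: "bij_betw (\<lambda>n. - int n) {1..} {..-1}" by (rule bij_betwI[of _ _ _ "\<lambda>k. nat (- k)"]) auto
  have bij': "bij_betw int {1..} {1..}" by (rule bij_betwI[of _ _ _ nat]) auto
  have "serre_col (- int n) = serre_col (int n)" for n by (simp add: serre_col_def)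
  with 1 have 2: "((\<lambda>n. serre_col (- int n)) has_sum (inverse (z ^ 2) * ?L - pi ^ 2 / 6)) {1..}" by simp
  have "(serre_col has_sum (inverse (z ^ 2) * ?L - pi ^ 2 / 6)) {1..}"
    by (rule has_sum_reindex_bij_betw[OF bij', THEN iffD1, OF 1])
  moreover have "(serre_col has_sum (inverse (z ^ 2) * ?L - pi ^ 2 / 6)) {..-1}"
    by (rule has_sum_reindex_bij_betw[OF bij, THEN iffD1, OF 2])
  ultimately have "(serre_col has_sum (inverse (z ^ 2) * ?L - pi ^ 2 / 6 + (inverse (z ^ 2) * ?L - pi ^ 2 / 6))) ({1..} \<union> {..-1})"
    by (rule has_sum_Un_disjoint) auto
  moreover have "(serre_col has_sum serre_col 0) {0}"
    using has_sum_finite[of "{0}" serre_col] by simp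
  ultimately have "(serre_col has_sum (inverse (z ^ 2) * ?L - pi ^ 2 / 6 + (inverse (z ^ 2) * ?L - pi ^ 2 / 6) + serre_col 0)) ({1..} \<union> {..-1} \<union> {0})"
    by (rule has_sum_Un_disjoint) auto
  moreover have "{1..} \<union> {..-1} \<union> {0} = (UNIV :: int set)" by auto
  moreover have "inverse (z ^ 2) * ?L - pi ^ 2 / 6 + (inverse (z ^ 2) * ?L - pi ^ 2 / 6) + serre_col 0 =
     inverse (z ^ 2) * (pi ^ 2 / 3) * P_eis (- 1 / z) - pi ^ 2 / 3"
    by (simp add: serre_col_def P_eis_def algebra_simps)
  ultimately show ?thesis by (simp only:)
qed

lemma cot_limit:
  fixes w :: complex
  assumes w: "Im w > 0"
  shows "(\<lambda>n. cot (pi * (of_nat n * w))) \<longlonglongrightarrow> - \<i>"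
proof -
  have "(\<lambda>n. nome w ^ n) \<longlonglongrightarrow> 0"
    using norm_nome_less_1[OF w] by (rule LIMSEQ_power_zero)
  then have "(\<lambda>n. - \<i> * (1 + nome w ^ n) / (1 - nome w ^ n)) \<longlonglongrightarrow> - \<i> * (1 + 0) / (1 - 0)"
    by (intro tendsto_divide tendsto_mult tendsto_add tendsto_diff tendsto_const) auto
  moreover have "\<forall>\<^sub>F n in sequentially. - \<i> * (1 + nome w ^ n) / (1 - nome w ^ n) = cot (pi * (of_nat n * w))"
    using eventually_gt_at_top[of 0]
    by eventually_elim (subst cot_eq_nome, use w in \<open>auto simp: nome_of_nat_mult\<close>)
  ultimately show ?thesis by (simp add: filterlim_cong)
qed

text \<open>The failure of modularity arises here: unlike in the rows, the telescoping terms have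
  nonzero limits of opposite sign at the two ends, because the cotangent tends to \<open>- i\<close>
  high in the upper half plane and to \<open>i\<close> low in the lower one. Their difference is the
  extra term in the law of \<open>P\<close>.\<close>

lemma serre_cot_total:
  assumes "(\<lambda>n. serre_cot n - serre_cot (n + 1)) summable_on UNIV"
  shows "((\<lambda>n. serre_cot n - serre_cot (n + 1)) has_sum (- 2 * pi * \<i> / z)) UNIV"
proof -
  have c: "(\<lambda>n. cot (pi * (of_nat n * (- 1 / z)))) \<longlonglongrightarrow> - \<i>"
    by (rule cot_limit[OF Im_minus_inverse[OF z]])
  have c0: "(\<lambda>n. inverse (of_nat n :: complex)) \<longlonglongrightarrow> 0"
    using lim_inverse_n by simp
  have L: "(\<lambda>n. serre_cot (- int n)) \<longlonglongrightarrow> inverse z * (pi * (- \<i>)) + 0"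
  proof -
    have "(\<lambda>n. inverse z * (pi * cot (pi * (of_nat n * (- 1 / z)))) + inverse (of_nat n)) \<longlonglongrightarrow> inverse z * (pi * (- \<i>)) + 0"
      by (intro tendsto_intros c c0)
    moreover have "\<forall>\<^sub>F n in sequentially. inverse z * (pi * cot (pi * (of_nat n * (- 1 / z)))) + inverse (of_nat n) = serre_cot (- int n)"
      using eventually_gt_at_top[of 0] by eventually_elim (simp add: serre_cot_def)
    ultimately show ?thesis by (simp only: filterlim_cong[OF refl refl])
  qed
  have odd: "serre_cot (int n) = - serre_cot (- int n)" for n
    by (simp add: serre_cot_def cot_def)
  have R: "(\<lambda>n. serre_cot (int n)) \<longlonglongrightarrow> - (inverse z * (pi * (- \<i>)) + 0)"
    unfolding odd by (intro tendsto_intros L)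
  have "inverse z * (pi * (- \<i>)) + 0 - - (inverse z * (pi * (- \<i>)) + 0) = - 2 * pi * \<i> / z"
    by (simp add: field_simps)
  then show ?thesis
    using has_sum_telescope_int[OF assms R L] by (simp only:)
qed

theorem P_eis_S: "P_eis (- 1 / z) = z ^ 2 * P_eis z + 6 * z / (pi * \<i>)"
proof -
  let ?f = "\<lambda>(m, n). serre_term z (int m) n + serre_term z (- int m) n"
  obtain S where S: "(?f has_sum S) ({1..} \<times> UNIV)"
    using serre_term_summable[OF z] by (auto simp: summable_on_def)
  have "((\<lambda>m. 2 * lipschitz2 (of_nat m * z)) has_sum S) {1..}"
    by (rule has_sum_Sigma'[OF S]) (use serre_rows in auto)
  moreover have "((\<lambda>m. 2 * lipschitz2 (of_nat m * z)) has_sum (2 * (- 4 * pi ^ 2 * sigma_series (nome z)))) {1..}"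
    by (rule has_sum_cmult_right[OF has_sum_lipschitz2_multiples[OF z]])
  ultimately have S1: "S = 2 * (- 4 * pi ^ 2 * sigma_series (nome z))" by (rule has_sum_unique)
  have S': "((\<lambda>(n, m). ?f (m, n)) has_sum S) (UNIV \<times> {1..})"
    using S by (simp only: has_sum_swap[of ?f])
  have T: "((\<lambda>n. serre_col n - (serre_cot n - serre_cot (n + 1))) has_sum S) UNIV"
    by (rule has_sum_Sigma'[OF S']) (use serre_cols in auto)
  \<comment> \<open>These differences are the gap between the full columns and the columns of
    \<open>serre_term\<close>, both of which are already known to be summable.\<close>
  have "(\<lambda>n. serre_cot n - serre_cot (n + 1)) summable_on UNIV"
    using summable_on_diff[of serre_col UNIV "\<lambda>n. serre_col n - (serre_cot n - serre_cot (n + 1))"]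
      serre_col_total T by (auto simp: summable_on_def)
  from has_sum_diff[OF serre_col_total serre_cot_total[OF this]]
  have "S = inverse (z ^ 2) * (pi ^ 2 / 3) * P_eis (- 1 / z) - pi ^ 2 / 3 - (- 2 * pi * \<i> / z)"
    using T has_sum_unique by blast
  with S1 have "inverse (z ^ 2) * (pi ^ 2 / 3) * P_eis (- 1 / z) - pi ^ 2 / 3 - (- 2 * pi * \<i> / z)
      = (pi ^ 2 / 3) * P_eis z - pi ^ 2 / 3"
    by (simp add: P_eis_def algebra_simps)
  then have *: "inverse (z ^ 2) * (pi ^ 2 / 3) * P_eis (- 1 / z) = (pi ^ 2 / 3) * P_eis z - 2 * pi * \<i> / z"
    by (simp add: algebra_simps)
  have z0: "z \<noteq> 0" using z by auto
  have "P_eis (- 1 / z) = (3 * z ^ 2 / pi ^ 2) * (inverse (z ^ 2) * (pi ^ 2 / 3) * P_eis (- 1 / z))"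
    using z0 by (simp add: field_simps)
  also have "\<dots> = (3 * z ^ 2 / pi ^ 2) * ((pi ^ 2 / 3) * P_eis z - 2 * pi * \<i> / z)"
    unfolding * ..
  also have "\<dots> = z ^ 2 * P_eis z - 6 * \<i> * z / pi"
    using z0 by (simp add: field_simps power2_eq_square)
  also have "\<dots> = z ^ 2 * P_eis z + 6 * z / (pi * \<i>)"
    by (simp add: divide_inverse algebra_simps)
  finally show ?thesis .
qed

end

section \<open>Expansions in the nome\<close>

lemma fps_conv_radius_of_nat_power: "fps_conv_radius (Abs_fps (\<lambda>n. of_nat n ^ k :: complex)) \<ge> 1"
proof (induction k)
  case 0
  show ?case unfolding fps_conv_radius_def
  proof (rule conv_radius_geI_ex')
    fix r :: real assume "0 < r" "ereal r < 1"
    then show "summable (\<lambda>n. fps_nth (Abs_fps (\<lambda>n. of_nat n ^ 0 :: complex)) n * of_real r ^ n)"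
      by (simp add: summable_geometric)
  qed
next
  case (Suc k)
  let ?f = "\<lambda>k. Abs_fps (\<lambda>n. of_nat n ^ k :: complex)"
  have "?f (Suc k) = fps_X * fps_deriv (?f k)"
    by (rule fps_ext) (auto simp: fps_mult_fps_X_commute[symmetric] intro: nat.exhaust)
  also have "fps_conv_radius \<dots> \<ge> min (fps_conv_radius (fps_X :: complex fps)) (fps_conv_radius (fps_deriv (?f k)))"
    by (rule fps_conv_radius_mult)
  finally show ?case
    using Suc.IH fps_conv_radius_deriv[of "?f k"] by (simp add: min_def split: if_splits)
qed

lemma fps_conv_radius_ge_1_polynomial_growth:
  fixes f :: "complex fps"
  assumes "\<And>n. norm (fps_nth f n) \<le> real n ^ k"
  shows "fps_conv_radius f \<ge> 1"
  unfolding fps_conv_radius_def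
proof (rule conv_radius_geI_ex')
  fix r :: real assume r: "0 < r" "ereal r < 1"
  then have "ereal (norm (of_real r :: complex)) < 1" by simp
  then have "ereal (norm (of_real r :: complex)) < fps_conv_radius (Abs_fps (\<lambda>n. of_nat n ^ k :: complex))"
    using fps_conv_radius_of_nat_power[of k] by (rule less_le_trans)
  from norm_summable_fps[OF this]
  have "summable (\<lambda>n. real n ^ k * r ^ n)"
    using r by (simp add: norm_mult norm_power)
  then show "summable (\<lambda>n. fps_nth f n * of_real r ^ n)"
    by (rule summable_comparison_test'[where N = 0])
       (use assms r in \<open>auto simp: norm_mult norm_power intro!: mult_right_mono\<close>)
qed

lemma sigma_nat_le: "sigma_nat k n \<le> n ^ Suc k"
proof -
  have "(\<Sum>d\<in>divisors_upto n. d ^ k) \<le> (\<Sum>d\<in>divisors_upto n. n ^ k)"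
    by (intro sum_mono power_mono) (auto simp: divisors_upto_def)
  also have "\<dots> = card (divisors_upto n) * n ^ k" by simp
  also have "card (divisors_upto n) \<le> card {1..n}"
    by (rule card_mono) (auto simp: divisors_upto_def)
  finally show ?thesis by (simp add: sigma_nat_altdef)
qed

definition sigma_fps :: "nat \<Rightarrow> complex fps" where
  "sigma_fps k = Abs_fps (\<lambda>n. of_nat (sigma_nat k n))"

definition P_fps :: "complex fps" where "P_fps = 1 - fps_const 24 * sigma_fps 1"

definition Q_fps :: "complex fps" where "Q_fps = 1 + fps_const 240 * sigma_fps 3"

text \<open>The logarithm of the product of all \<open>1 - q^n\<close>, from expanding each
  \<open>log (1 - q^n)\<close>. Its constant term is \<open>0\<close> because
  \<open>sigma_nat 1 0 = 0\<close>.\<close>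

definition eta_log_fps :: "complex fps" where
  "eta_log_fps = Abs_fps (\<lambda>n. - of_nat (sigma_nat 1 n) / of_nat n)"

definition unit_radius :: "complex fps \<Rightarrow> bool" where
  "unit_radius f \<longleftrightarrow> fps_conv_radius f \<ge> 1"

named_theorems unit_radius_intros

lemma unit_radius_sigma_fps [unit_radius_intros]: "unit_radius (sigma_fps k)"
  unfolding unit_radius_def
proof (rule fps_conv_radius_ge_1_polynomial_growth)
  show "norm (fps_nth (sigma_fps k) n) \<le> real n ^ Suc k" for n
    using sigma_nat_le[of k n] unfolding sigma_fps_def
    by (simp del: power_Suc of_nat_power add: of_nat_power[symmetric])
qed

lemma unit_radius_eta_log_fps [unit_radius_intros]: "unit_radius eta_log_fps"
  unfolding unit_radius_def
proof (rule fps_conv_radius_ge_1_polynomial_growth)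
  fix n
  have "real (sigma_nat 1 n) \<le> real n * real n"
    using sigma_nat_le[of 1 n] by (simp add: numeral_2_eq_2 flip: of_nat_mult)
  then show "norm (fps_nth eta_log_fps n) \<le> real n ^ 1"
    unfolding eta_log_fps_def by (cases "n = 0") (auto simp: norm_divide divide_simps)
qed

lemma unit_radius_const [unit_radius_intros]: "unit_radius (fps_const c)" "unit_radius 1" "unit_radius fps_X"
  by (simp_all add: unit_radius_def)

lemma unit_radius_add [unit_radius_intros]: "unit_radius f \<Longrightarrow> unit_radius g \<Longrightarrow> unit_radius (f + g)"
  unfolding unit_radius_def using fps_conv_radius_add[of f g] by (meson min.boundedI order_trans)

lemma unit_radius_diff [unit_radius_intros]: "unit_radius f \<Longrightarrow> unit_radius g \<Longrightarrow> unit_radius (f - g)"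
  unfolding unit_radius_def using fps_conv_radius_diff[of f g] by (meson min.boundedI order_trans)

lemma unit_radius_mult [unit_radius_intros]: "unit_radius f \<Longrightarrow> unit_radius g \<Longrightarrow> unit_radius (f * g)"
  unfolding unit_radius_def using fps_conv_radius_mult[of f g] by (meson min.boundedI order_trans)

lemma unit_radius_power [unit_radius_intros]: "unit_radius f \<Longrightarrow> unit_radius (f ^ n)"
  by (induction n) (auto intro: unit_radius_intros)

lemma unit_radius_deriv [unit_radius_intros]: "unit_radius f \<Longrightarrow> unit_radius (fps_deriv f)"
  unfolding unit_radius_def using fps_conv_radius_deriv[of f] by (meson order_trans)

lemma unit_radius_P_fps [unit_radius_intros]: "unit_radius P_fps"
  unfolding P_fps_def by (intro unit_radius_intros)

lemma unit_radius_Q_fps [unit_radius_intros]: "unit_radius Q_fps"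
  unfolding Q_fps_def by (intro unit_radius_intros)

section \<open>Such series as functions on the upper half plane\<close>

definition qexp :: "complex fps \<Rightarrow> complex \<Rightarrow> complex" where
  "qexp f z = eval_fps f (nome z)"

lemma unit_radiusD: "unit_radius f \<Longrightarrow> norm q < 1 \<Longrightarrow> ereal (norm q) < fps_conv_radius f"
  unfolding unit_radius_def by (metis ereal_less(3) less_le_trans)

lemma norm_nome_less_radius: "unit_radius f \<Longrightarrow> Im z > 0 \<Longrightarrow> ereal (norm (nome z)) < fps_conv_radius f"
  by (intro unit_radiusD norm_nome_less_1)

lemma qexp_ring:
  assumes "unit_radius f" "unit_radius g" "Im z > 0"
  shows "qexp (f + g) z = qexp f z + qexp g z" "qexp (f - g) z = qexp f z - qexp g z"
    "qexp (f * g) z = qexp f z * qexp g z"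
  unfolding qexp_def using assms norm_nome_less_radius
  by (simp_all add: eval_fps_add eval_fps_diff eval_fps_mult)

lemma qexp_const [simp]: "qexp (fps_const c) z = c" "qexp 1 z = 1" "qexp fps_X z = nome z"
  by (simp_all add: qexp_def)

lemma qexp_power: "unit_radius f \<Longrightarrow> Im z > 0 \<Longrightarrow> qexp (f ^ n) z = qexp f z ^ n"
  by (induction n) (simp_all add: qexp_ring unit_radius_intros)

lemma nome_add_int: "nome (z + of_int k) = nome z"
proof -
  have "nome (z + of_int k) = nome z * exp (of_int (2 * k) * (pi * \<i>))"
    unfolding nome_def exp_add[symmetric] by (simp add: algebra_simps)
  also have "exp (of_int (2 * k) * (pi * \<i>)) = 1"
    using exp_integer_2pi[of "of_int k"] by (simp add: mult_ac)
  finally show ?thesis by simp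
qed

lemma qexp_add_int: "qexp f (z + of_int k) = qexp f z"
  by (simp add: qexp_def nome_add_int)

lemma has_field_derivative_nome: "(nome has_field_derivative (2 * pi * \<i> * nome z)) (at z within A)"
  unfolding nome_def by (auto intro!: derivative_eq_intros)

lemma has_field_derivative_qexp:
  assumes "unit_radius f" "Im z > 0"
  shows "(qexp f has_field_derivative (2 * pi * \<i> * qexp (fps_X * fps_deriv f) z)) (at z)"
proof -
  have "(eval_fps f has_field_derivative eval_fps (fps_deriv f) (nome z)) (at (nome z))"
    by (intro has_field_derivative_eval_fps norm_nome_less_radius assms)
  from DERIV_chain2[OF this has_field_derivative_nome]
  show ?thesis
    using qexp_ring(3)[OF unit_radius_const(3) unit_radius_deriv[OF assms(1)] assms(2)]
    by (simp add: qexp_def[abs_def] mult_ac)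
qed

lemma holomorphic_qexp: "unit_radius f \<Longrightarrow> qexp f holomorphic_on {z. Im z > 0}"
  using has_field_derivative_qexp
  by (subst holomorphic_on_open) (auto simp: open_halfspace_Im_gt)

lemma qexp_bounded:
  assumes f: "unit_radius f" and c: "c > 0"
  obtains K where "K > 0" "\<And>z. Im z \<ge> c \<Longrightarrow> norm (qexp f z) \<le> K"
proof -
  let ?D = "cball (0::complex) (exp (- 2 * pi * c))"
  have sub: "?D \<subseteq> eball 0 (fps_conv_radius f)"
    using c by (auto intro!: unit_radiusD[OF f] elim!: le_less_trans)
  have "compact (eval_fps f ` ?D)"
    by (intro compact_continuous_image continuous_on_subset[OF continuous_on_eval_fps sub]) auto
  then obtain K where K: "K > 0" "\<And>q. q \<in> ?D \<Longrightarrow> norm (eval_fps f q) \<le> K"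
    using compact_imp_bounded bounded_pos by (metis imageI)
  have "norm (qexp f z) \<le> K" if "Im z \<ge> c" for z
    unfolding qexp_def using that c by (intro K(2)) (simp add: norm_nome)
  with K(1) show ?thesis by (rule that)
qed

text \<open>A factor \<open>q^N\<close> splits off, and the remaining series is bounded for
  \<open>Im z \<ge> 1\<close>. In this form the agreement of coefficients enters the vanishing
  hypothesis of \<open>sturm_bound\<close>.\<close>

lemma qexp_decay:
  assumes f: "unit_radius f" and N: "\<And>n. n < N \<Longrightarrow> fps_nth f n = 0"
  obtains K where "K > 0" "\<And>z. Im z \<ge> 1 \<Longrightarrow> norm (qexp f z) \<le> K * norm (nome z) ^ N"
proof -
  define g where "g = fps_shift N f"
  have g: "unit_radius g" using f by (simp add: g_def unit_radius_def)
  have fg: "f = fps_X ^ N * g"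
    by (rule fps_ext) (auto simp: g_def fps_X_power_mult_nth N)
  obtain K where K: "K > 0" "\<And>z. Im z \<ge> 1 \<Longrightarrow> norm (qexp g z) \<le> K"
    using qexp_bounded[OF g, of 1] by auto
  show ?thesis
  proof (rule that[OF K(1)])
    fix z assume z: "Im z \<ge> (1 :: real)"
    have "qexp f z = nome z ^ N * qexp g z"
      unfolding fg using z g
      by (subst qexp_ring(3)) (auto simp: qexp_power unit_radius_const intro!: unit_radius_intros)
    then show "norm (qexp f z) \<le> K * norm (nome z) ^ N"
      using K(2)[OF z] by (simp add: norm_mult norm_power mult.commute mult_left_mono)
  qed
qed

text \<open>The nome maps the upper half plane onto the punctured unit disc, and continuity fills in
  the centre; identities of functions thereby become identities of coefficients.\<close>

lemma qexp_eq_0_imp_eq_0: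
  assumes f: "unit_radius f" and 0: "\<And>z. Im z > 0 \<Longrightarrow> qexp f z = 0"
  shows "f = 0"
proof (rule ccontr)
  assume nz: "f \<noteq> 0"
  have *: "eval_fps f q = 0" if q: "q \<noteq> 0" "norm q < 1" for q
  proof -
    define z where "z = Ln q / (2 * pi * \<i>)"
    have "nome z = q" using q by (simp add: nome_def z_def)
    moreover from this have "Im z > 0"
      using q norm_nome[of z] by (simp add: zero_less_mult_iff)
    ultimately show ?thesis using 0[of z] by (simp add: qexp_def)
  qed
  have "(0::ereal) < 1" by simp
  then have r: "fps_conv_radius f > 0" using f unfolding unit_radius_def
    by (rule less_le_trans)
  have "isCont (eval_fps f) 0"
    using r by (intro continuous_eval_fps) (auto simp: zero_ereal_def)
  then have "(eval_fps f \<longlongrightarrow> eval_fps f 0) (at 0)" by (simp add: isCont_def)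
  moreover have "\<forall>\<^sub>F q in at 0. eval_fps f q = 0"
    unfolding eventually_at by (rule exI[of _ 1]) (use * in auto)
  then have "(eval_fps f \<longlongrightarrow> 0) (at 0)" by (simp add: tendsto_eventually)
  ultimately have "eval_fps f 0 = 0" by (rule tendsto_unique[OF trivial_limit_at])
  with * have "\<And>q. norm q < 1 \<Longrightarrow> eval_fps f q = 0" by (metis norm_zero)
  then have "\<forall>\<^sub>F q in nhds 0. eval_fps f q = eval_fps 0 q"
    unfolding eventually_nhds_metric by (intro exI[of _ 1]) auto
  with r have "f = 0" by (intro eval_fps_eqD) auto
  with nz show False by simp
qed

text \<open>Coefficient by coefficient this is \<open>sigma_convolution\<close>; the square of
  \<open>24\<close> is \<open>576 = 48 * 12\<close>, which provides the factor \<open>12\<close> of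
  that formula.\<close>

lemma theta_P_fps: "fps_const 12 * (fps_X * fps_deriv P_fps) = P_fps ^ 2 - Q_fps"
proof (rule fps_ext)
  fix n
  let ?s = "\<lambda>k n. of_nat (sigma_nat k n) :: complex"
  have "12 * (\<Sum>k\<le>n. ?s 1 k * ?s 1 (n - k)) = 5 * ?s 3 n + (1 - 6 * of_nat n) * ?s 1 n"
    using arg_cong[OF sigma_convolution[of n], of "of_int :: int \<Rightarrow> complex"] by simp
  then have conv: "12 * fps_nth (sigma_fps 1 ^ 2) n = 5 * ?s 3 n + (1 - 6 * of_nat n) * ?s 1 n"
    by (simp add: power2_eq_square fps_mult_nth sigma_fps_def atLeast0AtMost)
  have th: "fps_nth (fps_X * fps_deriv P_fps) n = - 24 * of_nat n * ?s 1 n"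
    by (cases n) (auto simp: P_fps_def sigma_fps_def algebra_simps)
  have "P_fps ^ 2 = 1 - (2 * fps_const 24) * sigma_fps 1 + (fps_const 24 * fps_const 24) * sigma_fps 1 ^ 2"
    unfolding P_fps_def by (simp only: power2_eq_square ring_distribs mult_ac mult_2 add_ac) simp
  also have "2 * fps_const 24 = (fps_const 48 :: complex fps)"
    by (simp add: numeral_fps_const)
  also have "fps_const 24 * fps_const 24 = (fps_const 576 :: complex fps)"
    by simp
  finally have "P_fps ^ 2 = 1 - fps_const 48 * sigma_fps 1 + fps_const 576 * sigma_fps 1 ^ 2" .
  then have "fps_nth (P_fps ^ 2 - Q_fps) n = - 48 * ?s 1 n + 48 * (12 * fps_nth (sigma_fps 1 ^ 2) n) - 240 * ?s 3 n"
    by (simp add: Q_fps_def sigma_fps_def)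
  also have "\<dots> = 12 * (- 24 * of_nat n * ?s 1 n)"
    unfolding conv by (simp add: algebra_simps)
  finally show "fps_nth (fps_const 12 * (fps_X * fps_deriv P_fps)) n = fps_nth (P_fps ^ 2 - Q_fps) n"
    unfolding fps_mult_left_const_nth th by simp
qed

section \<open>Laws of \<open>P\<close>, \<open>Q\<close> and \<open>\<eta>^2\<close> for the
  generators of the modular group\<close>

lemma P_eis_eq_qexp: "Im z > 0 \<Longrightarrow> P_eis z = qexp P_fps z"
proof -
  assume z: "Im z > 0"
  have "sigma_series (nome z) = qexp (sigma_fps 1) z"
    using has_sum_imp_sums[OF lambert_series(1)[OF norm_nome_less_1[OF z]]]
    by (simp add: qexp_def eval_fps_def sigma_fps_def sums_iff)
  then show ?thesis
    unfolding P_eis_def P_fps_def using z by (simp add: qexp_ring unit_radius_intros)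
qed

lemma qexp_P_S:
  assumes "Im z > 0"
  shows "qexp P_fps (- 1 / z) = z ^ 2 * qexp P_fps z + 6 / (pi * \<i>) * z"
  using P_eis_S[OF assms] assms Im_minus_inverse[OF assms] by (simp add: P_eis_eq_qexp)

lemma qexp_Q_eq:
  assumes z: "Im z > 0"
  shows "qexp Q_fps z = qexp P_fps z ^ 2 - 12 * qexp (fps_X * fps_deriv P_fps) z"
proof -
  have "Q_fps = P_fps ^ 2 - fps_const 12 * (fps_X * fps_deriv P_fps)"
    using theta_P_fps by simp
  then have "qexp Q_fps z = qexp (P_fps ^ 2 - fps_const 12 * (fps_X * fps_deriv P_fps)) z" by simp
  also have "\<dots> = qexp (P_fps ^ 2) z - 12 * qexp (fps_X * fps_deriv P_fps) z"
    by (subst qexp_ring(2,3), (intro unit_radius_intros z)+)+ simp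
  finally show ?thesis using z by (simp add: qexp_power unit_radius_intros)
qed

lemma eventually_upper_half_plane: "Im z > 0 \<Longrightarrow> \<forall>\<^sub>F u in nhds z. Im u > 0"
  using eventually_nhds_in_open[OF open_halfspace_Im_gt, of z 0] by auto

text \<open>Differentiating the law of \<open>P\<close> gives the law of \<open>q P'\<close>. In
  \<open>P^2 - 12 q P'\<close> the terms linear and quadratic in \<open>c = 6 / (\<pi> i)\<close>
  cancel, because \<open>2 \<pi> i c = 12\<close>.\<close>

lemma qexp_Q_S:
  assumes z: "Im z > 0"
  shows "qexp Q_fps (- 1 / z) = z ^ 4 * qexp Q_fps z"
proof -
  define c :: complex where "c = 6 / (pi * \<i>)"
  define t where "t = qexp (fps_X * fps_deriv P_fps) z"
  define t' where "t' = qexp (fps_X * fps_deriv P_fps) (- 1 / z)"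
  define p where "p = qexp P_fps z"
  have z0: "z \<noteq> 0" using z by auto
  have w: "Im (- 1 / z) > 0" by (rule Im_minus_inverse[OF z])
  have d1: "((\<lambda>u. qexp P_fps (- 1 / u)) has_field_derivative (2 * pi * \<i> * t' * (1 / z ^ 2))) (at z)"
    unfolding t'_def
    by (rule DERIV_chain2[where g = "\<lambda>u. - 1 / u", OF has_field_derivative_qexp[OF unit_radius_P_fps w]])
       (use z0 in \<open>auto intro!: derivative_eq_intros simp: power2_eq_square\<close>)
  have "((\<lambda>u. u ^ 2 * qexp P_fps u + c * u) has_field_derivative
      (2 * z * p + z ^ 2 * (2 * pi * \<i> * t) + c)) (at z)"
    unfolding t_def p_def
    by (auto intro!: derivative_eq_intros has_field_derivative_qexp unit_radius_intros z)
  note der = this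
  have ev: "\<forall>\<^sub>F u in nhds z. u ^ 2 * qexp P_fps u + c * u = qexp P_fps (- 1 / u)"
    using eventually_upper_half_plane[OF z] by (rule eventually_mono) (simp only: qexp_P_S c_def)
  have d2: "((\<lambda>u. qexp P_fps (- 1 / u)) has_field_derivative
      (2 * z * p + z ^ 2 * (2 * pi * \<i> * t) + c)) (at z)"
    by (rule DERIV_cong_ev[OF refl ev refl, THEN iffD1, OF der])
  have d12: "2 * pi * \<i> * t' * (1 / z ^ 2) = 2 * z * p + z ^ 2 * (2 * pi * \<i> * t) + c"
    by (rule DERIV_unique[OF d1 d2])
  have cc: "12 / (2 * pi * \<i>) = c" by (simp add: c_def)
  have "12 * t' = (12 / (2 * pi * \<i>)) * (2 * pi * \<i> * t' * (1 / z ^ 2)) * z ^ 2"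
    using z0 by (simp add: field_simps)
  also have "\<dots> = c * (2 * z * p + z ^ 2 * (2 * pi * \<i> * t) + c) * z ^ 2"
    unfolding cc d12 ..
  also have "\<dots> = 2 * c * z ^ 3 * p + (c * (2 * pi * \<i>)) * z ^ 4 * t + c ^ 2 * z ^ 2"
    by (simp add: power2_eq_square power3_eq_cube eval_nat_numeral algebra_simps)
  also have "c * (2 * pi * \<i>) = 12"
    by (simp add: c_def field_simps)
  finally have t': "12 * t' = 2 * c * z ^ 3 * p + 12 * z ^ 4 * t + c ^ 2 * z ^ 2" .
  show ?thesis
    unfolding qexp_Q_eq[OF z] qexp_Q_eq[OF w] t_def[symmetric] t'_def[symmetric] p_def[symmetric] t'
      qexp_P_S[OF z] c_def[symmetric]
    by (simp add: power2_eq_square power3_eq_cube eval_nat_numeral algebra_simps)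
qed

text \<open>Defined through its logarithm, so that it is visibly nonzero and its logarithmic
  derivative is a multiple of \<open>P\<close>.\<close>

definition eta :: "complex \<Rightarrow> complex" where
  "eta z = exp (pi * \<i> * z / 12 + qexp eta_log_fps z)"

lemma eta_nonzero [simp]: "eta z \<noteq> 0"
  by (simp add: eta_def)

lemma theta_eta_log_fps: "fps_X * fps_deriv eta_log_fps = - sigma_fps 1"
proof (rule fps_ext)
  show "fps_nth (fps_X * fps_deriv eta_log_fps) n = fps_nth (- sigma_fps 1) n" for n
    by (cases n) (simp_all add: eta_log_fps_def sigma_fps_def del: of_nat_Suc)
qed

lemma has_field_derivative_eta:
  assumes z: "Im z > 0"
  shows "(eta has_field_derivative (eta z * (pi * \<i> / 12 * qexp P_fps z))) (at z)"
proof -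
  have "- sigma_fps 1 = fps_const (-1) * sigma_fps 1" by (simp add: fps_eq_iff)
  then have e: "qexp (- sigma_fps (Suc 0)) z = - qexp (sigma_fps (Suc 0)) z"
    using z by (simp add: qexp_ring unit_radius_intros)
  have p: "qexp P_fps z = 1 - 24 * qexp (sigma_fps (Suc 0)) z"
    unfolding P_fps_def using z by (simp add: qexp_ring unit_radius_intros)
  show ?thesis
    unfolding eta_def[abs_def]
    by (auto intro!: derivative_eq_intros has_field_derivative_qexp unit_radius_intros z
        simp: theta_eta_log_fps e p algebra_simps)
qed

lemma eta_squared_T: "eta (z + 1) ^ 2 = exp (pi * \<i> / 6) * eta z ^ 2"
proof -
  have "qexp eta_log_fps (z + 1) = qexp eta_log_fps z"
    using qexp_add_int[of _ z 1] by simp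
  then show ?thesis
    unfolding eta_def exp_of_nat_mult[symmetric] exp_add[symmetric]
    by (simp add: algebra_simps add_divide_distrib)
qed

text \<open>By the law of \<open>P\<close> the quotient \<open>h\<close> has derivative
  \<open>0\<close>, hence is constant; its value \<open>- i\<close> is found at the fixed point
  \<open>i\<close> of the inversion.\<close>

lemma eta_squared_S:
  assumes z: "Im z > 0"
  shows "eta (- 1 / z) ^ 2 = - \<i> * z * eta z ^ 2"
proof -
  let ?H = "{z. Im z > 0}"
  define h where "h = (\<lambda>u. eta (- 1 / u) ^ 2 / (u * eta u ^ 2))"
  have "(h has_field_derivative 0) (at u)" if u: "Im u > 0" for u
  proof -
    have u0: "u \<noteq> 0" using u by auto
    have w: "Im (- 1 / u) > 0" by (rule Im_minus_inverse[OF u])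
    let ?p = "pi * \<i> / 12 * qexp P_fps u" and ?p' = "pi * \<i> / 12 * qexp P_fps (- 1 / u)"
    have "((\<lambda>u. eta (- 1 / u)) has_field_derivative (eta (- 1 / u) * ?p' * (1 / u ^ 2))) (at u)"
      by (rule DERIV_chain2[where g = "\<lambda>u. - 1 / u", OF has_field_derivative_eta[OF w]])
         (use u0 in \<open>auto intro!: derivative_eq_intros simp: power2_eq_square\<close>)
    then have "(h has_field_derivative
       (eta (- 1 / u) ^ 2 / (u * eta u ^ 2) * (2 * ?p' / u ^ 2 - 1 / u - 2 * ?p))) (at u)"
      unfolding h_def using u0
      by (auto intro!: derivative_eq_intros has_field_derivative_eta[OF u]
          simp: field_simps power2_eq_square)
    also have "2 * ?p' / u ^ 2 - 1 / u - 2 * ?p = 0"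
      unfolding qexp_P_S[OF u] using u0 by (simp add: field_simps power2_eq_square)
    finally show ?thesis by simp
  qed
  then have "\<exists>c. \<forall>u\<in>?H. h u = c"
    by (intro has_field_derivative_zero_constant[where s = ?H])
       (auto simp: convex_halfspace_Im_gt intro: has_field_derivative_at_within)
  then obtain c where c: "\<And>u. Im u > 0 \<Longrightarrow> h u = c" by auto
  have "- 1 / \<i> = \<i>" by (simp add: divide_inverse)
  then have "h \<i> = - \<i>" by (simp add: h_def divide_inverse)
  with c[of \<i>] c[OF z] have "h z = - \<i>" by simp
  moreover have "z \<noteq> 0" using z by auto
  ultimately show ?thesis by (simp add: h_def field_simps)
qed

lemma holomorphic_eta: "eta holomorphic_on {z. Im z > 0}"
  using has_field_derivative_eta
  by (subst holomorphic_on_open) (auto simp: open_halfspace_Im_gt)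

text \<open>The lower bound serves the negative exponents of eta quotients and the division by a
  power of \<open>\<eta>\<close> in \<open>sturm_bound\<close>.\<close>

lemma eta_growth:
  assumes c: "c > 0"
  obtains K where "K > 0" "\<And>z. Im z \<ge> c \<Longrightarrow> norm (eta z) \<le> K * exp (- pi * Im z / 12)"
    "\<And>z. Im z \<ge> c \<Longrightarrow> norm (eta z) \<ge> inverse K * exp (- pi * Im z / 12)"
proof -
  obtain K where K: "\<And>z. Im z \<ge> c \<Longrightarrow> norm (qexp eta_log_fps z) \<le> K"
    using qexp_bounded[OF unit_radius_eta_log_fps c] by metis
  have n: "norm (eta z) = exp (Re (qexp eta_log_fps z)) * exp (- pi * Im z / 12)" for z
    by (simp add: eta_def mult.commute flip: exp_add)
  have R: "\<bar>Re (qexp eta_log_fps z)\<bar> \<le> K" if "Im z \<ge> c" for z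
    using K[OF that] abs_Re_le_cmod order_trans by blast
  show ?thesis
  proof (rule that[of "exp K"])
    show "norm (eta z) \<le> exp K * exp (- pi * Im z / 12)" if "Im z \<ge> c" for z
      unfolding n using R[OF that] by (intro mult_right_mono) auto
    show "norm (eta z) \<ge> inverse (exp K) * exp (- pi * Im z / 12)" if "Im z \<ge> c" for z
      unfolding n exp_minus[symmetric] using R[OF that] by (intro mult_right_mono) auto
  qed auto
qed

section \<open>Transformation under the modular group\<close>

text \<open>Euclid's algorithm on the first column: translations reduce \<open>a\<close> modulo
  \<open>c\<close> and the inversion exchanges the rows, so the absolute value of \<open>c\<close>
  decreases until \<open>c = 0\<close>, where the diagonal is \<open>1, 1\<close> or
  \<open>- 1, - 1\<close>.\<close>

lemma SL2_induct [consumes 1, case_names one minus_one T T_inv S]: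
  fixes a b c d :: int
  assumes det: "a * d - b * c = 1"
  assumes one: "R 1 0 0 1" and minus_one: "R (-1) 0 0 (-1)"
    and T: "\<And>a b c d. a * d - b * c = 1 \<Longrightarrow> R a b c d \<Longrightarrow> R (a + c) (b + d) c d"
    and T_inv: "\<And>a b c d. a * d - b * c = 1 \<Longrightarrow> R a b c d \<Longrightarrow> R (a - c) (b - d) c d"
    and S: "\<And>a b c d. a * d - b * c = 1 \<Longrightarrow> R a b c d \<Longrightarrow> R (- c) (- d) a b"
  shows "R a b c d"
proof -
  have Tn: "R (a + int n * c) (b + int n * d) c d" if "R a b c d" "a * d - b * c = 1" for a b c d n
  proof (induction n)
    case (Suc n)
    have "(a + int n * c) * d - (b + int n * d) * c = 1" using that by (simp add: algebra_simps)
    from T[OF this Suc.IH] show ?case by (simp add: algebra_simps)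
  qed (use that in simp)
  have Tm: "R (a - int n * c) (b - int n * d) c d" if "R a b c d" "a * d - b * c = 1" for a b c d n
  proof (induction n)
    case (Suc n)
    have "(a - int n * c) * d - (b - int n * d) * c = 1" using that by (simp add: algebra_simps)
    from T_inv[OF this Suc.IH] show ?case by (simp add: algebra_simps)
  qed (use that in simp)
  have Tk: "R (a + k * c) (b + k * d) c d" if "R a b c d" "a * d - b * c = 1" for a b c d k
    using Tn[OF that, of "nat k"] Tm[OF that, of "nat (- k)"] by (cases "k \<ge> 0") auto
  show ?thesis using det
  proof (induction "nat \<bar>c\<bar>" arbitrary: a b c d rule: less_induct)
    case less
    show ?case
    proof (cases "c = 0")
      case True
      with less.prems have "a * d = 1" by simp
      then have "a = 1 \<and> d = 1 \<or> a = -1 \<and> d = -1" by (simp add: zmult_eq_1_iff)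
      then show ?thesis
      proof
        assume "a = 1 \<and> d = 1"
        then show ?thesis using Tk[OF one, of b] True by simp
      next
        assume "a = -1 \<and> d = -1"
        then show ?thesis using Tk[OF minus_one, of "- b"] True by simp
      qed
    next
      case False
      define k where "k = - (a div c)"
      define a' where "a' = a + k * c"
      define b' where "b' = b + k * d"
      have a': "\<bar>a'\<bar> < \<bar>c\<bar>"
        using False abs_mod_less[of c a] by (simp add: a'_def k_def minus_div_mult_eq_mod[symmetric])
      have det': "c * (- b') - d * (- a') = 1"
        using less.prems by (simp add: a'_def b'_def algebra_simps)
      have "R c d (- a') (- b')" using a' by (intro less.hyps det') auto
      from S[OF det' this] have R': "R a' b' c d" by simp
      have "a' * d - b' * c = 1" using det' by (simp add: algebra_simps)
      from Tk[OF R' this, of "- k"] show ?thesis by (simp add: a'_def b'_def)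
    qed
  qed
qed

section \<open>The laws for arbitrary matrices\<close>

definition moebius_act :: "int \<Rightarrow> int \<Rightarrow> int \<Rightarrow> int \<Rightarrow> complex \<Rightarrow> complex" where
  "moebius_act a b c d z = (of_int a * z + of_int b) / (of_int c * z + of_int d)"

lemma cocycle_nonzero:
  fixes a b c d :: int
  assumes "a * d - b * c = 1" "Im z > 0"
  shows "of_int c * z + of_int d \<noteq> 0"
proof
  assume *: "of_int c * z + of_int d = 0"
  then have "Im (of_int c * z + of_int d) = 0" by simp
  then have "c = 0" using assms by simp
  with * have "d = 0" by simp
  with \<open>c = 0\<close> assms show False by simp
qed

lemma Im_moebius_act:
  assumes det: "a * d - b * c = 1" and z: "Im z > 0"
  shows "Im (moebius_act a b c d z) = Im z / norm (of_int c * z + of_int d) ^ 2"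
proof -
  let ?w = "of_int c * z + of_int d"
  have nz: "?w \<noteq> 0" by (rule cocycle_nonzero[OF det z])
  have "moebius_act a b c d z = (of_int a * z + of_int b) * cnj ?w / of_real (norm ?w ^ 2)"
    unfolding moebius_act_def using complex_div_cnj by blast
  then have "Im (moebius_act a b c d z) = Im ((of_int a * z + of_int b) * cnj ?w) / norm ?w ^ 2"
    by (simp only: Im_divide_of_real)
  also have "Im ((of_int a * z + of_int b) * cnj ?w) = (of_int a * of_int d - of_int b * of_int c) * Im z"
    by (simp add: algebra_simps)
  also have "(of_int a * of_int d - of_int b * of_int c :: real) = of_int (a * d - b * c)" by simp
  finally show ?thesis using det by simp
qed

lemma Im_moebius_pos:
  assumes det: "a * d - b * c = 1" and z: "Im z > 0"
  shows "Im (moebius_act a b c d z) > 0"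
  using Im_moebius_act[OF det z] cocycle_nonzero[OF det z] z by simp

lemma moebius_T:
  assumes det: "a * d - b * c = 1" and z: "Im z > 0"
  shows "moebius_act (a + c) (b + d) c d z = moebius_act a b c d z + 1"
    "moebius_act (a - c) (b - d) c d z = moebius_act a b c d z - 1"
  using cocycle_nonzero[OF det z] by (simp_all add: moebius_act_def field_simps)

lemma moebius_S:
  assumes det: "a * d - b * c = 1" and z: "Im z > 0"
  shows "moebius_act (- c) (- d) a b z = - 1 / moebius_act a b c d z"
proof -
  have "of_int (- c) * z + of_int (- d) = - (of_int c * z + of_int d)" by simp
  then show ?thesis unfolding moebius_act_def by simp
qed

lemma qexp_P_moebius_act:
  assumes det: "a * d - b * c = 1" and z: "Im z > 0"
  shows "qexp P_fps (moebius_act a b c d z) = (of_int c * z + of_int d) ^ 2 * qexp P_fps z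
     + 6 / (pi * \<i>) * of_int c * (of_int c * z + of_int d)"
  using det
proof (induction rule: SL2_induct)
  case one
  then show ?case by (simp add: moebius_act_def)
next
  case minus_one
  then show ?case by (simp add: moebius_act_def)
next
  case (T a b c d)
  then show ?case
    using qexp_add_int[of P_fps "moebius_act a b c d z" 1] z by (simp add: moebius_T)
next
  case (T_inv a b c d)
  then show ?case
    using qexp_add_int[of P_fps "moebius_act a b c d z" "- 1"] z by (simp add: moebius_T)
next
  case (S a b c d)
  define x where "x = of_int c * z + of_int d"
  define y where "y = of_int a * z + of_int b"
  define p where "p = qexp P_fps z"
  define k where "k = 6 / (pi * \<i>)"
  have x0: "x \<noteq> 0" unfolding x_def by (rule cocycle_nonzero[OF S.hyps z])
  \<comment> \<open>The determinant condition in the form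
    \<open>c (a z + b) + 1 = a (c z + d)\<close>; it merges the old extra term with the one produced
    by the inversion.\<close>
  have xy: "y * of_int c + 1 = of_int a * x"
  proof -
    have "of_int (a * d - b * c) = (1 :: complex)" using S.hyps by simp
    then show ?thesis by (simp add: x_def y_def algebra_simps)
  qed
  have "qexp P_fps (moebius_act (- c) (- d) a b z) = (y / x) ^ 2 * (x ^ 2 * p + k * of_int c * x) + k * (y / x)"
    unfolding moebius_S[OF S.hyps z] qexp_P_S[OF Im_moebius_pos[OF S.hyps z]] S.IH
    by (simp add: moebius_act_def x_def y_def p_def k_def)
  also have "\<dots> = y ^ 2 * p + k * (y * (y * of_int c + 1) / x)"
    using x0 by (simp add: field_simps power2_eq_square)
  also have "\<dots> = y ^ 2 * p + k * of_int a * y"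
    unfolding xy using x0 by simp
  finally show ?case by (simp add: y_def p_def k_def)
qed

lemma qexp_Q_moebius_act:
  assumes det: "a * d - b * c = 1" and z: "Im z > 0"
  shows "qexp Q_fps (moebius_act a b c d z) = (of_int c * z + of_int d) ^ 4 * qexp Q_fps z"
  using det
proof (induction rule: SL2_induct)
  case (T a b c d)
  then show ?case
    using qexp_add_int[of Q_fps "moebius_act a b c d z" 1] z by (simp add: moebius_T)
next
  case (T_inv a b c d)
  then show ?case
    using qexp_add_int[of Q_fps "moebius_act a b c d z" "- 1"] z by (simp add: moebius_T)
next
  case (S a b c d)
  have "of_int c * z + of_int d \<noteq> 0" by (rule cocycle_nonzero[OF S.hyps z])
  then show ?case
    unfolding moebius_S[OF S.hyps z] qexp_Q_S[OF Im_moebius_pos[OF S.hyps z]] S.IH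
    by (simp add: moebius_act_def power_divide)
qed (simp_all add: moebius_act_def)

text \<open>The multiplier of the weight one form \<open>\<eta>\<^sup>2\<close> is the character \<open>exp (2 \<pi> i \<psi> / 12)\<close> of
  \<open>SL\<^sub>2(\<int>)\<close>; the following is the classical polynomial formula for the exponent.\<close>
definition eta_exponent :: "int \<Rightarrow> int \<Rightarrow> int \<Rightarrow> int \<Rightarrow> int" where
  "eta_exponent a b c d = (1 - c ^ 2) * (b * d + 3 * (c - 1) * d + c + 3) + c * (a + d - 3)"

lemma dvd_12_iff: "(12 :: int) dvd n \<longleftrightarrow> n mod 3 = 0 \<and> n mod 4 = 0"
  by presburger

text \<open>Integer polynomials depend only on residues, so a congruence modulo \<open>m\<close> on
  the infinite solution set of \<open>g = 0\<close> follows from checking \<open>m^4\<close>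
  quadruples. By \<open>dvd_12_iff\<close> only \<open>m = 3\<close> and \<open>m = 4\<close>
  occur.\<close>

lemma residues_exhaust:
  fixes f g :: "int \<Rightarrow> int \<Rightarrow> int \<Rightarrow> int \<Rightarrow> int"
  assumes f: "\<And>a b c d. [f a b c d = f (a mod m) (b mod m) (c mod m) (d mod m)] (mod m)"
    and g: "\<And>a b c d. [g a b c d = g (a mod m) (b mod m) (c mod m) (d mod m)] (mod m)"
    and all: "\<forall>a\<in>set [0..m - 1]. \<forall>b\<in>set [0..m - 1]. \<forall>c\<in>set [0..m - 1]. \<forall>d\<in>set [0..m - 1].
      g a b c d mod m = 0 \<longrightarrow> f a b c d mod m = 0"
    and m: "m > 0" and 0: "g a b c d = 0"
  shows "f a b c d mod m = 0"
proof -
  have "g (a mod m) (b mod m) (c mod m) (d mod m) mod m = 0"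
    using g[of a b c d] 0 by (simp add: cong_def)
  then have "f (a mod m) (b mod m) (c mod m) (d mod m) mod m = 0"
    using all m by simp
  then show ?thesis using f[of a b c d] by (simp add: cong_def)
qed

lemma cong_self_mod: "[a = a mod m] (mod m)" for a m :: int
  by (simp add: cong_def)

lemma cong_neg: "[a = b] (mod m) \<Longrightarrow> [- a = - b] (mod m)" for a b m :: int
  using cong_diff[OF cong_refl[of 0 m], of a b] by simp

lemmas poly_cong_intros = cong_add cong_mult cong_diff cong_pow cong_neg cong_self_mod cong_refl

text \<open>The increments of the exponent, \<open>1\<close> here and \<open>- 3\<close> for the
  inversion, mirror the factors \<open>exp (\<pi> i / 6)\<close> and \<open>- i\<close> in the laws
  of \<open>\<eta>^2\<close>.\<close>

lemma eta_exponent_T: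
  assumes det: "a * d - b * c = 1"
  shows "12 dvd eta_exponent (a + c) (b + d) c d - eta_exponent a b c d - 1"
proof -
  let ?f = "\<lambda>a b c d. eta_exponent (a + c) (b + d) c d - eta_exponent a b c d - 1"
  let ?g = "\<lambda>a b c d :: int. a * d - b * c - 1"
  have cong: "[?f a b c d = ?f (a mod m) (b mod m) (c mod m) (d mod m)] (mod m)"
    "[?g a b c d = ?g (a mod m) (b mod m) (c mod m) (d mod m)] (mod m)" for a b c d m
    unfolding eta_exponent_def by (intro poly_cong_intros)+
  have "?g a b c d = 0" using det by simp
  have "?f a b c d mod 3 = 0"
    by (rule residues_exhaust[where f = ?f and g = ?g, OF cong _ _ \<open>?g a b c d = 0\<close>]) (code_simp, simp)
  moreover have "?f a b c d mod 4 = 0"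
    by (rule residues_exhaust[where f = ?f and g = ?g, OF cong _ _ \<open>?g a b c d = 0\<close>]) (code_simp, simp)
  ultimately show ?thesis unfolding dvd_12_iff by blast
qed

lemma eta_exponent_S:
  assumes det: "a * d - b * c = 1"
  shows "12 dvd eta_exponent (- c) (- d) a b - eta_exponent a b c d + 3"
proof -
  let ?f = "\<lambda>a b c d. eta_exponent (- c) (- d) a b - eta_exponent a b c d + 3"
  let ?g = "\<lambda>a b c d :: int. a * d - b * c - 1"
  have cong: "[?f a b c d = ?f (a mod m) (b mod m) (c mod m) (d mod m)] (mod m)"
    "[?g a b c d = ?g (a mod m) (b mod m) (c mod m) (d mod m)] (mod m)" for a b c d m
    unfolding eta_exponent_def by (intro poly_cong_intros)+
  have "?g a b c d = 0" using det by simp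
  have "?f a b c d mod 3 = 0"
    by (rule residues_exhaust[where f = ?f and g = ?g, OF cong _ _ \<open>?g a b c d = 0\<close>]) (code_simp, simp)
  moreover have "?f a b c d mod 4 = 0"
    by (rule residues_exhaust[where f = ?f and g = ?g, OF cong _ _ \<open>?g a b c d = 0\<close>]) (code_simp, simp)
  ultimately show ?thesis unfolding dvd_12_iff by blast
qed

definition eta_mult :: "int \<Rightarrow> complex" where "eta_mult k = exp (pi * \<i> / 6 * of_int k)"

lemma eta_mult_add: "eta_mult (j + k) = eta_mult j * eta_mult k"
  by (simp add: eta_mult_def exp_add[symmetric] algebra_simps add_divide_distrib)

lemma eta_mult_12: "12 dvd k \<Longrightarrow> eta_mult k = 1"
proof (elim dvdE)
  fix j assume "k = 12 * j"
  then have "eta_mult k = exp (of_int (2 * j) * (pi * \<i>))"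
    unfolding eta_mult_def by (intro arg_cong[where f = exp]) simp
  then show ?thesis using exp_integer_2pi[of "of_int j"] by (simp add: mult_ac)
qed

lemma eta_mult_cong: "12 dvd j - k \<Longrightarrow> eta_mult j = eta_mult k"
  using eta_mult_add[of "j - k" k] eta_mult_12[of "j - k"] by simp

lemma eta_mult_1: "eta_mult 1 = exp (pi * \<i> / 6)"
  by (simp add: eta_mult_def)

lemma norm_eta_mult [simp]: "norm (eta_mult k) = 1"
  by (simp add: eta_mult_def)

lemma eta_mult_6: "eta_mult 6 = - 1"
  by (simp add: eta_mult_def)

lemma eta_mult_minus_3: "eta_mult (- 3) = - \<i>"
proof -
  have "eta_mult (- 3) = cis (- (pi / 2))" by (simp add: eta_mult_def cis_conv_exp mult_ac)
  then show ?thesis by (simp add: cis.ctr complex_eq_iff)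
qed

lemma eta_squared_moebius_act:
  assumes det: "a * d - b * c = 1" and z: "Im z > 0"
  shows "eta (moebius_act a b c d z) ^ 2 = eta_mult (eta_exponent a b c d) * (of_int c * z + of_int d) * eta z ^ 2"
  using det
proof (induction rule: SL2_induct)
  case one
  then show ?case by (simp add: moebius_act_def eta_exponent_def eta_mult_def)
next
  \<comment> \<open>For the negative of the identity the exponent is \<open>6\<close>, and the
    multiplier \<open>- 1\<close> cancels the cocycle \<open>- 1\<close>.\<close>
  case minus_one
  then show ?case by (simp add: moebius_act_def eta_exponent_def eta_mult_6)
next
  case (T a b c d)
  have "eta_mult (eta_exponent (a + c) (b + d) c d) = eta_mult (1 + eta_exponent a b c d)"
    using eta_exponent_T[OF T.hyps] by (intro eta_mult_cong) (simp add: algebra_simps)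
  then show ?case
    unfolding moebius_T[OF T.hyps z] eta_squared_T T.IH eta_mult_add eta_mult_1 by simp
next
  case (T_inv a b c d)
  have det': "(a - c) * d - (b - d) * c = 1" using T_inv.hyps by (simp add: algebra_simps)
  have "eta_mult (eta_exponent a b c d) = eta_mult (1 + eta_exponent (a - c) (b - d) c d)"
    using eta_exponent_T[OF det'] by (intro eta_mult_cong) (simp add: algebra_simps)
  then have e: "eta_mult (eta_exponent a b c d) = exp (pi * \<i> / 6) * eta_mult (eta_exponent (a - c) (b - d) c d)"
    unfolding eta_mult_add eta_mult_1 .
  have "exp (pi * \<i> / 6) * eta (moebius_act a b c d z - 1) ^ 2 = eta (moebius_act a b c d z) ^ 2"
    using eta_squared_T[of "moebius_act a b c d z - 1"] by simp
  also have "\<dots> = exp (pi * \<i> / 6) *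
      (eta_mult (eta_exponent (a - c) (b - d) c d) * (of_int c * z + of_int d) * eta z ^ 2)"
    unfolding T_inv.IH e by (simp only: mult.assoc)
  finally show ?case
    unfolding moebius_T[OF T_inv.hyps z] mult_cancel_left by simp
next
  case (S a b c d)
  have "eta_mult (eta_exponent (- c) (- d) a b) = eta_mult (- 3 + eta_exponent a b c d)"
    using eta_exponent_S[OF S.hyps] by (intro eta_mult_cong) (simp add: algebra_simps)
  moreover have "of_int c * z + of_int d \<noteq> 0" by (rule cocycle_nonzero[OF S.hyps z])
  ultimately show ?case
    unfolding moebius_S[OF S.hyps z] eta_squared_S[OF Im_moebius_pos[OF S.hyps z]] S.IH eta_mult_add eta_mult_minus_3
    by (simp add: moebius_act_def)
qed

section \<open>Sturm's bound\<close>

type_synonym mat2 = "int \<times> int \<times> int \<times> int"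

definition SL2 :: "mat2 set" where
  "SL2 = {(a, b, c, d). a * d - b * c = 1}"

fun mat2_mult :: "mat2 \<Rightarrow> mat2 \<Rightarrow> mat2" where
  "mat2_mult (a, b, c, d) (a', b', c', d') =
     (a * a' + b * c', a * b' + b * d', c * a' + d * c', c * b' + d * d')"

fun mat2_inv :: "mat2 \<Rightarrow> mat2" where
  "mat2_inv (a, b, c, d) = (d, - b, - c, a)"

fun act :: "mat2 \<Rightarrow> complex \<Rightarrow> complex" where
  "act (a, b, c, d) z = moebius_act a b c d z"

fun cocycle :: "mat2 \<Rightarrow> complex \<Rightarrow> complex" where
  "cocycle (a, b, c, d) z = of_int c * z + of_int d"

definition Gamma0 :: "int \<Rightarrow> mat2 set" where
  "Gamma0 N = {(a, b, c, d). a * d - b * c = 1 \<and> N dvd c}"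

lemma SL2_mult: "g \<in> SL2 \<Longrightarrow> h \<in> SL2 \<Longrightarrow> mat2_mult g h \<in> SL2"
proof -
  assume "g \<in> SL2" "h \<in> SL2"
  moreover obtain a b c d a' b' c' d' where gh: "g = (a, b, c, d)" "h = (a', b', c', d')"
    by (metis prod_cases4)
  moreover have "(a * a' + b * c') * (c * b' + d * d') - (a * b' + b * d') * (c * a' + d * c') =
      (a * d - b * c) * (a' * d' - b' * c')"
    by (simp add: algebra_simps)
  ultimately show ?thesis by (simp add: SL2_def)
qed

lemma SL2_inv: "g \<in> SL2 \<Longrightarrow> mat2_inv g \<in> SL2"
  by (cases g) (auto simp: SL2_def algebra_simps)

lemma SL2_mult_inv: "g \<in> SL2 \<Longrightarrow> mat2_mult g (mat2_inv g) = (1, 0, 0, 1)"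
  by (cases g) (auto simp: SL2_def algebra_simps)

lemma mat2_mult_one: "mat2_mult g (1, 0, 0, 1) = g" "mat2_mult (1, 0, 0, 1) g = g"
  by (cases g; simp)+

lemma mat2_mult_assoc: "mat2_mult (mat2_mult g h) k = mat2_mult g (mat2_mult h k)"
  by (cases g; cases h; cases k) (simp add: algebra_simps)

lemma SL2_one: "(1, 0, 0, 1) \<in> SL2"
  by (simp add: SL2_def)

lemma Gamma0_subset: "Gamma0 N \<subseteq> SL2"
  by (auto simp: Gamma0_def SL2_def)

lemma Im_act_pos: "g \<in> SL2 \<Longrightarrow> Im z > 0 \<Longrightarrow> Im (act g z) > 0"
  by (cases g) (auto simp: SL2_def intro: Im_moebius_pos)

lemma SL2_cocycle_nonzero: "g \<in> SL2 \<Longrightarrow> Im z > 0 \<Longrightarrow> cocycle g z \<noteq> 0"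
  using cocycle_nonzero by (cases g) (auto simp: SL2_def)

lemma moebius_act_one [simp]: "moebius_act 1 0 0 1 z = z"
  by (simp add: moebius_act_def)

lemma cocycle_mult:
  assumes "g \<in> SL2" "h \<in> SL2" "Im z > 0"
  shows "cocycle (mat2_mult g h) z = cocycle g (act h z) * cocycle h z"
proof -
  obtain a b c d a' b' c' d' where gh: "g = (a, b, c, d)" "h = (a', b', c', d')"
    by (metis prod_cases4)
  have "of_int c' * z + of_int d' \<noteq> 0" using SL2_cocycle_nonzero[OF assms(2,3)] gh by simp
  then show ?thesis by (simp add: gh moebius_act_def field_simps)
qed

lemma act_mult:
  assumes "g \<in> SL2" "h \<in> SL2" "Im z > 0"
  shows "act (mat2_mult g h) z = act g (act h z)"
proof -
  obtain a b c d a' b' c' d' where gh: "g = (a, b, c, d)" "h = (a', b', c', d')"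
    by (metis prod_cases4)
  let ?x = "of_int a' * z + of_int b'" and ?y = "of_int c' * z + of_int d'"
  have y: "?y \<noteq> 0" using SL2_cocycle_nonzero[OF assms(2,3)] gh by simp
  have divide: "(s * ?x + t * ?y) / ?y = s * (?x / ?y) + t" for s t
  proof -
    have "(s * x + t * y) / y = s * (x / y) + t" if "y \<noteq> 0" for x y :: complex
      using that by (simp add: field_simps)
    then show ?thesis using y by blast
  qed
  have "act (mat2_mult g h) z = (of_int a * ?x + of_int b * ?y) / (of_int c * ?x + of_int d * ?y)"
    by (simp add: gh moebius_act_def algebra_simps)
  also have "\<dots> = ((of_int a * ?x + of_int b * ?y) / ?y) / ((of_int c * ?x + of_int d * ?y) / ?y)"
    using y by simp
  also have "(of_int a * ?x + of_int b * ?y) / ?y = of_int a * (?x / ?y) + of_int b"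
    by (rule divide)
  also have "(of_int c * ?x + of_int d * ?y) / ?y = of_int c * (?x / ?y) + of_int d"
    by (rule divide)
  finally show ?thesis by (simp add: gh moebius_act_def)
qed

lemma holomorphic_act:
  assumes "g \<in> SL2"
  shows "act g holomorphic_on {z. Im z > 0}"
proof -
  obtain a b c d where g: "g = (a, b, c, d)" by (metis prod_cases4)
  have "(\<lambda>z. (of_int a * z + of_int b) / (of_int c * z + of_int d)) holomorphic_on {z. Im z > 0}"
    using SL2_cocycle_nonzero[OF assms] g by (intro holomorphic_intros) auto
  then show ?thesis by (simp add: g moebius_act_def[abs_def] fun_eq_iff cong: holomorphic_cong)
qed

text \<open>Each inversion at least doubles an imaginary part below \<open>1/2\<close>, so no fundamental domain is needed.\<close>
lemma SL2_reduction:
  assumes "Im z > 0"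
  obtains g where "g \<in> SL2" "\<bar>Re (act g z)\<bar> \<le> 1 / 2" "Im (act g z) \<ge> 1 / 2"
proof -
  have "\<exists>g\<in>SL2. \<bar>Re (act g z)\<bar> \<le> 1 / 2 \<and> Im (act g z) \<ge> 1 / 2" if "Im z \<ge> (1 / 2) ^ Suc n" for n z
    using that
  proof (induction n arbitrary: z)
    case (0 z)
    define g :: mat2 where "g = (1, - round (Re z), 0, 1)"
    have "act g z = z - of_int (round (Re z))" by (simp add: g_def moebius_act_def)
    then have "\<bar>Re (act g z)\<bar> \<le> 1 / 2" "Im (act g z) = Im z"
      using of_int_round_abs_le[of "Re z"] by (simp_all add: abs_minus_commute)
    moreover have "g \<in> SL2" by (simp add: g_def SL2_def)
    ultimately show ?case using 0 by (intro bexI[of _ g]) auto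
  next
    case (Suc n z)
    have "(0::real) < (1 / 2) ^ Suc (Suc n)" by simp
    then have z: "Im z > 0" using Suc.prems by linarith
    define g :: mat2 where "g = (1, - round (Re z), 0, 1)"
    define u where "u = act g z"
    have g: "g \<in> SL2" by (simp add: g_def SL2_def)
    have "u = z - of_int (round (Re z))" by (simp add: u_def g_def moebius_act_def)
    then have u: "\<bar>Re u\<bar> \<le> 1 / 2" "Im u = Im z"
      using of_int_round_abs_le[of "Re z"] by (simp_all add: abs_minus_commute)
    show ?case
    proof (cases "Im z \<ge> 1 / 2")
      case True
      then show ?thesis using u g by (intro bexI[of _ g]) (auto simp: u_def)
    next
      case False
      define S :: mat2 where "S = (0, - 1, 1, 0)"
      have S: "S \<in> SL2" by (simp add: S_def SL2_def)
      have iu: "Im u > 0" using u z by simp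
      have "norm u ^ 2 = \<bar>Re u\<bar> ^ 2 + (Im u) ^ 2" by (simp add: cmod_power2)
      also have "\<dots> \<le> (1 / 2) ^ 2 + (1 / 2) ^ 2"
        using u z False by (intro add_mono power_mono) auto
      finally have nu: "norm u ^ 2 \<le> 1 / 2" by (simp add: power2_eq_square)
      have u0: "norm u ^ 2 > 0" using iu by auto
      have "Im (act S u) = Im u / norm u ^ 2"
        using Im_moebius_act[of 0 0 "-1" 1 u] iu by (simp add: S_def)
      also have "\<dots> \<ge> Im u / (1 / 2)"
        using nu u0 iu by (intro divide_left_mono) auto
      finally have "Im (act S u) \<ge> 2 * Im z" using u by simp
      then have "Im (act S u) \<ge> (1 / 2) ^ Suc n" using Suc.prems by simp
      from Suc.IH[OF this] obtain h where h: "h \<in> SL2" "\<bar>Re (act h (act S u))\<bar> \<le> 1 / 2" "Im (act h (act S u)) \<ge> 1 / 2"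
        by blast
      have "act h (act S u) = act (mat2_mult h (mat2_mult S g)) z"
        using h g S z iu by (simp add: act_mult SL2_mult Im_act_pos u_def)
      then show ?thesis using h SL2_mult[OF h(1) SL2_mult[OF S g]] by metis
    qed
  qed
  moreover obtain n where "(1 / 2 :: real) ^ n < Im z"
    using real_arch_pow_inv[OF assms, of "1 / 2"] by auto
  moreover have "(1 / 2 :: real) ^ Suc n \<le> (1 / 2) ^ n" by simp
  ultimately show ?thesis using that by (meson less_imp_le order_trans)
qed

text \<open>If \<open>H z \<noteq> 0\<close>, the maximum modulus is attained: by reduction every
  value occurs in the strip over \<open>K\<close>, and above height \<open>Y\<close> the modulus
  lies below that at \<open>z\<close>, so the compact rectangle \<open>K\<close> suffices. The
  maximum modulus principle then makes \<open>H\<close> constant, against its smallness near the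
  cusp.\<close>

lemma modular_function_eq_0:
  assumes hol: "H holomorphic_on {z. Im z > 0}"
    and inv: "\<And>g z. g \<in> SL2 \<Longrightarrow> Im z > 0 \<Longrightarrow> H (act g z) = H z"
    and lim: "\<And>\<epsilon>. \<epsilon> > 0 \<Longrightarrow> \<exists>Y>0. \<forall>z. Im z \<ge> Y \<longrightarrow> norm (H z) < \<epsilon>"
    and z: "Im z > 0"
  shows "H z = 0"
proof (rule ccontr)
  let ?U = "{z. Im z > 0}"
  assume nz: "H z \<noteq> 0"
  define \<epsilon> where "\<epsilon> = norm (H z)"
  have "\<epsilon> > 0" using nz by (simp add: \<epsilon>_def)
  from lim[OF this] obtain Y where Y: "Y > 0" "\<And>z. Im z \<ge> Y \<Longrightarrow> norm (H z) < \<epsilon>" by blast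
  define K where "K = cbox (Complex (- 1 / 2) (1 / 2)) (Complex (1 / 2) Y)"
  have K: "u \<in> K \<longleftrightarrow> \<bar>Re u\<bar> \<le> 1 / 2 \<and> Im u \<ge> 1 / 2 \<and> Im u \<le> Y" for u
    by (auto simp: K_def in_cbox_complex_iff)
  have KU: "K \<subseteq> ?U" using K by auto
  have red: "\<exists>u. \<bar>Re u\<bar> \<le> 1 / 2 \<and> Im u \<ge> 1 / 2 \<and> H u = H v" if "Im v > 0" for v
    using SL2_reduction[OF that] inv[OF _ that] by metis
  obtain z1 where z1: "\<bar>Re z1\<bar> \<le> 1 / 2" "Im z1 \<ge> 1 / 2" "H z1 = H z" using red[OF z] by blast
  have "z1 \<in> K" using z1 Y(2)[of z1] by (force simp: K \<epsilon>_def)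
  moreover have "continuous_on K (\<lambda>z. norm (H z))"
    using holomorphic_on_imp_continuous_on[OF hol] KU by (intro continuous_on_norm) (rule continuous_on_subset)
  moreover have "compact K" by (simp add: K_def compact_cbox)
  ultimately obtain \<xi> where \<xi>: "\<xi> \<in> K" "\<And>u. u \<in> K \<Longrightarrow> norm (H u) \<le> norm (H \<xi>)"
    using continuous_attains_sup[of K "\<lambda>z. norm (H z)"] by blast
  have \<epsilon>: "\<epsilon> \<le> norm (H \<xi>)" using \<xi>(2)[OF \<open>z1 \<in> K\<close>] z1 by (simp add: \<epsilon>_def)
  have max: "norm (H v) \<le> norm (H \<xi>)" if "v \<in> ?U" for v
  proof -
    have "Im v > 0" using that by simp
    from red[OF this] obtain u where u: "\<bar>Re u\<bar> \<le> 1 / 2" "Im u \<ge> 1 / 2" "H u = H v" by blast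
    show ?thesis
    proof (cases "Im u \<le> Y")
      case True
      then show ?thesis using \<xi>(2)[of u] u by (simp add: K)
    next
      case False
      then show ?thesis using Y(2)[of u] u \<epsilon> by simp
    qed
  qed
  have "H constant_on ?U"
    by (rule maximum_modulus_principle[OF hol, of ?U \<xi>])
       (use KU \<xi>(1) max in \<open>auto simp: open_halfspace_Im_gt intro: convex_connected convex_halfspace_Im_gt\<close>)
  then obtain c where c: "\<And>v. Im v > 0 \<Longrightarrow> H v = c" by (auto simp: constant_on_def)
  have "norm (H (Complex 0 Y)) < \<epsilon>" by (rule Y(2)) simp
  moreover have "H (Complex 0 Y) = H z" using c[OF z] c[of "Complex 0 Y"] Y by simp
  ultimately show False by (simp add: \<epsilon>_def)
qed

text \<open>Holomorphic functions on a connected open set form an integral domain: \<open>f\<close>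
  vanishes on the open set where \<open>g\<close> does not, and the identity theorem spreads
  this.\<close>

lemma holomorphic_mult_eq_0:
  assumes f: "f holomorphic_on S" and g: "g holomorphic_on S" and S: "open S" "connected S"
    and 0: "\<And>z. z \<in> S \<Longrightarrow> f z * g z = 0"
  shows "(\<forall>z\<in>S. f z = 0) \<or> (\<forall>z\<in>S. g z = 0)"
proof (rule disjCI)
  assume "\<not> (\<forall>z\<in>S. g z = 0)"
  then obtain w where w: "w \<in> S" "g w \<noteq> 0" by blast
  have "continuous_on S g" using g by (rule holomorphic_on_imp_continuous_on)
  then have op: "open (S \<inter> g -` (- {0}))"
    by (rule continuous_open_preimage) (auto simp: S)
  show "\<forall>z\<in>S. f z = 0"
  proof
    fix z assume "z \<in> S"
    show "f z = 0"
      by (rule analytic_continuation_open[OF op S(1) _ S(2) _ f _ _ \<open>z \<in> S\<close>, where g = "\<lambda>_. 0"])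
         (use w 0 in auto)
  qed
qed

lemma holomorphic_prod_eq_0:
  assumes "finite R" "\<And>f. f \<in> R \<Longrightarrow> f holomorphic_on S" "open S" "connected S" "S \<noteq> {}"
    and "\<And>z. z \<in> S \<Longrightarrow> (\<Prod>f\<in>R. f z) = 0"
  shows "\<exists>f\<in>R. \<forall>z\<in>S. f z = (0 :: complex)"
  using assms(1,2,6)
proof (induction R rule: finite_induct)
  case empty
  then show ?case using assms(5) by auto
next
  case (insert f R)
  have "(\<forall>z\<in>S. f z = 0) \<or> (\<forall>z\<in>S. (\<Prod>f\<in>R. f z) = 0)"
    using insert by (intro holomorphic_mult_eq_0 assms(3,4) holomorphic_intros) auto
  then show ?case using insert by auto
qed

lemma eta_24_act:
  assumes "g \<in> SL2" "Im z > 0"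
  shows "eta (act g z) ^ 24 = cocycle g z ^ 12 * eta z ^ 24"
proof -
  obtain a b c d where g: "g = (a, b, c, d)" by (metis prod_cases4)
  have det: "a * d - b * c = 1" using assms g by (simp add: SL2_def)
  have m: "eta_mult k ^ 12 = 1" for k
  proof -
    have "eta_mult k ^ n = eta_mult (int n * k)" for n
      by (induction n) (simp_all add: eta_mult_add algebra_simps, simp add: eta_mult_def)
    from this[of 12] show ?thesis using eta_mult_12[of "12 * k"] by simp
  qed
  have "(eta (act g z) ^ 2) ^ 12 = (eta_mult (eta_exponent a b c d) * (of_int c * z + of_int d) * eta z ^ 2) ^ 12"
    using eta_squared_moebius_act[OF det assms(2)] by (simp add: g)
  also have "\<dots> = cocycle g z ^ 12 * (eta z ^ 2) ^ 12"
    by (simp only: power_mult_distrib m g cocycle.simps mult_1)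
  finally show ?thesis by (simp flip: power_mult)
qed

text \<open>The value \<open>0\<close> off the upper half plane makes conjugates that agree on it
  equal as functions, so that they can be collected in a finite set.\<close>

definition slash :: "nat \<Rightarrow> (complex \<Rightarrow> complex) \<Rightarrow> mat2 \<Rightarrow> complex \<Rightarrow> complex" where
  "slash k G g z = (if Im z > 0 then G (act g z) / cocycle g z ^ k else 0)"

lemma slash_slash:
  assumes "g \<in> SL2" "h \<in> SL2"
  shows "slash k (slash k G g) h = slash k G (mat2_mult g h)"
  using assms by (auto simp: slash_def fun_eq_iff act_mult cocycle_mult Im_act_pos power_mult_distrib)

lemma holomorphic_slash:
  assumes G: "G holomorphic_on {z. Im z > 0}" and g: "g \<in> SL2"
  shows "slash k G g holomorphic_on {z. Im z > 0}"
proof -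
  have 1: "(G \<circ> act g) holomorphic_on {z. Im z > 0}"
    by (rule holomorphic_on_compose_gen[OF holomorphic_act[OF g] G]) (use Im_act_pos[OF g] in auto)
  have 2: "cocycle g holomorphic_on {z. Im z > 0}"
  proof -
    obtain a b c d where "g = (a, b, c, d)" by (metis prod_cases4)
    then have "cocycle g = (\<lambda>z. of_int c * z + of_int d)" by (auto simp: fun_eq_iff)
    then show ?thesis by (auto intro!: holomorphic_intros)
  qed
  have "(\<lambda>z. (G \<circ> act g) z / cocycle g z ^ k) holomorphic_on {z. Im z > 0}"
    by (rule holomorphic_on_divide[OF 1 holomorphic_on_power[OF 2]])
       (use SL2_cocycle_nonzero[OF g] in auto)
  then show ?thesis
    by (rule holomorphic_cong[THEN iffD1, OF refl, rotated]) (auto simp: slash_def)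
qed

text \<open>The product \<open>\<Phi>\<close> of the conjugates of \<open>G\<close> is modular for the full group, and
  \<open>\<Phi>\<^sup>1\<^sup>2 / \<eta>\<^sup>2\<^sup>4\<^sup>k\<^sup>m\<close> is a modular function vanishing at the cusp.\<close>
theorem sturm_bound:
  assumes hol: "G holomorphic_on {z. Im z > 0}"
    and inv: "\<And>g z. g \<in> Gamma0 N \<Longrightarrow> Im z > 0 \<Longrightarrow> G (act g z) = cocycle g z ^ k * G z"
    and cusps: "\<And>g. g \<in> SL2 \<Longrightarrow> \<exists>K. \<forall>z. Im z \<ge> 1 \<longrightarrow> norm (G (act g z)) \<le> K * norm (cocycle g z) ^ k"
    and vanish: "\<exists>K. \<forall>z. Im z \<ge> 1 \<longrightarrow> norm (G z) \<le> K * norm (nome z) ^ n"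
    and reps: "finite reps" "reps \<subseteq> SL2"
      "\<And>g. g \<in> SL2 \<Longrightarrow> \<exists>\<rho>\<in>reps. mat2_mult g (mat2_inv \<rho>) \<in> Gamma0 N"
    and bound: "k * card reps < 12 * n"
    and z: "Im z > 0"
  shows "G z = 0"
proof -
  let ?U = "{z. Im z > 0}"
  have G0: "G z = 0" if "\<exists>g\<in>SL2. \<forall>z\<in>?U. slash k G g z = 0"
  proof -
    from that obtain g where g: "g \<in> SL2" "\<And>z. Im z > 0 \<Longrightarrow> slash k G g z = 0" by auto
    have i: "Im (act (mat2_inv g) z) > 0" using g z by (intro Im_act_pos SL2_inv)
    have "act g (act (mat2_inv g) z) = z"
      using act_mult[OF g(1) SL2_inv[OF g(1)] z] by (simp add: SL2_mult_inv g)
    then show ?thesis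
      using g(2)[OF i] SL2_cocycle_nonzero[OF g(1) i] i by (simp add: slash_def)
  qed
  \<comment> \<open>A set rather than a family indexed by cosets: coinciding conjugates count once,
    which can only lower the weight \<open>k * m\<close> of the product.\<close>
  define R where "R = slash k G ` SL2"
  have "slash k G g \<in> slash k G ` reps" if g: "g \<in> SL2" for g
  proof -
    obtain \<rho> where \<rho>: "\<rho> \<in> reps" "mat2_mult g (mat2_inv \<rho>) \<in> Gamma0 N" using reps(3)[OF g] by blast
    let ?h = "mat2_mult g (mat2_inv \<rho>)"
    have \<rho>S: "\<rho> \<in> SL2" using \<rho> reps by blast
    have hS: "?h \<in> SL2" using \<rho>(2) Gamma0_subset by blast
    have "mat2_mult (mat2_inv \<rho>) \<rho> = (1, 0, 0, 1)"
      using \<rho>S by (cases \<rho>) (auto simp: SL2_def algebra_simps)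
    then have gh: "g = mat2_mult ?h \<rho>" by (simp add: mat2_mult_assoc mat2_mult_one)
    have "slash k G ?h w = slash k G (1, 0, 0, 1) w" for w
      using inv[OF \<rho>(2)] SL2_cocycle_nonzero[OF hS] by (simp add: slash_def)
    then have "slash k G ?h = slash k G (1, 0, 0, 1)" by blast
    then have "slash k G g = slash k G \<rho>"
      using slash_slash[OF hS \<rho>S, of k G] slash_slash[OF SL2_one \<rho>S, of k G] gh by (simp add: mat2_mult_one)
    with \<rho> show ?thesis by blast
  qed
  then have R_eq: "R = slash k G ` reps" using reps(2) by (auto simp: R_def)
  define m where "m = card R"
  have finR: "finite R" using R_eq reps(1) by simp
  have "m \<le> card reps" unfolding m_def R_eq by (rule card_image_le[OF reps(1)])
  then have "k * m \<le> k * card reps" by simp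
  with bound have km: "k * m < 12 * n" by linarith
  define \<Phi> where "\<Phi> = (\<lambda>z. \<Prod>f\<in>R. f z)"
  have holR: "f holomorphic_on ?U" if "f \<in> R" for f
    using that holomorphic_slash[OF hol] by (auto simp: R_def)
  have \<Phi>_act: "\<Phi> (act g w) = cocycle g w ^ (k * m) * \<Phi> w" if g: "g \<in> SL2" and w: "Im w > 0" for g w
  proof -
    \<comment> \<open>Right translation by \<open>g\<close> maps this finite set injectively into
      itself, hence permutes it and leaves the product over it unchanged.\<close>
    have maps: "(\<lambda>f. slash k f g) ` R \<subseteq> R"
      using g by (auto simp: R_def slash_slash SL2_mult)
    have inj: "inj_on (\<lambda>f. slash k f g) R"
    proof (rule inj_on_inverseI[where g = "\<lambda>f. slash k f (mat2_inv g)"])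
      fix f assume "f \<in> R"
      then obtain h where "h \<in> SL2" "f = slash k G h" unfolding R_def by blast
      then show "slash k (slash k f g) (mat2_inv g) = f"
        using g by (simp add: slash_slash SL2_mult SL2_inv mat2_mult_assoc SL2_mult_inv mat2_mult_one)
    qed
    have im: "(\<lambda>f. slash k f g) ` R = R"
      by (rule endo_inj_surj[OF finR maps inj])
    have "\<Phi> (act g w) = (\<Prod>f\<in>R. cocycle g w ^ k * slash k f g w)"
      unfolding \<Phi>_def using SL2_cocycle_nonzero[OF g w] w by (intro prod.cong) (auto simp: slash_def)
    also have "\<dots> = cocycle g w ^ (k * m) * (\<Prod>f\<in>R. slash k f g w)"
      by (simp add: prod.distrib m_def power_mult)
    also have "(\<Prod>f\<in>R. slash k f g w) = (\<Prod>f\<in>(\<lambda>f. slash k f g) ` R. f w)"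
      by (subst prod.reindex[OF inj]) simp
    also have "\<dots> = \<Phi> w" unfolding im \<Phi>_def ..
    finally show ?thesis .
  qed
  define H where "H = (\<lambda>z. \<Phi> z ^ 12 / (eta z ^ 24) ^ (k * m))"
  have hol\<Phi>: "\<Phi> holomorphic_on ?U"
    unfolding \<Phi>_def using holR by (intro holomorphic_intros)
  have R_bound: "\<exists>K. \<forall>z. Im z \<ge> 1 \<longrightarrow> norm (f z) \<le> K" if fR: "f \<in> R" for f
  proof -
    obtain g where g: "g \<in> SL2" "f = slash k G g" using fR unfolding R_def by blast
    obtain K where K: "\<And>z. Im z \<ge> 1 \<Longrightarrow> norm (G (act g z)) \<le> K * norm (cocycle g z) ^ k"
      using cusps[OF g(1)] by blast
    have "norm (f z) \<le> K" if "Im z \<ge> 1" for z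
      using K[OF that] SL2_cocycle_nonzero[OF g(1), of z] that
      by (simp add: g(2) slash_def norm_divide norm_power divide_le_eq)
    then show ?thesis by blast
  qed
  have GR: "slash k G (1, 0, 0, 1) \<in> R" using SL2_one by (auto simp: R_def)
  \<comment> \<open>The conjugate by the identity carries the whole order of vanishing; the other
    factors need only be bounded at infinity.\<close>
  have "\<exists>C>0. \<forall>z. Im z \<ge> 1 \<longrightarrow> norm (\<Phi> z) \<le> C * norm (nome z) ^ n"
  proof -
    obtain K where K: "\<And>f z. f \<in> R \<Longrightarrow> Im z \<ge> 1 \<Longrightarrow> norm (f z) \<le> K f" using R_bound by metis
    obtain K0 where K0: "\<And>z. Im z \<ge> 1 \<Longrightarrow> norm (G z) \<le> K0 * norm (nome z) ^ n" using vanish by blast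
    define C where "C = \<bar>K0\<bar> * (\<Prod>f\<in>R - {slash k G (1, 0, 0, 1)}. \<bar>K f\<bar>)"
    have "norm (\<Phi> z) \<le> (C + 1) * norm (nome z) ^ n" if "Im z \<ge> 1" for z
    proof -
      have "norm (\<Phi> z) = norm (slash k G (1, 0, 0, 1) z) * (\<Prod>f\<in>R - {slash k G (1, 0, 0, 1)}. norm (f z))"
        unfolding \<Phi>_def by (subst prod.remove[OF finR GR]) (simp add: norm_mult prod_norm)
      also have "\<dots> \<le> (\<bar>K0\<bar> * norm (nome z) ^ n) * (\<Prod>f\<in>R - {slash k G (1, 0, 0, 1)}. \<bar>K f\<bar>)"
      proof (intro mult_mono prod_mono conjI)
        have "norm (G z) \<le> K0 * norm (nome z) ^ n" by (rule K0[OF that])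
        also have "\<dots> \<le> \<bar>K0\<bar> * norm (nome z) ^ n" by (intro mult_right_mono) auto
        finally show "norm (slash k G (1, 0, 0, 1) z) \<le> \<bar>K0\<bar> * norm (nome z) ^ n"
          using that by (simp add: slash_def)
        show "norm (f z) \<le> \<bar>K f\<bar>" if "f \<in> R - {slash k G (1, 0, 0, 1)}" for f
          using K[of f z] that \<open>Im z \<ge> 1\<close> by force
      qed (auto intro!: prod_nonneg)
      also have "\<dots> = C * norm (nome z) ^ n" by (simp add: C_def)
      also have "\<dots> \<le> (C + 1) * norm (nome z) ^ n" by (intro mult_right_mono) auto
      finally show ?thesis .
    qed
    moreover have "C \<ge> 0" unfolding C_def by (intro mult_nonneg_nonneg prod_nonneg) auto
    ultimately show ?thesis by (intro exI[of _ "C + 1"]) auto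
  qed
  then obtain C where C: "C > 0" "\<And>z. Im z \<ge> 1 \<Longrightarrow> norm (\<Phi> z) \<le> C * norm (nome z) ^ n" by blast
  obtain K where K: "K > 0" "\<And>z. Im z \<ge> 1 \<Longrightarrow> norm (eta z) \<ge> inverse K * exp (- pi * Im z / 12)"
    by (rule eta_growth[OF zero_less_one]) blast
  have H_bound: "norm (H z) \<le> C ^ 12 * K ^ (24 * (k * m)) * norm (nome z)" if z: "Im z \<ge> 1" for z
  proof -
    let ?q = "norm (nome z)"
    have q: "0 < ?q" "?q < 1" using z norm_nome_less_1[of z] by auto
    have "?q = exp (- pi * Im z / 12) ^ 24"
      by (simp add: norm_nome flip: exp_of_nat_mult)
    then have e: "?q ^ (k * m) = exp (- pi * Im z / 12) ^ (24 * (k * m))" by (simp add: power_mult)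
    have "(inverse K * exp (- pi * Im z / 12)) ^ (24 * (k * m)) \<le> norm (eta z) ^ (24 * (k * m))"
      using K z by (intro power_mono) auto
    then have lower: "inverse K ^ (24 * (k * m)) * ?q ^ (k * m) \<le> norm ((eta z ^ 24) ^ (k * m))"
      unfolding e by (simp add: power_mult_distrib norm_power power_mult)
    have "norm (\<Phi> z) ^ 12 \<le> (C * ?q ^ n) ^ 12" using C(2)[OF z] by (intro power_mono) auto
    also have "\<dots> = C ^ 12 * ?q ^ (12 * n)" by (simp add: power_mult_distrib mult.commute flip: power_mult)
    \<comment> \<open>By the strict bound, \<open>12 n\<close> exceeds \<open>k m\<close> by at
      least \<open>1\<close>: one power of \<open>q\<close> survives the division by
      \<open>\<eta>^(24 k m)\<close> and makes \<open>H\<close> vanish at the cusp.\<close>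
    also have "?q ^ (12 * n) \<le> ?q ^ Suc (k * m)" using q km by (intro power_decreasing) auto
    finally have upper: "norm (\<Phi> z) ^ 12 \<le> C ^ 12 * (?q * ?q ^ (k * m))" using C(1) by simp
    have "norm (H z) = norm (\<Phi> z) ^ 12 / norm ((eta z ^ 24) ^ (k * m))"
      by (simp add: H_def norm_divide norm_power)
    also have "\<dots> \<le> (C ^ 12 * (?q * ?q ^ (k * m))) / (inverse K ^ (24 * (k * m)) * ?q ^ (k * m))"
      using upper lower K(1) C(1) q by (intro frac_le) auto
    also have "\<dots> = C ^ 12 * K ^ (24 * (k * m)) * ?q"
      using q K(1) by (simp add: field_simps)
    finally show ?thesis .
  qed
  have "H w = 0" if w: "Im w > 0" for w
  proof (rule modular_function_eq_0[OF _ _ _ w])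
    show "H holomorphic_on ?U"
      unfolding H_def by (intro holomorphic_intros hol\<Phi> holomorphic_eta) auto
    show "H (act g z) = H z" if "g \<in> SL2" "Im z > 0" for g z
    proof -
      have "H (act g z) = (cocycle g z ^ (k * m)) ^ 12 * \<Phi> z ^ 12 / ((cocycle g z ^ 12) ^ (k * m) * (eta z ^ 24) ^ (k * m))"
        unfolding H_def eta_24_act[OF that] \<Phi>_act[OF that] by (simp only: power_mult_distrib)
      also have "(cocycle g z ^ 12) ^ (k * m) = (cocycle g z ^ (k * m)) ^ 12"
        by (simp only: power_mult[symmetric] mult.commute)
      finally show ?thesis
        using SL2_cocycle_nonzero[OF that] by (simp add: H_def)
    qed
    fix \<epsilon> :: real assume \<epsilon>: "\<epsilon> > 0"
    define M where "M = C ^ 12 * K ^ (24 * (k * m))"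
    have M: "M > 0" using C K by (simp add: M_def)
    define Y where "Y = max 1 (M / \<epsilon>)"
    have "norm (H z) < \<epsilon>" if "Im z \<ge> Y" for z
    proof -
      have y: "Im z \<ge> 1" "Im z \<ge> M / \<epsilon>" using that by (auto simp: Y_def)
      have "M / \<epsilon> < exp (M / \<epsilon>)" using exp_ge_add_one_self[of "M / \<epsilon>"] by linarith
      also have "\<dots> \<le> exp (2 * pi * Im z)"
        using y pi_ge_two M \<epsilon> mult_mono[of 1 "2 * pi" "M / \<epsilon>" "Im z"] by simp
      finally have "M * exp (- (2 * pi * Im z)) < \<epsilon>"
        using \<epsilon> by (simp add: exp_minus field_simps)
      then have "M * norm (nome z) < \<epsilon>" by (simp add: norm_nome)
      then show ?thesis using H_bound[OF y(1)] by (simp add: M_def)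
    qed
    then show "\<exists>Y>0. \<forall>z. Im z \<ge> Y \<longrightarrow> norm (H z) < \<epsilon>"
      by (intro exI[of _ Y]) (auto simp: Y_def)
  qed
  then have "\<Phi> w = 0" if "Im w > 0" for w
    using that by (auto simp: H_def)
  then have "\<exists>f\<in>R. \<forall>z\<in>?U. f z = 0"
    using holR unfolding \<Phi>_def
    by (intro holomorphic_prod_eq_0[OF finR])
       (auto simp: open_halfspace_Im_gt intro: convex_connected convex_halfspace_Im_gt exI[of _ \<i>])
  then show ?thesis using G0 unfolding R_def by blast
qed

section \<open>Behaviour at the cusps\<close>

text \<open>Writing \<open>N \<cdot> g\<close> as \<open>h\<close> times an upper triangular matrix reduces the behaviour of \<open>f (N z)\<close>
  at the cusp \<open>g \<infinity>\<close> to that of \<open>f\<close> at \<open>\<infinity>\<close>.\<close>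
lemma scaled_act:
  fixes a b c d :: int and N :: nat
  assumes det: "a * d - b * c = 1" and N: "N > 0"
  obtains a' b' c' d' B :: int and A D :: nat where
    "a' * d' - b' * c' = 1" "A > 0" "D > 0" "A * D = N" "int A = gcd c (int N)" "c' * int A = c"
    "\<And>z. of_nat N * moebius_act a b c d z = moebius_act a' b' c' d' ((of_nat A * z + of_int B) / of_nat D)"
    "\<And>z :: complex. of_int c' * ((of_nat A * z + of_int B) / of_nat D) + of_int d' = (of_int c * z + of_int d) / of_nat D"
proof -
  \<comment> \<open>The product of \<open>diag(N, 1)\<close> with the given matrix has first column
    \<open>(N a, c)\<close>, with gcd \<open>A\<close> since \<open>a\<close> and \<open>c\<close>
    are coprime. Dividing by \<open>A\<close> gives the primitive column \<open>(a', c')\<close>,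
    which Bezout completes to determinant \<open>1\<close>; \<open>B\<close> is the remaining entry
    of the triangular factor.\<close>
  define A where "A = nat (gcd c (int N))"
  define D where "D = N div A"
  have A: "int A = gcd c (int N)" "A > 0" using N by (auto simp: A_def)
  have "int A dvd int N" unfolding A by simp
  then have "A dvd N" by simp
  then have AD: "A * D = N" by (simp add: D_def)
  then have D: "D > 0" using N by (cases D) auto
  have AD': "int A * int D = int N" using AD by (metis of_nat_mult)
  define a' where "a' = int D * a"
  define c' where "c' = c div int A"
  have c': "c' * int A = c" unfolding c'_def A(1) by simp
  have "coprime (int D) c'"
  proof -
    have "coprime (c div gcd c (int N)) (int N div gcd c (int N))"
      using N by (intro div_gcd_coprime) auto
    moreover have "int N div gcd c (int N) = int D" unfolding A(1)[symmetric] D_def by (simp add: zdiv_int)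
    ultimately show ?thesis unfolding c'_def A(1) by (simp add: coprime_commute)
  qed
  moreover have "coprime a c'"
  proof -
    have "coprime a c" using det by (intro coprimeI) (metis dvd_diff dvd_mult dvd_mult2)
    then show ?thesis using c' by (metis coprime_mult_right_iff)
  qed
  ultimately have "coprime a' c'" by (simp add: a'_def)
  then obtain u v where uv: "u * a' + v * c' = 1" using bezout_int[of a' c'] by auto
  define d' where "d' = u"
  define b' where "b' = - v"
  have det': "a' * d' - b' * c' = 1" using uv by (simp add: d'_def b'_def algebra_simps)
  define B where "B = d' * (int N * b) - b' * d"
  have e1: "a' * int A = int N * a" by (simp add: a'_def AD'[symmetric])
  have e0: "c' * int N * b = int D * (b * c)"
    unfolding AD'[symmetric] using c' by (metis (no_types, opaque_lifting) mult.assoc mult.commute)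
  have e0': "c' * int N * b - a' * d = - int D"
  proof -
    have "c' * int N * b - a' * d = - int D * (a * d - b * c)"
      unfolding e0 a'_def by (simp add: algebra_simps)
    then show ?thesis using det by simp
  qed
  have e2: "a' * B + b' * int D = int N * b"
  proof -
    have "a' * B + b' * int D = (a' * d' - b' * c') * (int N * b) + b' * (c' * int N * b - a' * d + int D)"
      by (simp add: B_def algebra_simps)
    then show ?thesis using det' e0' by simp
  qed
  have e3: "c' * B + d' * int D = d"
  proof -
    have "c' * B + d' * int D = (a' * d' - b' * c') * d + d' * (c' * int N * b - a' * d + int D)"
      by (simp add: B_def algebra_simps)
    then show ?thesis using det' e0' by simp
  qed
  have D0: "of_nat D \<noteq> (0 :: complex)" using D by simp
  have c1: "(of_int a' :: complex) * of_nat A = of_nat N * of_int a"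
    "(of_int a' :: complex) * of_int B + of_int b' * of_nat D = of_nat N * of_int b"
    "(of_int c' :: complex) * of_nat A = of_int c"
    "(of_int c' :: complex) * of_int B + of_int d' * of_nat D = of_int d"
    using e1 e2 c' e3 by (metis of_int_mult of_int_add of_int_of_nat_eq)+
  have num: "of_int a' * ((of_nat A * z + of_int B) / of_nat D) + of_int b' =
      of_nat N * (of_int a * z + of_int b) / of_nat D"
    and den: "of_int c' * ((of_nat A * z + of_int B) / of_nat D) + of_int d' =
      (of_int c * z + of_int d) / of_nat D" for z :: complex
  proof -
    have "s * ((t * z + x) / y) + r = (s * t * z + (s * x + r * y)) / y" if "y \<noteq> 0" for s t x y r :: complex
      using that by (simp add: field_simps)
    note * = this[OF D0]
    show "of_int a' * ((of_nat A * z + of_int B) / of_nat D) + of_int b' =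
      of_nat N * (of_int a * z + of_int b) / of_nat D"
      "of_int c' * ((of_nat A * z + of_int B) / of_nat D) + of_int d' =
      (of_int c * z + of_int d) / of_nat D"
      unfolding * c1 by (simp_all add: algebra_simps)
  qed
  show ?thesis
  proof (rule that[OF det' A(2) D AD A(1) c' _ den])
    show "of_nat N * moebius_act a b c d z = moebius_act a' b' c' d' ((of_nat A * z + of_int B) / of_nat D)" for z
      unfolding moebius_act_def num den using D0 by simp
  qed
qed

text \<open>Since \<open>A D = N\<close> gives \<open>A / D \<ge> 1 / N\<close>, the points met at
  all cusps lie in one half plane on which the expansions are bounded.\<close>

lemma scaled_Im:
  assumes "A > 0" "D > 0" "A * D = N" "Im z \<ge> 1"
  shows "Im ((of_nat A * z + of_int B) / of_nat D) = real A / real D * Im z"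
    "real A / real D * Im z \<ge> 1 / real N"
proof -
  show "Im ((of_nat A * z + of_int B) / of_nat D) = real A / real D * Im z"
    by (simp add: Im_divide_of_nat)
  have "1 / real N \<le> real A / real D" 
    using assms(1,2) unfolding assms(3)[symmetric]
    by (simp add: divide_simps) (metis One_nat_def Suc_leI mult_le_mono nat_mult_1 of_nat_1 of_nat_le_iff of_nat_mult)
  also have "\<dots> \<le> real A / real D * Im z"
    using assms mult_left_mono[of 1 "Im z" "real A / real D"] by simp
  finally show "real A / real D * Im z \<ge> 1 / real N" .
qed

text \<open>The extra term carries the factor \<open>N c' / D = A c' = c\<close>, which no longer
  depends on \<open>N\<close>. This uniformity lets it cancel between \<open>2 P(2z)\<close> and
  \<open>13 P(13z)\<close>.\<close>

lemma P_growth: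
  fixes N :: nat
  assumes g: "(a, b, c, d) \<in> SL2" and N: "N > 0"
  shows "\<exists>K. \<forall>z. Im z \<ge> 1 \<longrightarrow>
    norm (of_nat N * qexp P_fps (of_nat N * act (a, b, c, d) z)
       - 6 / (pi * \<i>) * of_int c * cocycle (a, b, c, d) z) \<le> K * norm (cocycle (a, b, c, d) z) ^ 2"
proof -
  from g have det: "a * d - b * c = 1" by (simp add: SL2_def)
  obtain a' b' c' d' B :: int and A D :: nat where h:
    "a' * d' - b' * c' = 1" "A > 0" "D > 0" "A * D = N" "int A = gcd c (int N)" "c' * int A = c"
    "\<And>z. of_nat N * moebius_act a b c d z = moebius_act a' b' c' d' ((of_nat A * z + of_int B) / of_nat D)"
    "\<And>z :: complex. of_int c' * ((of_nat A * z + of_int B) / of_nat D) + of_int d' = (of_int c * z + of_int d) / of_nat D"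
    by (rule scaled_act[OF det N], rule that)
  have "1 / real N > 0" using N by simp
  from qexp_bounded[OF unit_radius_P_fps this] obtain K where
    K: "\<And>z. Im z \<ge> 1 / real N \<Longrightarrow> norm (qexp P_fps z) \<le> K" by metis
  have cA: "of_int c = of_int c' * (of_nat A :: complex)" using h(6) by (metis of_int_mult of_int_of_nat_eq)
  have "norm (of_nat N * qexp P_fps (of_nat N * act (a, b, c, d) z)
       - 6 / (pi * \<i>) * of_int c * cocycle (a, b, c, d) z) \<le> (real A / real D * K) * norm (cocycle (a, b, c, d) z) ^ 2"
    if z: "Im z \<ge> 1" for z
  proof -
    define w where "w = (of_nat A * z + of_int B) / of_nat D"
    define J where "J = of_int c * z + of_int d"
    have w: "Im w \<ge> 1 / real N" using scaled_Im[OF h(2,3,4) z] by (simp add: w_def)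
    have w0: "Im w > 0" using w N by (smt (verit) divide_pos_pos of_nat_0_less_iff)
    have hw: "of_int c' * w + of_int d' = J / of_nat D" unfolding w_def J_def by (rule h(8))
    have aw: "of_nat N * act (a, b, c, d) z = moebius_act a' b' c' d' w"
      unfolding act.simps w_def by (rule h(7))
    have D0: "of_nat D \<noteq> (0 :: complex)" using h by simp
    have P: "qexp P_fps (of_nat N * act (a, b, c, d) z) = (J / of_nat D) ^ 2 * qexp P_fps w + 6 / (pi * \<i>) * of_int c' * (J / of_nat D)"
      unfolding aw qexp_P_moebius_act[OF h(1) w0] hw ..
    have "of_nat N * qexp P_fps (of_nat N * act (a, b, c, d) z) - 6 / (pi * \<i>) * of_int c * J =
       of_nat A / of_nat D * J ^ 2 * qexp P_fps w"
    proof -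
      have "(s * t) * x - k * (u * s) * y = s / t * y ^ 2 * p"
        if "t \<noteq> 0" "x = (y / t) ^ 2 * p + k * u * (y / t)" for s t x k u y p :: complex
        using that by (simp add: field_simps power2_eq_square)
      then show ?thesis
        using D0 P unfolding h(4)[symmetric] cA of_nat_mult by blast
    qed
    then have "norm (of_nat N * qexp P_fps (of_nat N * act (a, b, c, d) z) - 6 / (pi * \<i>) * of_int c * J) =
       real A / real D * norm J ^ 2 * norm (qexp P_fps w)"
      by (simp add: norm_mult norm_divide norm_power)
    also have "\<dots> \<le> real A / real D * norm J ^ 2 * K"
      using K[OF w] by (intro mult_left_mono) auto
    finally show ?thesis by (simp add: J_def mult_ac)
  qed
  then show ?thesis by blast
qed

lemma Q_growth:
  fixes N :: nat
  assumes g: "(a, b, c, d) \<in> SL2" and N: "N > 0"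
  shows "\<exists>K. \<forall>z. Im z \<ge> 1 \<longrightarrow>
    norm (qexp Q_fps (of_nat N * act (a, b, c, d) z)) \<le> K * norm (cocycle (a, b, c, d) z) ^ 4"
proof -
  from g have det: "a * d - b * c = 1" by (simp add: SL2_def)
  obtain a' b' c' d' B :: int and A D :: nat where h:
    "a' * d' - b' * c' = 1" "A > 0" "D > 0" "A * D = N" "int A = gcd c (int N)" "c' * int A = c"
    "\<And>z. of_nat N * moebius_act a b c d z = moebius_act a' b' c' d' ((of_nat A * z + of_int B) / of_nat D)"
    "\<And>z :: complex. of_int c' * ((of_nat A * z + of_int B) / of_nat D) + of_int d' = (of_int c * z + of_int d) / of_nat D"
    by (rule scaled_act[OF det N], rule that)
  have "1 / real N > 0" using N by simp
  from qexp_bounded[OF unit_radius_Q_fps this] obtain K where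
    K: "\<And>z. Im z \<ge> 1 / real N \<Longrightarrow> norm (qexp Q_fps z) \<le> K" by metis
  have "norm (qexp Q_fps (of_nat N * act (a, b, c, d) z)) \<le> (K / real D ^ 4) * norm (cocycle (a, b, c, d) z) ^ 4"
    if z: "Im z \<ge> 1" for z
  proof -
    define w where "w = (of_nat A * z + of_int B) / of_nat D"
    define J where "J = of_int c * z + of_int d"
    have w: "Im w \<ge> 1 / real N" using scaled_Im[OF h(2,3,4) z] by (simp add: w_def)
    have w0: "Im w > 0" using w N by (smt (verit) divide_pos_pos of_nat_0_less_iff)
    have hw: "of_int c' * w + of_int d' = J / of_nat D" unfolding w_def J_def by (rule h(8))
    have aw: "of_nat N * act (a, b, c, d) z = moebius_act a' b' c' d' w"
      unfolding act.simps w_def by (rule h(7))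
    have "qexp Q_fps (of_nat N * act (a, b, c, d) z) = (J / of_nat D) ^ 4 * qexp Q_fps w"
      unfolding aw qexp_Q_moebius_act[OF h(1) w0] hw ..
    then have "norm (qexp Q_fps (of_nat N * act (a, b, c, d) z)) = (norm J / real D) ^ 4 * norm (qexp Q_fps w)"
      by (simp add: norm_mult norm_divide norm_power)
    also have "\<dots> \<le> (norm J / real D) ^ 4 * K"
      using K[OF w] by (intro mult_left_mono) auto
    finally show ?thesis by (simp add: J_def mult_ac power_divide)
  qed
  then show ?thesis by blast
qed

text \<open>This is \<open>A / D\<close> in the notation of \<open>scaled_act\<close>:
  \<open>24\<close> times the order, measured in the nome, of \<open>\<eta>(N z)\<close> at the
  image of infinity under a matrix with lower left entry \<open>c\<close>.\<close>

definition cusp_order :: "int \<Rightarrow> nat \<Rightarrow> real" where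
  "cusp_order c N = of_int (gcd c (int N)) ^ 2 / real N"

text \<open>Squares, because the multiplier law is that of \<open>\<eta>^2\<close>; two-sided,
  because exponents in an eta quotient may be negative.\<close>

lemma eta_scaled_growth:
  fixes N :: nat
  assumes g: "(a, b, c, d) \<in> SL2" and N: "N > 0"
  shows "\<exists>K>0. \<forall>z. Im z \<ge> 1 \<longrightarrow>
    (let E = norm (cocycle (a, b, c, d) z) * exp (- pi / 6 * cusp_order c N * Im z);
         X = norm (eta (of_nat N * act (a, b, c, d) z)) ^ 2
     in X \<le> K * E \<and> inverse K * E \<le> X)"
proof -
  from g have det: "a * d - b * c = 1" by (simp add: SL2_def)
  obtain a' b' c' d' B :: int and A D :: nat where h:
    "a' * d' - b' * c' = 1" "A > 0" "D > 0" "A * D = N" "int A = gcd c (int N)" "c' * int A = c"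
    "\<And>z. of_nat N * moebius_act a b c d z = moebius_act a' b' c' d' ((of_nat A * z + of_int B) / of_nat D)"
    "\<And>z :: complex. of_int c' * ((of_nat A * z + of_int B) / of_nat D) + of_int d' = (of_int c * z + of_int d) / of_nat D"
    by (rule scaled_act[OF det N], rule that)
  have D0: "real D > 0" "real A > 0" using h by simp_all
  have ord: "cusp_order c N = real A / real D"
  proof -
    have "cusp_order c N = real A ^ 2 / real (A * D)"
      unfolding cusp_order_def h(5)[symmetric] h(4) by simp
    then show ?thesis using D0 by (simp add: field_simps power2_eq_square)
  qed
  have "1 / real N > 0" using N by simp
  then obtain K where K: "K > 0" "\<And>z. Im z \<ge> 1 / real N \<Longrightarrow> norm (eta z) \<le> K * exp (- pi * Im z / 12)"
    "\<And>z. Im z \<ge> 1 / real N \<Longrightarrow> norm (eta z) \<ge> inverse K * exp (- pi * Im z / 12)"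
    by (rule eta_growth) blast
  define M where "M = K ^ 2 * real D"
  have M: "M > 0" using K h by (simp add: M_def)
  have "let E = norm (cocycle (a, b, c, d) z) * exp (- pi / 6 * cusp_order c N * Im z);
         X = norm (eta (of_nat N * act (a, b, c, d) z)) ^ 2
     in X \<le> M * E \<and> inverse M * E \<le> X" if z: "Im z \<ge> 1" for z
  proof -
    define w where "w = (of_nat A * z + of_int B) / of_nat D"
    define J where "J = of_int c * z + of_int d"
    have w: "Im w \<ge> 1 / real N" "Im w = real A / real D * Im z"
      using scaled_Im[OF h(2,3,4) z] by (simp_all add: w_def)
    have w0: "Im w > 0" using w N by (smt (verit) divide_pos_pos of_nat_0_less_iff)
    have hw: "of_int c' * w + of_int d' = J / of_nat D" unfolding w_def J_def by (rule h(8))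
    have aw: "of_nat N * act (a, b, c, d) z = moebius_act a' b' c' d' w"
      unfolding act.simps w_def by (rule h(7))
    have "eta (of_nat N * act (a, b, c, d) z) ^ 2 = eta_mult (eta_exponent a' b' c' d') * (J / of_nat D) * eta w ^ 2"
      unfolding aw eta_squared_moebius_act[OF h(1) w0] hw ..
    then have X: "norm (eta (of_nat N * act (a, b, c, d) z)) ^ 2 = norm J / real D * norm (eta w) ^ 2"
      by (metis (no_types, lifting) mult_1 norm_divide norm_eta_mult norm_mult norm_of_nat norm_power)
    define e where "e = exp (- pi * Im w / 12)"
    have e2: "e ^ 2 = exp (- pi / 6 * cusp_order c N * Im z)"
      unfolding e_def ord w(2) by (simp flip: exp_of_nat_mult)
    have e0: "e > 0" by (simp add: e_def)
    have up: "norm (eta w) ^ 2 \<le> (K * e) ^ 2" using K(2)[OF w(1)] by (intro power_mono) (auto simp: e_def)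
    have lo: "(inverse K * e) ^ 2 \<le> norm (eta w) ^ 2" using K(3)[OF w(1)] K(1) by (intro power_mono) (auto simp: e_def)
    have "norm J / real D * norm (eta w) ^ 2 \<le> norm J / 1 * (K * e) ^ 2"
      using up h(3) by (intro mult_mono divide_left_mono) auto
    also have "\<dots> \<le> M * (norm J * e ^ 2)"
    proof -
      have "K ^ 2 * 1 \<le> M" unfolding M_def using h(3) by (intro mult_left_mono) auto
      from mult_right_mono[OF this, of "norm J * e ^ 2"] show ?thesis
        by (simp add: power_mult_distrib mult_ac)
    qed
    finally have 1: "norm J / real D * norm (eta w) ^ 2 \<le> M * (norm J * e ^ 2)" .
    have "inverse M * (norm J * e ^ 2) = norm J / real D * (inverse K * e) ^ 2"
      by (simp add: M_def power_mult_distrib field_simps)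
    also have "\<dots> \<le> norm J / real D * norm (eta w) ^ 2"
      using lo by (intro mult_left_mono) auto
    finally have 2: "inverse M * (norm J * e ^ 2) \<le> norm J / real D * norm (eta w) ^ 2" .
    show ?thesis unfolding Let_def X using 1 2 by (simp add: J_def e2)
  qed
  with M show ?thesis by blast
qed

definition eta_quotient :: "(nat \<times> int) list \<Rightarrow> complex \<Rightarrow> complex" where
  "eta_quotient l z = prod_list (map (\<lambda>(N, r). eta (of_nat N * z) powi r) l)"

lemma powi_two_sided_bound:
  fixes X E K :: real
  assumes "X \<le> K * E" "inverse K * E \<le> X" "E > 0" "K > 0"
  shows "X powi r \<le> K powi \<bar>r\<bar> * E powi r"
proof (cases "r \<ge> 0")
  case True
  have "0 \<le> X" using assms by (smt (verit) mult_pos_pos positive_imp_inverse_positive)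
  then have "X ^ nat r \<le> (K * E) ^ nat r" using assms by (intro power_mono)
  then show ?thesis using True by (simp add: power_int_def power_mult_distrib)
next
  case False
  have "0 < inverse K * E" using assms by simp
  then have "inverse (X ^ nat (- r)) \<le> inverse ((inverse K * E) ^ nat (- r))"
    using assms by (intro le_imp_inverse_le power_mono zero_less_power) auto
  then show ?thesis using False assms
    by (simp add: power_int_def power_mult_distrib power_inverse field_simps)
qed

lemma eta_quotient_growth:
  assumes g: "(a, b, c, d) \<in> SL2" and l: "\<forall>(N, r)\<in>set l. N > 0"
  shows "\<exists>K>0. \<forall>z. Im z \<ge> 1 \<longrightarrow> norm (eta_quotient l (act (a, b, c, d) z)) ^ 2 \<le>
     K * norm (cocycle (a, b, c, d) z) powi (\<Sum>(N, r)\<leftarrow>l. r) *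
     exp (- pi / 6 * (\<Sum>(N, r)\<leftarrow>l. of_int r * cusp_order c N) * Im z)"
  using l
proof (induction l)
  case Nil
  show ?case by (intro exI[of _ 1]) (auto simp: eta_quotient_def)
next
  case (Cons x l)
  obtain N r where x: "x = (N, r)" by (cases x)
  from Cons x have N: "N > 0" by auto
  from Cons obtain K where K: "K > 0" "\<And>z. Im z \<ge> 1 \<Longrightarrow> norm (eta_quotient l (act (a, b, c, d) z)) ^ 2 \<le>
     K * norm (cocycle (a, b, c, d) z) powi (\<Sum>(N, r)\<leftarrow>l. r) *
     exp (- pi / 6 * (\<Sum>(N, r)\<leftarrow>l. of_int r * cusp_order c N) * Im z)" by auto
  from eta_scaled_growth[OF g N] obtain M where M: "M > 0" "\<And>z. Im z \<ge> 1 \<Longrightarrow>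
    (let E = norm (cocycle (a, b, c, d) z) * exp (- pi / 6 * cusp_order c N * Im z);
         X = norm (eta (of_nat N * act (a, b, c, d) z)) ^ 2
     in X \<le> M * E \<and> inverse M * E \<le> X)" by auto
  have "norm (eta_quotient (x # l) (act (a, b, c, d) z)) ^ 2 \<le>
     (M powi \<bar>r\<bar> * K) * norm (cocycle (a, b, c, d) z) powi (\<Sum>(N, r)\<leftarrow>x # l. r) *
     exp (- pi / 6 * (\<Sum>(N, r)\<leftarrow>x # l. of_int r * cusp_order c N) * Im z)" if z: "Im z \<ge> 1" for z
  proof -
    define J where "J = norm (cocycle (a, b, c, d) z)"
    have J: "J > 0" using SL2_cocycle_nonzero[OF g] z by (simp add: J_def del: cocycle.simps)
    define e where "e = exp (- pi / 6 * cusp_order c N * Im z)"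
    define S where "S = (\<Sum>(N, r)\<leftarrow>l. r)"
    define T where "T = (\<Sum>(N, r)\<leftarrow>l. of_int r * cusp_order c N)"
    have 1: "(norm (eta (of_nat N * act (a, b, c, d) z)) ^ 2) powi r \<le> M powi \<bar>r\<bar> * (J * e) powi r"
      using M(2)[OF z] M(1) J unfolding Let_def J_def[symmetric] e_def[symmetric]
      by (intro powi_two_sided_bound) (auto simp: e_def)
    have er: "e powi r = exp (- pi / 6 * (of_int r * cusp_order c N) * Im z)"
      unfolding e_def exp_power_int by (simp add: mult_ac)
    have "norm (eta_quotient (x # l) (act (a, b, c, d) z)) ^ 2 =
      (norm (eta (of_nat N * act (a, b, c, d) z)) ^ 2) powi r * norm (eta_quotient l (act (a, b, c, d) z)) ^ 2"
      by (simp add: eta_quotient_def x norm_mult power_mult_distrib norm_power_int power2_eq_square power_int_mult_distrib)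
    also have "\<dots> \<le> (M powi \<bar>r\<bar> * (J * e) powi r) * (K * J powi S * exp (- pi / 6 * T * Im z))"
      using K(2)[OF z] M(1) J by (intro mult_mono 1) (auto simp: J_def S_def T_def e_def)
    also have "\<dots> = (M powi \<bar>r\<bar> * K) * (J powi r * J powi S) * (e powi r * exp (- pi / 6 * T * Im z))"
      by (simp add: power_int_mult_distrib)
    also have "J powi r * J powi S = J powi (r + S)"
      using J by (simp add: power_int_add)
    also have "e powi r * exp (- pi / 6 * T * Im z) = exp (- pi / 6 * (of_int r * cusp_order c N + T) * Im z)"
      unfolding er exp_add[symmetric] by (simp add: algebra_simps)
    finally show ?thesis by (simp add: x J_def S_def T_def)
  qed
  moreover have "M powi \<bar>r\<bar> * K > 0" using M(1) K(1) by simp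
  ultimately show ?case by blast
qed

text \<open>Ligozat's criterion: exponents with sum \<open>8\<close> give weight \<open>4\<close>,
  and a nonnegative total order excludes a pole at the cusp.\<close>

lemma eta_quotient_growth_weight4:
  assumes g: "(a, b, c, d) \<in> SL2" and l: "\<forall>(N, r)\<in>set l. N > 0"
    and weight: "(\<Sum>(N, r)\<leftarrow>l. r) = 8" and ord: "(\<Sum>(N, r)\<leftarrow>l. of_int r * cusp_order c N) \<ge> 0"
  shows "\<exists>K. \<forall>z. Im z \<ge> 1 \<longrightarrow> norm (eta_quotient l (act (a, b, c, d) z)) \<le> K * norm (cocycle (a, b, c, d) z) ^ 4"
proof -
  let ?T = "\<Sum>(N, r)\<leftarrow>l. of_int r * cusp_order c N"
  obtain K where K: "K > 0" "\<And>z. Im z \<ge> 1 \<Longrightarrow> norm (eta_quotient l (act (a, b, c, d) z)) ^ 2 \<le>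
     K * norm (cocycle (a, b, c, d) z) powi 8 * exp (- pi / 6 * ?T * Im z)"
    using eta_quotient_growth[OF g l] unfolding weight by blast
  have "norm (eta_quotient l (act (a, b, c, d) z)) \<le> sqrt K * norm (cocycle (a, b, c, d) z) ^ 4" if z: "Im z \<ge> 1" for z
  proof -
    define J where "J = norm (cocycle (a, b, c, d) z)"
    have "exp (- pi / 6 * ?T * Im z) \<le> 1" using ord z by simp
    then have "K * J powi 8 * exp (- pi / 6 * ?T * Im z) \<le> K * J powi 8 * 1"
      using K(1) by (intro mult_left_mono) (auto simp: J_def)
    with K(2)[OF z] have "norm (eta_quotient l (act (a, b, c, d) z)) ^ 2 \<le> K * J ^ 8"
      by (simp add: J_def)
    also have "\<dots> = (sqrt K * J ^ 4) ^ 2" using K(1) by (simp add: power_mult_distrib flip: power_mult)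
    finally show ?thesis
      unfolding J_def by (rule power2_le_imp_le) (use K(1) in auto)
  qed
  then show ?thesis by blast
qed

text \<open>When \<open>N\<close> divides \<open>c\<close>, conjugation by \<open>diag(N, 1)\<close>
  stays integral and preserves the cocycle, so the laws for the full modular group apply at
  \<open>N z\<close>.\<close>

lemma scaled_Gamma0:
  fixes N :: nat and c' :: int
  assumes det: "a * d - b * c = 1" and N: "N > 0" "c = c' * int N"
  shows "a * d - (int N * b) * c' = 1"
    "of_nat N * moebius_act a b c d z = moebius_act a (int N * b) c' d (of_nat N * z)"
    "of_int c' * (of_nat N * z) + of_int d = of_int c * z + of_int d"
proof -
  show "a * d - (int N * b) * c' = 1" using det N(2) by (simp add: algebra_simps)
  have c: "(of_int c :: complex) = of_int c' * of_nat N" unfolding N(2) by simp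
  show den: "of_int c' * (of_nat N * z) + of_int d = of_int c * z + of_int d" by (simp add: c)
  show "of_nat N * moebius_act a b c d z = moebius_act a (int N * b) c' d (of_nat N * z)"
    unfolding moebius_act_def den by (simp add: algebra_simps)
qed

lemma P_Gamma0:
  fixes N :: nat
  assumes det: "a * d - b * c = 1" and N: "N > 0" "int N dvd c" and z: "Im z > 0"
  shows "of_nat N * qexp P_fps (of_nat N * moebius_act a b c d z) =
     (of_int c * z + of_int d) ^ 2 * (of_nat N * qexp P_fps (of_nat N * z)) + 6 / (pi * \<i>) * of_int c * (of_int c * z + of_int d)"
proof -
  obtain c' where c': "c = c' * int N" using N(2) by (metis dvdE mult.commute)
  note s = scaled_Gamma0[OF det N(1) c']
  have Nz: "Im (of_nat N * z) > 0" using N z by simp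
  have "(of_int c :: complex) = of_nat N * of_int c'" unfolding c' by simp
  then show ?thesis
    unfolding s(2) qexp_P_moebius_act[OF s(1) Nz] s(3) by (simp add: algebra_simps)
qed

lemma Q_Gamma0:
  fixes N :: nat
  assumes det: "a * d - b * c = 1" and N: "N > 0" "int N dvd c" and z: "Im z > 0"
  shows "qexp Q_fps (of_nat N * moebius_act a b c d z) = (of_int c * z + of_int d) ^ 4 * qexp Q_fps (of_nat N * z)"
proof -
  obtain c' where c': "c = c' * int N" using N(2) by (metis dvdE mult.commute)
  note s = scaled_Gamma0[OF det N(1) c']
  have Nz: "Im (of_nat N * z) > 0" using N z by simp
  show ?thesis unfolding s(2) qexp_Q_moebius_act[OF s(1) Nz] s(3) ..
qed

lemma eta_Gamma0:
  fixes N :: nat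
  assumes det: "a * d - b * c = 1" and N: "N > 0" "c = c' * int N" and z: "Im z > 0"
  shows "eta (of_nat N * moebius_act a b c d z) ^ 2 =
     eta_mult (eta_exponent a (int N * b) c' d) * (of_int c * z + of_int d) * eta (of_nat N * z) ^ 2"
proof -
  note s = scaled_Gamma0[OF det N]
  have Nz: "Im (of_nat N * z) > 0" using N z by simp
  show ?thesis unfolding s(2) eta_squared_moebius_act[OF s(1) Nz] s(3) ..
qed

text \<open>With \<open>c = 26 k\<close>, this gives \<open>\<eta>^2(z)\<close> and
  \<open>\<eta>^2(13z)\<close> the same multiplier on \<open>\<Gamma>_0(26)\<close>; the next
  congruence does so for \<open>2z\<close> and \<open>26z\<close>.\<close>

lemma eta_exponent_13_1:
  fixes a b d k :: int
  assumes det: "a * d - 26 * b * k = 1"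
  shows "12 dvd eta_exponent a (13 * b) (2 * k) d - eta_exponent a b (26 * k) d"
proof -
  let ?f = "\<lambda>a b k d. eta_exponent a (13 * b) (2 * k) d - eta_exponent a b (26 * k) d"
  let ?g = "\<lambda>a b k d :: int. a * d - 26 * b * k - 1"
  have cong: "[?f a b k d = ?f (a mod m) (b mod m) (k mod m) (d mod m)] (mod m)"
    "[?g a b k d = ?g (a mod m) (b mod m) (k mod m) (d mod m)] (mod m)" for a b k d m
    unfolding eta_exponent_def by (intro poly_cong_intros)+
  have "?g a b k d = 0" using det by simp
  have "?f a b k d mod 3 = 0"
    by (rule residues_exhaust[where f = ?f and g = ?g, OF cong _ _ \<open>?g a b k d = 0\<close>]) (code_simp, simp)
  moreover have "?f a b k d mod 4 = 0"
    by (rule residues_exhaust[where f = ?f and g = ?g, OF cong _ _ \<open>?g a b k d = 0\<close>]) (code_simp, simp)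
  ultimately show ?thesis unfolding dvd_12_iff by blast
qed


lemma eta_exponent_26_2:
  fixes a b d k :: int
  assumes det: "a * d - 26 * b * k = 1"
  shows "12 dvd eta_exponent a (26 * b) k d - eta_exponent a (2 * b) (13 * k) d"
proof -
  let ?f = "\<lambda>a b k d. eta_exponent a (26 * b) k d - eta_exponent a (2 * b) (13 * k) d"
  let ?g = "\<lambda>a b k d :: int. a * d - 26 * b * k - 1"
  have cong: "[?f a b k d = ?f (a mod m) (b mod m) (k mod m) (d mod m)] (mod m)"
    "[?g a b k d = ?g (a mod m) (b mod m) (k mod m) (d mod m)] (mod m)" for a b k d m
    unfolding eta_exponent_def by (intro poly_cong_intros)+
  have "?g a b k d = 0" using det by simp
  have "?f a b k d mod 3 = 0"
    by (rule residues_exhaust[where f = ?f and g = ?g, OF cong _ _ \<open>?g a b k d = 0\<close>]) (code_simp, simp)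
  moreover have "?f a b k d mod 4 = 0"
    by (rule residues_exhaust[where f = ?f and g = ?g, OF cong _ _ \<open>?g a b k d = 0\<close>]) (code_simp, simp)
  ultimately show ?thesis unfolding dvd_12_iff by blast
qed


text \<open>The weights \<open>3, 3, 1, 1\<close> are the exponents of \<open>C_2\<close>: its
  square, a product of these powers of \<open>\<eta>^2\<close>, has trivial character.\<close>

lemma eta_exponent_base:
  fixes a b d k :: int
  assumes det: "a * d - 26 * b * k = 1"
  shows "12 dvd 3 * eta_exponent a b (26 * k) d + 3 * eta_exponent a (2 * b) (13 * k) d + eta_exponent a (13 * b) (2 * k) d + eta_exponent a (26 * b) k d"
proof -
  let ?f = "\<lambda>a b k d. 3 * eta_exponent a b (26 * k) d + 3 * eta_exponent a (2 * b) (13 * k) d + eta_exponent a (13 * b) (2 * k) d + eta_exponent a (26 * b) k d"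
  let ?g = "\<lambda>a b k d :: int. a * d - 26 * b * k - 1"
  have cong: "[?f a b k d = ?f (a mod m) (b mod m) (k mod m) (d mod m)] (mod m)"
    "[?g a b k d = ?g (a mod m) (b mod m) (k mod m) (d mod m)] (mod m)" for a b k d m
    unfolding eta_exponent_def by (intro poly_cong_intros)+
  have "?g a b k d = 0" using det by simp
  have "?f a b k d mod 3 = 0"
    by (rule residues_exhaust[where f = ?f and g = ?g, OF cong _ _ \<open>?g a b k d = 0\<close>]) (code_simp, simp)
  moreover have "?f a b k d mod 4 = 0"
    by (rule residues_exhaust[where f = ?f and g = ?g, OF cong _ _ \<open>?g a b k d = 0\<close>]) (code_simp, simp)
  ultimately show ?thesis unfolding dvd_12_iff by blast
qed

section \<open>Level 26\<close>

definition P_at :: "nat \<Rightarrow> complex \<Rightarrow> complex" where "P_at N z = qexp P_fps (of_nat N * z)"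

definition Q_at :: "nat \<Rightarrow> complex \<Rightarrow> complex" where "Q_at N z = qexp Q_fps (of_nat N * z)"

text \<open>The generating function of \<open>W\<^bsub>(2,13)\<^esub>\<close> minus the divisor sums on the right hand side; the
  derivatives of the Eisenstein series \<open>P\<close> have been eliminated by Ramanujan's identity.\<close>
definition eisenstein_part :: "complex \<Rightarrow> complex" where
  "eisenstein_part z = - 1 / 29952 * (2 * P_at 2 z - 13 * P_at 13 z) ^ 2 + Q_at 2 z / 7488 + 13 * Q_at 13 z / 2304
     - Q_at 1 z / 489600 - Q_at 2 z / 122400 - 169 * Q_at 13 z / 489600 - 169 * Q_at 26 z / 122400"

definition cusp_part :: "complex \<Rightarrow> complex" where
  "cusp_part z = - 1 / 2040 * eta_quotient [(1, 1), (2, 5), (13, 3), (26, -1)] z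
     - 127 / 5304 * eta_quotient [(1, 3), (2, 3), (13, 1), (26, 1)] z
     - 181 / 1768 * eta_quotient [(1, 1), (2, 3), (13, 3), (26, 1)] z
     - 947 / 13260 * eta_quotient [(1, 3), (2, 1), (13, 1), (26, 3)] z
     - 127 / 408 * eta_quotient [(1, 1), (2, 1), (13, 3), (26, 3)] z
     - 13 / 2040 * eta_quotient [(1, -1), (2, 3), (13, 5), (26, 1)] z
     + 46 / 3315 * eta_quotient [(1, -1), (2, 5), (13, 5), (26, -1)] z
     + 863 / 26520 * eta_quotient [(1, 7), (2, -3), (13, -3), (26, 7)] z"

lemma eisenstein_part_Gamma0:
  assumes g: "g \<in> Gamma0 26" and z: "Im z > 0"
  shows "eisenstein_part (act g z) = cocycle g z ^ 4 * eisenstein_part z"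
proof -
  obtain a b c d where g_eq: "g = (a, b, c, d)" by (metis prod_cases4)
  from g have det: "a * d - b * c = 1" and c: "26 dvd c" by (auto simp: g_eq Gamma0_def)
  have dv: "int 1 dvd c" "int 2 dvd c" "int 13 dvd c" "int 26 dvd c" using c by auto
  define J where "J = of_int c * z + of_int d"
  define e where "e = 6 / (pi * \<i>) * of_int c * J"
  have P: "of_nat N * P_at N (moebius_act a b c d z) = J ^ 2 * (of_nat N * P_at N z) + e"
    if "N > 0" "int N dvd c" for N
    unfolding P_at_def J_def e_def by (rule P_Gamma0[OF det that z])
  have Q: "Q_at N (moebius_act a b c d z) = J ^ 4 * Q_at N z" if "N > 0" "int N dvd c" for N
    unfolding Q_at_def J_def by (rule Q_Gamma0[OF det that z])
  \<comment> \<open>The extra term \<open>e\<close> is the same for \<open>N = 2\<close> and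
    \<open>N = 13\<close> and drops out of the difference.\<close>
  have "2 * P_at 2 (moebius_act a b c d z) - 13 * P_at 13 (moebius_act a b c d z) =
      J ^ 2 * (2 * P_at 2 z - 13 * P_at 13 z)"
    using P[of 2] P[of 13] dv by (simp add: algebra_simps)
  then have "(2 * P_at 2 (moebius_act a b c d z) - 13 * P_at 13 (moebius_act a b c d z)) ^ 2 =
      J ^ 4 * (2 * P_at 2 z - 13 * P_at 13 z) ^ 2"
    by (simp add: power_mult_distrib flip: power_mult)
  then show ?thesis
    unfolding eisenstein_part_def g_eq act.simps cocycle.simps
    using Q[of 1] Q[of 2] Q[of 13] Q[of 26] dv unfolding J_def[symmetric]
    by (simp add: algebra_simps)
qed

lemma eisenstein_part_growth:
  assumes g: "g \<in> SL2"
  shows "\<exists>K. \<forall>z. Im z \<ge> 1 \<longrightarrow> norm (eisenstein_part (act g z)) \<le> K * norm (cocycle g z) ^ 4"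
proof -
  obtain a b c d where g_eq: "g = (a, b, c, d)" by (metis prod_cases4)
  have g': "(a, b, c, d) \<in> SL2" using g by (simp add: g_eq)
  define e where "e = (\<lambda>z. 6 / (pi * \<i>) * of_int c * cocycle g z)"
  obtain K2 where K2: "\<And>z. Im z \<ge> 1 \<Longrightarrow> norm (2 * P_at 2 (act g z) - e z) \<le> K2 * norm (cocycle g z) ^ 2"
    using P_growth[OF g', of 2] unfolding P_at_def e_def g_eq by auto
  obtain K13 where K13: "\<And>z. Im z \<ge> 1 \<Longrightarrow> norm (13 * P_at 13 (act g z) - e z) \<le> K13 * norm (cocycle g z) ^ 2"
    using P_growth[OF g', of 13] unfolding P_at_def e_def g_eq by auto
  have "\<forall>N. \<exists>L. N > 0 \<longrightarrow> (\<forall>z. Im z \<ge> 1 \<longrightarrow> norm (Q_at N (act g z)) \<le> L * norm (cocycle g z) ^ 4)"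
    using Q_growth[OF g'] unfolding Q_at_def g_eq by blast
  then obtain L where L: "\<And>N z. N > 0 \<Longrightarrow> Im z \<ge> 1 \<Longrightarrow> norm (Q_at N (act g z)) \<le> L N * norm (cocycle g z) ^ 4"
    by metis
  have "norm (eisenstein_part (act g z)) \<le>
     ((K2 + K13) ^ 2 / 29952 + L 2 / 7488 + 13 * L 13 / 2304 + L 1 / 489600 + L 2 / 122400
       + 169 * L 13 / 489600 + 169 * L 26 / 122400) * norm (cocycle g z) ^ 4" if z: "Im z \<ge> 1" for z
  proof -
    define J where "J = norm (cocycle g z)"
    define p where "p = 2 * P_at 2 (act g z) - 13 * P_at 13 (act g z)"
    have "p = (2 * P_at 2 (act g z) - e z) - (13 * P_at 13 (act g z) - e z)" by (simp add: p_def)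
    then have "norm p \<le> norm (2 * P_at 2 (act g z) - e z) + norm (13 * P_at 13 (act g z) - e z)"
      by (metis norm_triangle_ineq4)
    also have "\<dots> \<le> (K2 + K13) * J ^ 2" using K2[OF z] K13[OF z] by (simp add: J_def algebra_simps)
    finally have "norm p ^ 2 \<le> ((K2 + K13) * J ^ 2) ^ 2" by (intro power_mono) auto
    then have p: "norm (- 1 / 29952 * p ^ 2) \<le> (K2 + K13) ^ 2 * J ^ 4 / 29952"
      by (simp add: norm_mult norm_power power_mult_distrib flip: power_mult)
    define q where "q = (\<lambda>N. Q_at N (act g z))"
    have Q: "norm (q N) \<le> L N * J ^ 4" if "N > 0" for N
      using L[OF that z] by (simp add: q_def J_def)
    have "norm (- 1 / 29952 * p ^ 2 + q 2 / 7488 + 13 * q 13 / 2304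
     - q 1 / 489600 - q 2 / 122400 - 169 * q 13 / 489600 - 169 * q 26 / 122400) \<le>
      norm (- 1 / 29952 * p ^ 2) + norm (q 2 / 7488) + norm (13 * q 13 / 2304) + norm (q 1 / 489600)
        + norm (q 2 / 122400) + norm (169 * q 13 / 489600) + norm (169 * q 26 / 122400)"
      by (intro order_trans[OF norm_triangle_ineq4] order_trans[OF norm_triangle_ineq] add_mono order_refl)
    also have "\<dots> \<le> (K2 + K13) ^ 2 * J ^ 4 / 29952 + L 2 * J ^ 4 / 7488 + 13 * (L 13 * J ^ 4) / 2304
      + L 1 * J ^ 4 / 489600 + L 2 * J ^ 4 / 122400 + 169 * (L 13 * J ^ 4) / 489600 + 169 * (L 26 * J ^ 4) / 122400"
      using Q by (intro add_mono p) (auto simp: norm_divide norm_mult)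
    finally show ?thesis
      unfolding eisenstein_part_def p_def q_def J_def by (simp add: algebra_simps)
  qed
  then show ?thesis by blast
qed

section \<open>The eta quotients at level 26\<close>

lemma eta_quotient_4:
  "eta_quotient [(1, r1), (2, r2), (13, r3), (26, r4)] z =
     eta z powi r1 * eta (2 * z) powi r2 * eta (13 * z) powi r3 * eta (26 * z) powi r4"
  by (simp add: eta_quotient_def mult.assoc)

text \<open>With \<open>X = \<eta>\<^sup>2(13z) / \<eta>\<^sup>2(z)\<close> and \<open>Y = \<eta>\<^sup>2(26z) / \<eta>\<^sup>2(2z)\<close>, which are invariant under
  \<open>\<Gamma>\<^sub>0(26)\<close>, the eta quotients are \<open>C\<^sub>2\<close> times monomials in \<open>X\<close> and \<open>Y\<close>.\<close>
lemma cusp_part_factorization: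
  fixes z :: complex
  defines "X \<equiv> eta (13 * z) ^ 2 / eta z ^ 2" and "Y \<equiv> eta (26 * z) ^ 2 / eta (2 * z) ^ 2"
  shows "cusp_part z = (eta z ^ 3 * eta (2 * z) ^ 3 * eta (13 * z) * eta (26 * z)) *
    (- 1 / 2040 * (X / Y) - 127 / 5304 - 181 / 1768 * X - 947 / 13260 * Y - 127 / 408 * (X * Y)
      - 13 / 2040 * X ^ 2 + 46 / 3315 * (X ^ 2 / Y) + 863 / 26520 * (Y ^ 3 / X ^ 2))"
proof -
  let ?C2 = "eta z ^ 3 * eta (2 * z) ^ 3 * eta (13 * z) * eta (26 * z)"
  have pow: "x ^ 2 = x * x" "x ^ 3 = x * (x * x)" "x ^ 5 = x * (x * (x * (x * x)))"
    "x ^ 7 = x * (x * (x * (x * (x * (x * x)))))" for x :: complex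
    by (simp_all add: eval_nat_numeral)
  note simps = eta_quotient_4 X_def Y_def power_int_minus power_int_numeral pow
  have "eta_quotient [(1, 1), (2, 5), (13, 3), (26, -1)] z = ?C2 * (X / Y)"
    unfolding simps by (simp add: simps field_simps)
  moreover have "eta_quotient [(1, 3), (2, 3), (13, 1), (26, 1)] z = ?C2"
    unfolding simps by (simp add: simps field_simps)
  moreover have "eta_quotient [(1, 1), (2, 3), (13, 3), (26, 1)] z = ?C2 * X"
    unfolding simps by (simp add: simps field_simps)
  moreover have "eta_quotient [(1, 3), (2, 1), (13, 1), (26, 3)] z = ?C2 * Y"
    unfolding simps by (simp add: simps field_simps)
  moreover have "eta_quotient [(1, 1), (2, 1), (13, 3), (26, 3)] z = ?C2 * (X * Y)"
    unfolding simps by (simp add: simps field_simps)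
  moreover have "eta_quotient [(1, -1), (2, 3), (13, 5), (26, 1)] z = ?C2 * X ^ 2"
    unfolding simps by (simp add: simps field_simps)
  moreover have "eta_quotient [(1, -1), (2, 5), (13, 5), (26, -1)] z = ?C2 * (X ^ 2 / Y)"
    unfolding simps by (simp add: simps field_simps)
  moreover have "eta_quotient [(1, 7), (2, -3), (13, -3), (26, 7)] z = ?C2 * (Y ^ 3 / X ^ 2)"
    unfolding simps by (simp add: simps field_simps)
  ultimately show ?thesis
    unfolding cusp_part_def by (simp only: ring_distribs) (simp only: mult_ac)
qed

lemma cusp_part_Gamma0:
  assumes g: "g \<in> Gamma0 26" and z: "Im z > 0"
  shows "cusp_part (act g z) ^ 2 = cocycle g z ^ 8 * cusp_part z ^ 2"
proof -
  obtain a b c d where g_eq: "g = (a, b, c, d)" by (metis prod_cases4)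
  from g have det: "a * d - b * c = 1" and "26 dvd c" by (auto simp: g_eq Gamma0_def)
  then obtain k where k: "c = 26 * k" by (elim dvdE)
  have det': "a * d - 26 * b * k = 1" using det k by simp
  define J where "J = of_int c * z + of_int d"
  define w where "w = moebius_act a b c d z"
  have J0: "J \<noteq> 0" unfolding J_def by (rule cocycle_nonzero[OF det z])
  define m where "m = (\<lambda>N k'. eta_mult (eta_exponent a (N * b) k' d))"
  have e1: "eta w ^ 2 = m 1 (26 * k) * J * eta z ^ 2"
    using eta_Gamma0[OF det, of 1 "26 * k" z] z k by (simp add: w_def J_def m_def)
  have e2: "eta (2 * w) ^ 2 = m 2 (13 * k) * J * eta (2 * z) ^ 2"
    using eta_Gamma0[OF det, of 2 "13 * k" z] z k by (simp add: w_def J_def m_def)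
  have e13: "eta (13 * w) ^ 2 = m 13 (2 * k) * J * eta (13 * z) ^ 2"
    using eta_Gamma0[OF det, of 13 "2 * k" z] z k by (simp add: w_def J_def m_def)
  have e26: "eta (26 * w) ^ 2 = m 26 k * J * eta (26 * z) ^ 2"
    using eta_Gamma0[OF det, of 26 k z] z k by (simp add: w_def J_def m_def)
  have m13: "m 13 (2 * k) = m 1 (26 * k)"
    unfolding m_def using eta_exponent_13_1[OF det'] by (intro eta_mult_cong) simp
  have m26: "m 26 k = m 2 (13 * k)"
    unfolding m_def using eta_exponent_26_2[OF det'] by (intro eta_mult_cong) simp
  have m0: "m N k' \<noteq> 0" for N k' using norm_eta_mult unfolding m_def by (metis norm_zero zero_neq_one)
  have base: "m 1 (26 * k) ^ 3 * m 2 (13 * k) ^ 3 * m 13 (2 * k) * m 26 k = 1"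
  proof -
    have "eta_mult i ^ 3 = eta_mult (3 * i)" for i
      using eta_mult_add[of i i] eta_mult_add[of i "2 * i"] by (simp add: power3_eq_cube mult_ac)
    then show ?thesis
      using eta_mult_12[OF eta_exponent_base[OF det']] unfolding m_def by (simp add: eta_mult_add)
  qed
  define C2 where "C2 = (\<lambda>z. eta z ^ 3 * eta (2 * z) ^ 3 * eta (13 * z) * eta (26 * z))"
  have X: "eta (13 * w) ^ 2 / eta w ^ 2 = eta (13 * z) ^ 2 / eta z ^ 2"
    unfolding e13 e1 m13 using m0 J0 by simp
  have Y: "eta (26 * w) ^ 2 / eta (2 * w) ^ 2 = eta (26 * z) ^ 2 / eta (2 * z) ^ 2"
    unfolding e26 e2 m26 using m0 J0 by simp
  have sq: "(x ^ 3 * y ^ 3 * u * v) ^ 2 = (x ^ 2) ^ 3 * (y ^ 2) ^ 3 * u ^ 2 * v ^ 2" for x y u v :: complex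
    by (simp add: power_mult_distrib flip: power_mult)
  have "C2 w ^ 2 = (eta w ^ 2) ^ 3 * (eta (2 * w) ^ 2) ^ 3 * eta (13 * w) ^ 2 * eta (26 * w) ^ 2"
    unfolding C2_def by (rule sq)
  also have "\<dots> = (m 1 (26 * k) ^ 3 * m 2 (13 * k) ^ 3 * m 13 (2 * k) * m 26 k) * J ^ 8 *
      ((eta z ^ 2) ^ 3 * (eta (2 * z) ^ 2) ^ 3 * eta (13 * z) ^ 2 * eta (26 * z) ^ 2)"
  proof -
    have "(s * J * x) ^ 3 * (t * J * y) ^ 3 * (p * J * u) * (q * J * v) =
        (s ^ 3 * t ^ 3 * p * q) * J ^ 8 * (x ^ 3 * y ^ 3 * u * v)" for s t p q x y u v
      by (simp add: power_mult_distrib eval_nat_numeral mult_ac)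
    then show ?thesis unfolding e1 e2 e13 e26 .
  qed
  also have "\<dots> = J ^ 8 * C2 z ^ 2"
    unfolding base C2_def sq by simp
  finally have C2: "C2 w ^ 2 = J ^ 8 * C2 z ^ 2" .
  show ?thesis
    unfolding g_eq act.simps cocycle.simps w_def[symmetric] J_def[symmetric]
    unfolding cusp_part_factorization[of w] cusp_part_factorization[of z] X Y
    unfolding power_mult_distrib[of "eta _ ^ 3 * eta _ ^ 3 * eta _ * eta _"] C2[unfolded C2_def] by (simp only: mult.assoc)
qed

text \<open>The orders depend on \<open>c\<close> only through its gcds with \<open>2\<close>,
  \<open>13\<close> and \<open>26\<close>; the four cases correspond to the four cusps of
  \<open>\<Gamma>_0(26)\<close>.\<close>

lemma cusp_orders:
  obtains "cusp_order c 1 = 1" "cusp_order c 2 = 1 / 2" "cusp_order c 13 = 1 / 13" "cusp_order c 26 = 1 / 26"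
  | "cusp_order c 1 = 1" "cusp_order c 2 = 2" "cusp_order c 13 = 1 / 13" "cusp_order c 26 = 2 / 13"
  | "cusp_order c 1 = 1" "cusp_order c 2 = 1 / 2" "cusp_order c 13 = 13" "cusp_order c 26 = 13 / 2"
  | "cusp_order c 1 = 1" "cusp_order c 2 = 2" "cusp_order c 13 = 13" "cusp_order c 26 = 26"
proof -
  have dvd_26: "(2 :: int) dvd 26 \<longleftrightarrow> True" "(13 :: int) dvd 26 \<longleftrightarrow> True" by simp_all
  have r: "gcd c m = gcd (c mod 26) m" if "m dvd 26" for m
    using that by (metis gcd.commute gcd_red_int mod_mod_cancel)
  have "\<forall>r\<in>set [0..25]. (gcd r 2, gcd r 13, gcd r 26) \<in> {(1, 1, 1), (2, 1, 2), (1, 13, 13), (2, 13, 26 :: int)}"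
    by code_simp
  moreover have "c mod 26 \<in> set [0..25]" by simp
  ultimately have "(gcd c 2, gcd c 13, gcd c 26) \<in> {(1, 1, 1), (2, 1, 2), (1, 13, 13), (2, 13, 26)}"
    using r[of 2] r[of 13] r[of 26] by (simp only: dvd_refl dvd_26)
  then show ?thesis using that by (auto simp: cusp_order_def)
qed

lemma cusp_part_growth:
  assumes g: "g \<in> SL2"
  shows "\<exists>K. \<forall>z. Im z \<ge> 1 \<longrightarrow> norm (cusp_part (act g z)) \<le> K * norm (cocycle g z) ^ 4"
proof -
  obtain a b c d where g_eq: "g = (a, b, c, d)" by (metis prod_cases4)
  have g': "(a, b, c, d) \<in> SL2" using g by (simp add: g_eq)
  have L: "\<exists>K. \<forall>z. Im z \<ge> 1 \<longrightarrow> norm (\<beta> * eta_quotient l (act g z)) \<le> K * norm (cocycle g z) ^ 4"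
    if hyps: "\<forall>(N, r)\<in>set l. N > 0" "(\<Sum>(N, r)\<leftarrow>l. r) = 8" "(\<Sum>(N, r)\<leftarrow>l. of_int r * cusp_order c N) \<ge> 0" for l \<beta>
  proof -
    obtain K where K: "\<And>z. Im z \<ge> 1 \<Longrightarrow> norm (eta_quotient l (act g z)) \<le> K * norm (cocycle g z) ^ 4"
      using eta_quotient_growth_weight4[OF g' hyps] unfolding g_eq by blast
    have "norm (\<beta> * eta_quotient l (act g z)) \<le> (norm \<beta> * K) * norm (cocycle g z) ^ 4" if "Im z \<ge> 1" for z
      using mult_left_mono[OF K[OF that], of "norm \<beta>"] by (simp add: norm_mult mult_ac)
    then show ?thesis by blast
  qed
  have add: "\<exists>K. \<forall>z. Im z \<ge> 1 \<longrightarrow> norm (f (act g z) + h (act g z)) \<le> K * norm (cocycle g z) ^ 4"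
    if fh: "\<exists>K. \<forall>z. Im z \<ge> 1 \<longrightarrow> norm (f (act g z)) \<le> K * norm (cocycle g z) ^ 4"
       "\<exists>K. \<forall>z. Im z \<ge> 1 \<longrightarrow> norm (h (act g z)) \<le> K * norm (cocycle g z) ^ 4" for f h :: "complex \<Rightarrow> complex"
  proof -
    obtain K K' where K: "\<And>z. Im z \<ge> 1 \<Longrightarrow> norm (f (act g z)) \<le> K * norm (cocycle g z) ^ 4"
      "\<And>z. Im z \<ge> 1 \<Longrightarrow> norm (h (act g z)) \<le> K' * norm (cocycle g z) ^ 4"
      using fh by blast
    have "norm (f (act g z) + h (act g z)) \<le> (K + K') * norm (cocycle g z) ^ 4" if "Im z \<ge> 1" for z
      using norm_triangle_mono[OF K(1)[OF that] K(2)[OF that]] by (simp add: algebra_simps)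
    then show ?thesis by blast
  qed
  have cusp: "cusp_part = (\<lambda>z. (- 1 / 2040) * eta_quotient [(1, 1), (2, 5), (13, 3), (26, -1)] z
     + (- 127 / 5304) * eta_quotient [(1, 3), (2, 3), (13, 1), (26, 1)] z
     + (- 181 / 1768) * eta_quotient [(1, 1), (2, 3), (13, 3), (26, 1)] z
     + (- 947 / 13260) * eta_quotient [(1, 3), (2, 1), (13, 1), (26, 3)] z
     + (- 127 / 408) * eta_quotient [(1, 1), (2, 1), (13, 3), (26, 3)] z
     + (- 13 / 2040) * eta_quotient [(1, -1), (2, 3), (13, 5), (26, 1)] z
     + 46 / 3315 * eta_quotient [(1, -1), (2, 5), (13, 5), (26, -1)] z
     + 863 / 26520 * eta_quotient [(1, 7), (2, -3), (13, -3), (26, 7)] z)"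
    by (simp add: cusp_part_def fun_eq_iff)
  show ?thesis
    unfolding cusp by (intro add L) (auto intro: cusp_orders[of c])
qed

section \<open>Holomorphy, and cosets of \<open>\<Gamma>_0(26)\<close>\<close>

lemma holomorphic_scaled:
  assumes "f holomorphic_on {z. Im z > 0}" "N > 0"
  shows "(\<lambda>z. f (of_nat N * z)) holomorphic_on {z. Im z > 0}"
proof -
  have "(f \<circ> (\<lambda>z. of_nat N * z)) holomorphic_on {z. Im z > 0}"
    using assms by (intro holomorphic_on_compose_gen[OF _ assms(1)] holomorphic_intros) auto
  then show ?thesis by (simp add: o_def)
qed

lemma holomorphic_eisenstein_part: "eisenstein_part holomorphic_on {z. Im z > 0}"
  unfolding eisenstein_part_def[abs_def] P_at_def Q_at_def
  by (intro holomorphic_intros holomorphic_scaled holomorphic_qexp unit_radius_intros) auto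

lemma holomorphic_eta_quotient:
  assumes "\<forall>(N, r)\<in>set l. N > 0"
  shows "eta_quotient l holomorphic_on {z. Im z > 0}"
  using assms
proof (induction l)
  case Nil
  then show ?case by (simp add: eta_quotient_def[abs_def])
next
  case (Cons x l)
  obtain N r where x: "x = (N, r)" by (cases x)
  have "eta_quotient (x # l) = (\<lambda>z. eta (of_nat N * z) powi r * eta_quotient l z)"
    by (simp add: eta_quotient_def fun_eq_iff x)
  then show ?case
    using Cons x holomorphic_scaled[OF holomorphic_eta, of N] by (auto intro!: holomorphic_intros)
qed

lemma holomorphic_cusp_part: "cusp_part holomorphic_on {z. Im z > 0}"
  unfolding cusp_part_def[abs_def]
  by (intro holomorphic_intros holomorphic_eta_quotient) auto

text \<open>The bottom rows \<open>(0, 1)\<close>, \<open>(1, j)\<close>,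
  \<open>(2, 2 j + 1)\<close> and \<open>(13, 13 j + 1)\<close> run through the projective line over
  the integers modulo \<open>26\<close>, which has \<open>1 + 26 + 13 + 2 = 42\<close>
  points.\<close>

definition coset_reps_26 :: "mat2 set" where
  "coset_reps_26 = {(1, 0, 0, 1)} \<union> (\<lambda>j. (0, - 1, 1, j)) ` {0..<26}
     \<union> (\<lambda>j. (1, j, 2, 2 * j + 1)) ` {0..<13} \<union> (\<lambda>j. (1, j, 13, 13 * j + 1)) ` {0..<2}"

lemma card_coset_reps_26: "finite coset_reps_26" "card coset_reps_26 \<le> 42"
proof -
  show "finite coset_reps_26" by (simp add: coset_reps_26_def)
  let ?A = "(\<lambda>j. (0, - 1, 1, j)) ` {0..<26} :: mat2 set"
  let ?B = "(\<lambda>j. (1, j, 2, 2 * j + 1)) ` {0..<13} :: mat2 set"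
  let ?C = "(\<lambda>j. (1, j, 13, 13 * j + 1)) ` {0..<2} :: mat2 set"
  have "card ?A \<le> 26" "card ?B \<le> 13" "card ?C \<le> 2"
    by (rule order_trans[OF card_image_le]; simp)+
  moreover have "card ({(1, 0, 0, 1)} :: mat2 set) = 1" by simp
  ultimately show "card coset_reps_26 \<le> 42"
    unfolding coset_reps_26_def
    using card_Un_le[of "{(1, 0, 0, 1)} \<union> ?A \<union> ?B" ?C] card_Un_le[of "{(1, 0, 0, 1)} \<union> ?A" ?B]
      card_Un_le[of "{(1, 0, 0, 1)}" ?A] by linarith
qed

lemma coset_reps_26_SL2: "coset_reps_26 \<subseteq> SL2"
  by (auto simp: coset_reps_26_def SL2_def)

text \<open>Membership means that \<open>26\<close> divides \<open>c w - d v\<close> for the bottom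
  row \<open>(v, w)\<close> of the representative. The primes \<open>2\<close> and \<open>13\<close>
  dividing \<open>c\<close> select the family; modulo these the condition is automatic, and modulo
  the others it is a linear congruence for \<open>j\<close> with invertible coefficient.\<close>

lemma coset_reps_26_cover:
  assumes g: "g \<in> SL2"
  shows "\<exists>\<rho>\<in>coset_reps_26. mat2_mult g (mat2_inv \<rho>) \<in> Gamma0 26"
proof -
  obtain a b c d where g_eq: "g = (a, b, c, d)" by (metis prod_cases4)
  have mem: "mat2_mult g (mat2_inv \<rho>) \<in> Gamma0 26 \<longleftrightarrow> 26 dvd c * w - d * v"
    if "\<rho> \<in> coset_reps_26" "\<rho> = (u, t, v, w)" for \<rho> u t v w
  proof -
    have "mat2_mult g (mat2_inv \<rho>) \<in> SL2" using that(1) coset_reps_26_SL2 g by (intro SL2_mult SL2_inv) auto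
    then show ?thesis unfolding g_eq that(2) by (simp add: Gamma0_def SL2_def)
  qed
  have solve: "\<exists>j\<in>{0..<m}. m dvd s * j - t" if co: "coprime s m" "m > 0" for s t m :: int
  proof -
    obtain x where x: "[s * x = 1] (mod m)" using cong_solve_coprime_int[OF co(1)] by blast
    have "[s * ((x * t) mod m) = s * (x * t)] (mod m)" by (intro cong_mult) (simp_all add: cong_def)
    also have "s * (x * t) = s * x * t" by simp
    also have "[s * x * t = 1 * t] (mod m)" using x by (intro cong_mult) simp_all
    finally have "m dvd s * ((x * t) mod m) - t" by (simp add: cong_iff_dvd_diff)
    then show ?thesis using co(2) by (intro bexI[of _ "(x * t) mod m"]) auto
  qed
  have prime_co: "coprime c p" if "prime p" "\<not> p dvd c" for p :: int
    using prime_imp_coprime[OF that] by (simp add: coprime_commute)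
  consider "2 dvd c" "13 dvd c" | "2 dvd c" "\<not> 13 dvd c" | "\<not> 2 dvd c" "13 dvd c" | "\<not> 2 dvd c" "\<not> 13 dvd c"
    by blast
  then show ?thesis
  proof cases
    case 1
    then have "26 dvd c" by presburger
    then show ?thesis
      using g by (intro bexI[of _ "(1, 0, 0, 1)"])
        (auto simp: g_eq Gamma0_def SL2_def coset_reps_26_def)
  next
    case 2
    have "coprime (2 * c) 13" using prime_co[of 13] 2 by simp
    from solve[OF this zero_less_numeral, of "2 * d - c"] obtain j where j: "j \<in> {0..<13}" "13 dvd 2 * c * j - (2 * d - c)" by blast
    have eq: "c * (2 * j + 1) - d * 2 = 2 * c * j - (2 * d - c)" by (simp add: algebra_simps)
    have "13 dvd c * (2 * j + 1) - d * 2" unfolding eq by (rule j(2))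
    moreover have "2 dvd c * (2 * j + 1) - d * 2" using 2(1) by (intro dvd_diff dvd_mult2 dvd_triv_right)
    ultimately have "26 dvd c * (2 * j + 1) - d * 2" by presburger
    moreover have "(1, j, 2, 2 * j + 1) \<in> coset_reps_26" using j by (auto simp: coset_reps_26_def)
    ultimately show ?thesis using mem by blast
  next
    case 3
    have "coprime (13 * c) 2" using prime_co[of 2] 3 by simp
    from solve[OF this zero_less_numeral, of "13 * d - c"] obtain j where j: "j \<in> {0..<2}" "2 dvd 13 * c * j - (13 * d - c)" by blast
    have eq: "c * (13 * j + 1) - d * 13 = 13 * c * j - (13 * d - c)" by (simp add: algebra_simps)
    have "2 dvd c * (13 * j + 1) - d * 13" unfolding eq by (rule j(2))
    moreover have "13 dvd c * (13 * j + 1) - d * 13" using 3(2) by (intro dvd_diff dvd_mult2 dvd_triv_right)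
    ultimately have "26 dvd c * (13 * j + 1) - d * 13" by presburger
    moreover have "(1, j, 13, 13 * j + 1) \<in> coset_reps_26" using j by (auto simp: coset_reps_26_def)
    ultimately show ?thesis using mem by blast
  next
    case 4
    have "coprime c (2 * 13)" unfolding coprime_mult_right_iff using prime_co[of 2] prime_co[of 13] 4 by simp
    then have "coprime c 26" by simp
    from solve[OF this zero_less_numeral, of d] obtain j where j: "j \<in> {0..<26}" "26 dvd c * j - d" by blast
    have "(0, - 1, 1, j) \<in> coset_reps_26" using j by (auto simp: coset_reps_26_def)
    moreover from this have "mat2_mult g (mat2_inv (0, - 1, 1, j)) \<in> Gamma0 26"
      using mem[of "(0, - 1, 1, j)" 0 "- 1" 1 j] j by simp
    ultimately show ?thesis by blast
  qed
qed

text \<open>Only the squares of the eta quotients are known to have trivial character, which leaves a sign.\<close>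
lemma eisenstein_part_eq_pm_cusp_part:
  assumes "\<exists>K. \<forall>z. Im z \<ge> 1 \<longrightarrow> norm (eisenstein_part z - cusp_part z) \<le> K * norm (nome z) ^ 29"
  shows "(\<forall>z. Im z > 0 \<longrightarrow> eisenstein_part z - cusp_part z = 0) \<or>
         (\<forall>z. Im z > 0 \<longrightarrow> eisenstein_part z + cusp_part z = 0)"
proof -
  define G where "G = (\<lambda>z. eisenstein_part z ^ 2 - cusp_part z ^ 2)"
  obtain K where K: "\<And>z. Im z \<ge> 1 \<Longrightarrow> norm (eisenstein_part z - cusp_part z) \<le> K * norm (nome z) ^ 29"
    using assms by blast
  obtain A where A: "\<And>g z. g \<in> SL2 \<Longrightarrow> Im z \<ge> 1 \<Longrightarrow> norm (eisenstein_part (act g z)) \<le> A g * norm (cocycle g z) ^ 4"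
    using eisenstein_part_growth by metis
  obtain B where B: "\<And>g z. g \<in> SL2 \<Longrightarrow> Im z \<ge> 1 \<Longrightarrow> norm (cusp_part (act g z)) \<le> B g * norm (cocycle g z) ^ 4"
    using cusp_part_growth by metis
  have "G z = 0" if z: "Im z > 0" for z
  \<comment> \<open>Since \<open>8 * 42 = 336 < 348 = 12 * 29\<close>, vanishing to order
    \<open>29\<close> suffices.\<close>
  proof (rule sturm_bound[where G = G and z = z and k = 8 and n = 29 and reps = coset_reps_26 and N = 26])
    show "G holomorphic_on {z. Im z > 0}"
      unfolding G_def by (intro holomorphic_intros holomorphic_eisenstein_part holomorphic_cusp_part)
    show "G (act g z) = cocycle g z ^ 8 * G z" if "g \<in> Gamma0 26" "Im z > 0" for g z
      unfolding G_def cusp_part_Gamma0[OF that] eisenstein_part_Gamma0[OF that]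
      by (simp add: power_mult_distrib right_diff_distrib flip: power_mult)
    show "\<exists>K. \<forall>z. Im z \<ge> 1 \<longrightarrow> norm (G (act g z)) \<le> K * norm (cocycle g z) ^ 8" if g: "g \<in> SL2" for g
    proof -
      have "norm (G (act g z)) \<le> (A g ^ 2 + B g ^ 2) * norm (cocycle g z) ^ 8" if z: "Im z \<ge> 1" for z
      proof -
        have "norm (G (act g z)) \<le> norm (eisenstein_part (act g z)) ^ 2 + norm (cusp_part (act g z)) ^ 2"
          unfolding G_def by (metis norm_triangle_ineq4 norm_power)
        also have "\<dots> \<le> (A g * norm (cocycle g z) ^ 4) ^ 2 + (B g * norm (cocycle g z) ^ 4) ^ 2"
          using A[OF g z] B[OF g z] by (intro add_mono power_mono) auto
        finally show ?thesis by (simp add: power_mult_distrib distrib_right flip: power_mult)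
      qed
      then show ?thesis by blast
    qed
    show "\<exists>K. \<forall>z. Im z \<ge> 1 \<longrightarrow> norm (G z) \<le> K * norm (nome z) ^ 29"
    proof -
      let ?L = "A (1, 0, 0, 1) + B (1, 0, 0, 1)"
      have "norm (G z) \<le> (K * ?L) * norm (nome z) ^ 29" if z: "Im z \<ge> 1" for z
      proof -
        \<comment> \<open>The difference carries the whole decay; for the sum, boundedness near
          infinity is enough, and this is the growth estimate at the identity matrix.\<close>
        have "norm (eisenstein_part z + cusp_part z) \<le> ?L"
          using norm_triangle_mono[OF A[OF SL2_one z] B[OF SL2_one z]] by simp
        moreover have "norm (G z) = norm (eisenstein_part z - cusp_part z) * norm (eisenstein_part z + cusp_part z)"
          unfolding G_def norm_mult[symmetric] by (simp add: power2_eq_square algebra_simps)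
        ultimately have "norm (G z) \<le> (K * norm (nome z) ^ 29) * ?L"
          using K[OF z] by (simp add: mult_mono' order_trans[OF norm_ge_zero])
        then show ?thesis by (simp add: mult_ac)
      qed
      then show ?thesis by blast
    qed
  qed (use card_coset_reps_26 coset_reps_26_SL2 coset_reps_26_cover z in auto)
  then have 0: "(eisenstein_part z - cusp_part z) * (eisenstein_part z + cusp_part z) = 0" if "Im z > 0" for z
    using that by (simp add: G_def power2_eq_square algebra_simps)
  have "(\<forall>z\<in>{z. Im z > 0}. eisenstein_part z - cusp_part z = 0) \<or> (\<forall>z\<in>{z. Im z > 0}. eisenstein_part z + cusp_part z = 0)"
    by (intro holomorphic_mult_eq_0 holomorphic_intros holomorphic_eisenstein_part holomorphic_cusp_part)
       (use 0 in \<open>auto simp: open_halfspace_Im_gt intro: convex_connected convex_halfspace_Im_gt\<close>)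
  then show ?thesis by auto
qed

section \<open>Coefficients of eta quotients\<close>

definition dilate :: "nat \<Rightarrow> complex fps \<Rightarrow> complex fps" where
  "dilate N f = Abs_fps (\<lambda>n. if N dvd n then fps_nth f (n div N) else 0)"

lemma dilate_sums:
  assumes f: "unit_radius f" and N: "N > 0" and q: "norm q < 1"
  shows "(\<lambda>n. fps_nth (dilate N f) n * q ^ n) sums eval_fps f (q ^ N)"
proof -
  have "norm (q ^ N) < 1" using q N by (simp add: norm_power power_less_one_iff)
  from sums_eval_fps[OF unit_radiusD[OF f this]]
  have "(\<lambda>n. fps_nth f n * (q ^ N) ^ n) sums eval_fps f (q ^ N)" .
  then have "(\<lambda>n. (\<lambda>n. fps_nth (dilate N f) n * q ^ n) (N * n)) sums eval_fps f (q ^ N)"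
    using N by (simp add: dilate_def power_mult)
  moreover have "strict_mono (\<lambda>n. N * n)" using N by (auto simp: strict_mono_def)
  ultimately show ?thesis
    by (subst (asm) sums_mono_reindex) (auto simp: dilate_def elim!: dvdE)
qed

lemma unit_radius_dilate [unit_radius_intros]:
  assumes "unit_radius f" "N > 0"
  shows "unit_radius (dilate N f)"
  unfolding unit_radius_def fps_conv_radius_def
  by (rule conv_radius_geI_ex') (use dilate_sums[OF assms] in \<open>auto simp: sums_iff\<close>)

lemma qexp_dilate:
  assumes "unit_radius f" "N > 0" "Im z > 0"
  shows "qexp (dilate N f) z = qexp f (of_nat N * z)"
  using dilate_sums[OF assms(1,2) norm_nome_less_1[OF assms(3)]]
  by (simp add: qexp_def eval_fps_def sums_iff nome_of_nat_mult)

text \<open>\<open>H\<close> is \<open>q F' / F\<close>, with the denominator cleared so that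
  \<open>F\<close> need not be inverted. Products become sums, over the rationals and over the
  complex numbers alike.\<close>

definition log_deriv :: "'a :: field_char_0 fps \<Rightarrow> 'a fps \<Rightarrow> bool" where
  "log_deriv F H \<longleftrightarrow> fps_X * fps_deriv F = H * F"

lemma theta_nth: "fps_nth (fps_X * fps_deriv F) n = of_nat n * fps_nth F n"
  by (cases n) simp_all

lemma fps_prod_nth_0: "fps_nth (\<Prod>k\<in>A. F k) 0 = (\<Prod>k\<in>A. fps_nth (F k) 0)"
  by (induction A rule: infinite_finite_induct) simp_all

lemma log_deriv_1: "log_deriv 1 0"
  by (simp add: log_deriv_def)

lemma log_deriv_mult: "log_deriv F H \<Longrightarrow> log_deriv G K \<Longrightarrow> log_deriv (F * G) (H + K)"
  unfolding log_deriv_def by (simp add: algebra_simps)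

lemma log_deriv_power: "log_deriv F H \<Longrightarrow> log_deriv (F ^ n) (of_nat n * H)"
proof (induction n)
  case (Suc n)
  then show ?case using log_deriv_mult[of F H "F ^ n" "of_nat n * H"] by (simp add: algebra_simps)
qed (simp add: log_deriv_1)

lemma log_deriv_inverse:
  assumes "log_deriv F H" "fps_nth F 0 \<noteq> 0"
  shows "log_deriv (inverse F) (- H)"
proof -
  have "fps_X * fps_deriv (inverse F) = - (fps_X * fps_deriv F) * inverse F ^ 2"
    by (simp add: fps_inverse_deriv[OF assms(2)])
  also have "\<dots> = - H * inverse F * (F * inverse F)"
    using assms(1) by (simp add: log_deriv_def power2_eq_square mult_ac)
  also have "F * inverse F = 1" using assms(2) by (simp add: inverse_mult_eq_1')
  finally show ?thesis by (simp add: log_deriv_def)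
qed

lemma log_deriv_prod:
  assumes "finite A" "\<And>k. k \<in> A \<Longrightarrow> log_deriv (F k) (H k)"
  shows "log_deriv (\<Prod>k\<in>A. F k) (\<Sum>k\<in>A. H k)"
  using assms by (induction A rule: finite_induct) (auto intro: log_deriv_1 log_deriv_mult)

lemma log_deriv_recurrence:
  assumes "log_deriv F H"
  shows "of_nat m * fps_nth F m = (\<Sum>k\<le>m. fps_nth H k * fps_nth F (m - k))"
proof -
  have "of_nat m * fps_nth F m = fps_nth (fps_X * fps_deriv F) m" by (cases m) simp_all
  also have "\<dots> = fps_nth (H * F) m" using assms by (simp add: log_deriv_def)
  finally show ?thesis by (simp add: fps_mult_nth atLeast0AtMost)
qed

text \<open>As \<open>h 0 = 0\<close>, the right side involves only earlier terms and determines the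
  next one. All indices stay below a bound \<open>n\<close>, because a truncated product has the
  correct logarithmic derivative only that far.\<close>

lemma recurrence_unique:
  fixes a b h h' :: "nat \<Rightarrow> 'a :: field_char_0"
  assumes a: "\<And>m. m \<le> n \<Longrightarrow> of_nat m * a m = (\<Sum>k\<le>m. h k * a (m - k))"
    and b: "\<And>m. m \<le> n \<Longrightarrow> of_nat m * b m = (\<Sum>k\<le>m. h' k * b (m - k))"
    and h: "\<And>k. k \<le> n \<Longrightarrow> h k = h' k" "h 0 = 0" and 0: "a 0 = b 0" and m: "m \<le> n"
  shows "a m = b m"
  using m
proof (induction m rule: less_induct)
  case (less m)
  show ?case
  proof (cases "m = 0")
    case False
    have "of_nat m * a m = (\<Sum>k\<le>m. h k * a (m - k))" using less.prems by (rule a)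
    also have "\<dots> = (\<Sum>k\<le>m. h' k * b (m - k))"
    proof (rule sum.cong[OF refl])
      fix k assume "k \<in> {..m}"
      then show "h k * a (m - k) = h' k * b (m - k)"
        using less h False by (cases "k = 0") auto
    qed
    also have "\<dots> = of_nat m * b m" using b[OF less.prems] ..
    finally show ?thesis using False by simp
  qed (use 0 in simp)
qed

text \<open>The coefficient of \<open>q^m\<close> in the logarithmic derivative of the infinite
  product of all \<open>(1 - q^(d k))^r\<close>.\<close>

definition eta_log_deriv_coeff :: "(nat \<times> int) list \<Rightarrow> nat \<Rightarrow> int" where
  "eta_log_deriv_coeff l m =
     (\<Sum>(d, r)\<leftarrow>l. if d dvd m then - r * int d * int (sigma_nat 1 (m div d)) else 0)"

text \<open>For \<open>m > 0\<close> the expansion of \<open>q^m / (1 - q^m)\<close>.\<close>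

definition geometric_multiples :: "nat \<Rightarrow> rat fps" where
  "geometric_multiples m = Abs_fps (\<lambda>n. if m dvd n \<and> n > 0 then 1 else 0)"

lemma log_deriv_1_minus_X_power:
  assumes "m > 0"
  shows "log_deriv (1 - fps_X ^ m) (- of_nat m * geometric_multiples m)"
proof -
  have *: "geometric_multiples m * (1 - fps_X ^ m) = fps_X ^ m"
  proof (rule fps_ext)
    fix n
    have "fps_nth (geometric_multiples m * (1 - fps_X ^ m)) n =
      fps_nth (geometric_multiples m) n - (if n < m then 0 else fps_nth (geometric_multiples m) (n - m))"
      by (simp add: right_diff_distrib fps_X_power_mult_right_nth)
    also have "\<dots> = (if n = m then 1 else 0)"
      using assms by (auto simp: geometric_multiples_def dvd_minus_self dest: dvd_imp_le)
    finally show "fps_nth (geometric_multiples m * (1 - fps_X ^ m)) n = fps_nth (fps_X ^ m) n"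
      by simp
  qed
  have "fps_X * fps_deriv (1 - fps_X ^ m) = - of_nat m * (fps_X ^ m :: rat fps)"
    by (rule fps_ext) (auto simp: theta_nth fps_of_nat[symmetric] simp flip: fps_const_neg)
  also have "\<dots> = - of_nat m * geometric_multiples m * (1 - fps_X ^ m)"
    using * by (simp add: mult.assoc)
  finally show ?thesis by (simp add: log_deriv_def)
qed

lemma eta_factor_log_deriv:
  assumes d: "d > 0"
  obtains H where "log_deriv (eta_factor d r n) H" "fps_nth (eta_factor d r n) 0 = 1"
    "\<And>m. m \<le> n \<Longrightarrow> fps_nth H m = of_int (if d dvd m then - r * int d * int (sigma_nat 1 (m div d)) else 0)"
proof -
  define P where "P = (\<Prod>k\<in>{1..n}. (1 - fps_X ^ (d * k)) :: rat fps)"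
  define K where "K = (\<Sum>k\<in>{1..n}. - of_nat (d * k) * geometric_multiples (d * k))"
  have PK: "log_deriv P K" unfolding P_def K_def
    using d by (intro log_deriv_prod log_deriv_1_minus_X_power) auto
  have P0: "fps_nth P 0 = 1"
  proof -
    have "fps_nth P 0 = (\<Prod>k\<in>{1..n}. fps_nth (1 - fps_X ^ (d * k)) 0)"
      unfolding P_def by (rule fps_prod_nth_0)
    also have "\<dots> = 1" using d by (intro prod.neutral) auto
    finally show ?thesis .
  qed
  have K: "fps_nth K m = of_int (if d dvd m then - int d * int (sigma_nat 1 (m div d)) else 0)" if "m \<le> n" for m
  proof -
    have "fps_nth K m = (\<Sum>k\<in>{1..n}. - of_nat (d * k) * (if d * k dvd m \<and> m > 0 then 1 else 0))"
      unfolding K_def fps_sum_nth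
      by (intro sum.cong refl) (simp add: geometric_multiples_def fps_of_nat[symmetric] del: of_nat_mult flip: fps_const_neg)
    also have "\<dots> = (\<Sum>k\<in>{k\<in>{1..n}. d * k dvd m \<and> m > 0}. - of_nat (d * k))"
      by (subst sum.inter_filter) (auto intro!: sum.cong)
    \<comment> \<open>Here \<open>k\<close> runs through the divisors of \<open>m div d\<close>, all
      at most \<open>m \<le> n\<close>, so stopping the product at \<open>n\<close> loses
      nothing.\<close>
    also have "{k\<in>{1..n}. d * k dvd m \<and> m > 0} = (if d dvd m then divisors_upto (m div d) else {})"
    proof (cases "d dvd m")
      case True
      then obtain e where e: "m = d * e" by (elim dvdE)
      have "k \<le> e" if "k dvd e" "e > 0" for k using that by (rule dvd_imp_le)
      moreover have "e \<le> n" using \<open>m \<le> n\<close> e d by (metis le_trans mult.commute mult_le_mono2 nat_mult_1 Suc_leI One_nat_def)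
      ultimately show ?thesis using e d by (force simp: divisors_upto_def)
    next
      case False
      then show ?thesis by (auto dest: dvd_mult_left)
    qed
    also have "(\<Sum>k\<in>\<dots>. - of_nat (d * k)) = (of_int (if d dvd m then - int d * int (sigma_nat 1 (m div d)) else 0) :: rat)"
      by (simp add: sigma_nat_altdef sum_distrib_left sum_negf)
    finally show ?thesis .
  qed
  show ?thesis
  proof (cases "r \<ge> 0")
    case True
    have e: "eta_factor d r n = P ^ nat r" using True by (simp add: eta_factor_def P_def)
    show ?thesis
    proof (rule that[of "of_nat (nat r) * K"])
      show "log_deriv (eta_factor d r n) (of_nat (nat r) * K)" unfolding e by (rule log_deriv_power[OF PK])
      show "fps_nth (eta_factor d r n) 0 = 1" unfolding e by (simp add: fps_power_zeroth P0)
      show "fps_nth (of_nat (nat r) * K) m = of_int (if d dvd m then - r * int d * int (sigma_nat 1 (m div d)) else 0)"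
        if "m \<le> n" for m
        using True K[OF that] by (simp add: fps_of_nat[symmetric])
    qed
  next
    case False
    have e: "eta_factor d r n = inverse (P ^ nat (- r))" using False by (simp add: eta_factor_def P_def)
    have p0: "fps_nth (P ^ nat (- r)) 0 = 1" by (simp add: fps_power_zeroth P0)
    show ?thesis
    proof (rule that[of "- (of_nat (nat (- r)) * K)"])
      show "log_deriv (eta_factor d r n) (- (of_nat (nat (- r)) * K))"
        unfolding e using p0 by (intro log_deriv_inverse log_deriv_power PK) simp
      show "fps_nth (eta_factor d r n) 0 = 1" unfolding e by (simp add: p0)
      show "fps_nth (- (of_nat (nat (- r)) * K)) m = of_int (if d dvd m then - r * int d * int (sigma_nat 1 (m div d)) else 0)"
        if "m \<le> n" for m
        using False K[OF that] by (simp add: fps_of_nat[symmetric])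
    qed
  qed
qed

lemma eta_product_log_deriv:
  assumes "\<forall>(d, r)\<in>set l. d > 0"
  shows "\<exists>H. log_deriv (prod_list (map (\<lambda>(d, r). eta_factor d r n) l)) H \<and>
     fps_nth (prod_list (map (\<lambda>(d, r). eta_factor d r n) l)) 0 = 1 \<and>
     (\<forall>m\<le>n. fps_nth H m = of_int (eta_log_deriv_coeff l m))"
  using assms
proof (induction l)
  case Nil
  then show ?case by (auto intro!: exI[of _ 0] log_deriv_1 simp: eta_log_deriv_coeff_def)
next
  case (Cons x l)
  obtain d r where x: "x = (d, r)" by (cases x)
  from Cons x have d: "d > 0" by auto
  obtain H where H: "log_deriv (eta_factor d r n) H" "fps_nth (eta_factor d r n) 0 = 1"
    "\<And>m. m \<le> n \<Longrightarrow> fps_nth H m = of_int (if d dvd m then - r * int d * int (sigma_nat 1 (m div d)) else 0)"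
    by (rule eta_factor_log_deriv[OF d, of r n]) (rule that)
  obtain K where K: "log_deriv (prod_list (map (\<lambda>(d, r). eta_factor d r n) l)) K"
     "fps_nth (prod_list (map (\<lambda>(d, r). eta_factor d r n) l)) 0 = 1"
     "\<And>m. m \<le> n \<Longrightarrow> fps_nth K m = of_int (eta_log_deriv_coeff l m)"
    using Cons by auto
  show ?case
    using log_deriv_mult[OF H(1) K(1)] H(2,3) K(2,3)
    by (intro exI[of _ "H + K"]) (simp add: x eta_log_deriv_coeff_def)
qed

text \<open>\<open>E\<close> is the Taylor expansion of the exponential of \<open>L\<close> on the
  unit disc; its logarithmic derivative is computed on functions and carried back to series by
  \<open>qexp_eq_0_imp_eq_0\<close>.\<close>

lemma exp_qexp:
  assumes L: "unit_radius L"
  obtains E where "unit_radius E" "\<And>z. Im z > 0 \<Longrightarrow> qexp E z = exp (qexp L z)"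
    "fps_nth E 0 = exp (fps_nth L 0)" "log_deriv E (fps_X * fps_deriv L)"
proof -
  define \<phi> where "\<phi> = (\<lambda>q. exp (eval_fps L q))"
  define E where "E = fps_expansion \<phi> 0"
  have sub: "eball 0 1 \<subseteq> eball 0 (fps_conv_radius L)"
    using L unfolding unit_radius_def by (rule eball_mono)
  have hol: "\<phi> holomorphic_on eball 0 1"
    unfolding \<phi>_def using sub by (intro holomorphic_intros)
  have E: "unit_radius E"
    unfolding unit_radius_def E_def by (rule conv_radius_fps_expansion[OF hol])
  have ev: "eval_fps E q = \<phi> q" if "norm q < 1" for q
    using eval_fps_expansion'[OF hol, of q] that by (simp add: E_def one_ereal_def)
  have qE: "qexp E z = exp (qexp L z)" if "Im z > 0" for z
    unfolding qexp_def using ev[OF norm_nome_less_1[OF that]] by (simp add: \<phi>_def)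
  have E0: "fps_nth E 0 = exp (fps_nth L 0)"
    using ev[of 0] by (simp add: \<phi>_def eval_fps_at_0)
  have "fps_X * fps_deriv E - (fps_X * fps_deriv L) * E = 0"
  proof (rule qexp_eq_0_imp_eq_0)
    show "unit_radius (fps_X * fps_deriv E - (fps_X * fps_deriv L) * E)"
      by (intro unit_radius_intros E L)
    fix z assume z: "Im z > 0"
    have "(qexp E has_field_derivative (2 * pi * \<i> * qexp (fps_X * fps_deriv E) z)) (at z)"
      by (rule has_field_derivative_qexp[OF E z])
    moreover have der: "((\<lambda>z. exp (qexp L z)) has_field_derivative (exp (qexp L z) * (2 * pi * \<i> * qexp (fps_X * fps_deriv L) z))) (at z)"
      by (rule DERIV_chain2[where f = exp and g = "qexp L", OF DERIV_exp has_field_derivative_qexp[OF L z]])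
    have ev': "\<forall>\<^sub>F u in nhds z. exp (qexp L u) = qexp E u"
      using eventually_upper_half_plane[OF z] by (rule eventually_mono) (simp add: qE)
    have "(qexp E has_field_derivative (exp (qexp L z) * (2 * pi * \<i> * qexp (fps_X * fps_deriv L) z))) (at z)"
      by (rule DERIV_cong_ev[OF refl ev' refl, THEN iffD1, OF der])
    ultimately have "2 * pi * \<i> * qexp (fps_X * fps_deriv E) z = exp (qexp L z) * (2 * pi * \<i> * qexp (fps_X * fps_deriv L) z)"
      by (rule DERIV_unique)
    then have "qexp (fps_X * fps_deriv E) z = qexp (fps_X * fps_deriv L) z * qexp E z"
      by (simp add: qE[OF z])
    moreover have "qexp (fps_X * fps_deriv E - (fps_X * fps_deriv L) * E) z =
        qexp (fps_X * fps_deriv E) z - qexp (fps_X * fps_deriv L) z * qexp E z"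
      by (subst qexp_ring(2), (intro unit_radius_intros E L z)+, subst qexp_ring(3), (intro unit_radius_intros E L z)+) simp
    ultimately show "qexp (fps_X * fps_deriv E - (fps_X * fps_deriv L) * E) z = 0" by simp
  qed
  then show ?thesis using that[OF E qE E0] by (simp add: log_deriv_def)
qed

text \<open>Integer powers of \<open>\<eta>\<close> are multiples of its logarithm, so a quotient is
  a single exponential and no series has to be divided.\<close>

lemma eta_quotient_log:
  assumes l: "\<forall>(d, r)\<in>set l. d > 0"
  obtains L where "unit_radius L" "fps_nth L 0 = 0"
    "\<And>m. fps_nth (fps_X * fps_deriv L) m = of_int (eta_log_deriv_coeff l m)"
    "\<And>z. Im z > 0 \<Longrightarrow> eta_quotient l z = exp (pi * \<i> * z / 12 * of_int (\<Sum>(d, r)\<leftarrow>l. int d * r) + qexp L z)"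
proof -
  have "\<exists>L. unit_radius L \<and> fps_nth L 0 = 0 \<and>
    (\<forall>m. fps_nth (fps_X * fps_deriv L) m = of_int (eta_log_deriv_coeff l m)) \<and>
    (\<forall>z. Im z > 0 \<longrightarrow> eta_quotient l z = exp (pi * \<i> * z / 12 * of_int (\<Sum>(d, r)\<leftarrow>l. int d * r) + qexp L z))"
    using l
  proof (induction l)
    case Nil
    have "unit_radius (0 :: complex fps)" "qexp 0 z = 0" for z
      by (simp_all add: unit_radius_def qexp_def)
    then show ?case
      by (intro exI[of _ 0]) (auto simp: eta_quotient_def eta_log_deriv_coeff_def)
  next
    case (Cons x l)
    obtain d r where x: "x = (d, r)" by (cases x)
    from Cons x have d: "d > 0" by auto
    from Cons obtain L where L: "unit_radius L" "fps_nth L 0 = 0"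
      "\<And>m. fps_nth (fps_X * fps_deriv L) m = of_int (eta_log_deriv_coeff l m)"
      "\<And>z. Im z > 0 \<Longrightarrow> eta_quotient l z = exp (pi * \<i> * z / 12 * of_int (\<Sum>(d, r)\<leftarrow>l. int d * r) + qexp L z)"
      by auto
    define M where "M = fps_const (of_int r) * dilate d eta_log_fps"
    have M: "unit_radius M" unfolding M_def by (intro unit_radius_intros d)
    have M0: "fps_nth M 0 = 0" by (simp add: M_def dilate_def eta_log_fps_def)
    have Mm: "fps_nth (fps_X * fps_deriv M) m = of_int (if d dvd m then - r * int d * int (sigma_nat 1 (m div d)) else 0)" for m
    proof -
      have "fps_nth (fps_X * fps_deriv M) m = of_nat m * fps_nth M m" by (cases m) simp_all
      also have "\<dots> = of_int (if d dvd m then - r * int d * int (sigma_nat 1 (m div d)) else 0)"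
        using d by (auto simp: M_def dilate_def eta_log_fps_def field_simps elim!: dvdE)
      finally show ?thesis .
    qed
    have qM: "eta (of_nat d * z) powi r = exp (pi * \<i> * z / 12 * of_int (int d * r) + qexp M z)" if z: "Im z > 0" for z
    proof -
      have "qexp M z = of_int r * qexp eta_log_fps (of_nat d * z)"
        unfolding M_def using z d by (simp add: qexp_ring qexp_dilate unit_radius_intros)
      then show ?thesis
        by (simp add: eta_def exp_power_int algebra_simps)
    qed
    show ?case
    proof (intro exI[of _ "M + L"] conjI allI impI)
      show "unit_radius (M + L)" by (intro unit_radius_intros M L)
      show "fps_nth (M + L) 0 = 0" using M0 L by simp
      show "fps_nth (fps_X * fps_deriv (M + L)) m = of_int (eta_log_deriv_coeff (x # l) m)" for m
        using Mm[of m] L(3)[of m] by (simp add: distrib_left x eta_log_deriv_coeff_def)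
      show "eta_quotient (x # l) z = exp (pi * \<i> * z / 12 * of_int (\<Sum>(d, r)\<leftarrow>x # l. int d * r) + qexp (M + L) z)"
        if z: "Im z > 0" for z
      proof -
        have eq: "eta_quotient (x # l) z = eta (of_nat d * z) powi r * eta_quotient l z"
          by (simp add: eta_quotient_def x)
        have e: "(\<Sum>(d, r)\<leftarrow>x # l. int d * r) = int d * r + (\<Sum>(d, r)\<leftarrow>l. int d * r)"
          by (simp add: x)
        show ?thesis
          unfolding eq qM[OF z] L(4)[OF z] exp_add[symmetric] qexp_ring(1)[OF M L(1) z] e of_int_add
          by (simp only: ring_distribs add_ac)
      qed
    qed
  qed
  then show ?thesis using that by blast
qed

text \<open>The analytic quotient meets the truncated formal products here. \<open>E\<close> is
  independent of \<open>n\<close>, and for each \<open>n\<close> its own truncation \<open>G\<close>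
  is compared with it: both start with \<open>1\<close> and satisfy the same recurrence up to
  \<open>n\<close>.\<close>

theorem eta_quotient_expansion:
  assumes l: "\<forall>(d, r)\<in>set l. d > 0" and s: "(\<Sum>(d, r)\<leftarrow>l. int d * r) = 24 * int s"
  obtains E where "unit_radius E" "\<And>z. Im z > 0 \<Longrightarrow> eta_quotient l z = qexp (fps_X ^ s * E) z"
    "\<And>n. fps_nth (fps_X ^ s * E) n = of_rat (eta_coeff l n)"
    "fps_nth E 0 = 1"
    "\<And>m. of_nat m * fps_nth E m = (\<Sum>k\<le>m. of_int (eta_log_deriv_coeff l k) * fps_nth E (m - k))"
proof -
  obtain L where L: "unit_radius L" "fps_nth L 0 = 0"
    "\<And>m. fps_nth (fps_X * fps_deriv L) m = of_int (eta_log_deriv_coeff l m)"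
    "\<And>z. Im z > 0 \<Longrightarrow> eta_quotient l z = exp (pi * \<i> * z / 12 * of_int (\<Sum>(d, r)\<leftarrow>l. int d * r) + qexp L z)"
    by (rule eta_quotient_log[OF l], rule that)
  obtain E where E: "unit_radius E" "\<And>z. Im z > 0 \<Longrightarrow> qexp E z = exp (qexp L z)"
    "fps_nth E 0 = exp (fps_nth L 0)" "log_deriv E (fps_X * fps_deriv L)"
    by (rule exp_qexp[OF L(1)], rule that)
  have rec: "of_nat m * fps_nth E m = (\<Sum>k\<le>m. of_int (eta_log_deriv_coeff l k) * fps_nth E (m - k))" for m
    unfolding log_deriv_recurrence[OF E(4)] L(3) ..
  show ?thesis
  proof (rule that[OF E(1) _ _ _ rec])
    show "eta_quotient l z = qexp (fps_X ^ s * E) z" if z: "Im z > 0" for z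
    proof -
      have "exp (pi * \<i> * z / 12 * of_int (24 * int s)) = nome z ^ s"
        unfolding nome_def exp_of_nat_mult[symmetric] by (intro arg_cong[where f = exp]) simp
      then have "eta_quotient l z = nome z ^ s * qexp E z"
        unfolding L(4)[OF z] s exp_add E(2)[OF z] by simp
      moreover have "qexp (fps_X ^ s * E) z = nome z ^ s * qexp E z"
        using z E(1) by (simp add: qexp_ring qexp_power unit_radius_intros unit_radius_const)
      ultimately show ?thesis by simp
    qed
    show "fps_nth (fps_X ^ s * E) n = of_rat (eta_coeff l n)" for n
    proof (cases "s \<le> n")
      case True
      define G where "G = prod_list (map (\<lambda>(d, r). eta_factor d r n) l)"
      obtain H where H: "log_deriv G H" "fps_nth G 0 = 1" "\<And>m. m \<le> n \<Longrightarrow> fps_nth H m = of_int (eta_log_deriv_coeff l m)"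
        using eta_product_log_deriv[OF l, of n] unfolding G_def by blast
      have "of_rat (fps_nth G m) = fps_nth E m" if "m \<le> n" for m
      proof (rule recurrence_unique[where n = n])
        show "of_nat m * of_rat (fps_nth G m) = (\<Sum>k\<le>m. of_rat (fps_nth H k) * of_rat (fps_nth G (m - k)) :: complex)" for m
          using arg_cong[OF log_deriv_recurrence[OF H(1), of m], of "of_rat :: rat \<Rightarrow> complex"]
          by (simp add: of_rat_mult of_rat_sum)
        show "of_rat (fps_nth H k) = (of_int (eta_log_deriv_coeff l k) :: complex)" if "k \<le> n" for k
          using H(3)[OF that] by simp
        have "eta_log_deriv_coeff l 0 = 0" by (induction l) (auto simp: eta_log_deriv_coeff_def)
        then show "of_rat (fps_nth H 0) = (0 :: complex)" using H(3)[of 0] by simp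
      qed (use rec that H(2) E(3) L(2) in auto)
      then have "of_rat (fps_nth G (n - s)) = fps_nth E (n - s)" by simp
      moreover have "eta_coeff l n = fps_nth G (n - s)"
        using True s unfolding eta_coeff_def Let_def G_def by (simp add: nat_diff_distrib)
      ultimately show ?thesis using True by (simp add: fps_X_power_mult_nth)
    next
      case False
      then show ?thesis using s by (simp add: eta_coeff_def Let_def fps_X_power_mult_nth)
    qed
    show "fps_nth E 0 = 1" using E(3) L(2) by simp
  qed
qed

section \<open>The first 29 coefficients\<close>

definition sigma_1_table :: "int list" where
  "sigma_1_table = [0, 1, 3, 4, 7, 6, 12, 8, 15, 13, 18, 12, 28, 14, 24, 24, 31, 18, 39, 20, 42, 32, 36, 24, 60,
     31, 42, 40, 56]"

definition sigma_3_table :: "int list" where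
  "sigma_3_table = [0, 1, 9, 28, 73, 126, 252, 344, 585, 757, 1134, 1332, 2044, 2198, 3096, 3528, 4681, 4914,
     6813, 6860, 9198, 9632, 11988, 12168, 16380, 15751, 19782, 20440, 25112]"

text \<open>These tables give the coefficients of the \<open>C_i\<close> up to \<open>q^28\<close>.
  They are certificates, verified through the recurrence in \<open>eta_table_check\<close> and not
  by multiplying out products.\<close>

definition C1_table :: "int list" where
  "C1_table = [0, 1, - 1, - 6, 5, 10, - 4, 5, - 14, - 25, 15, 9, 21, 0, - 3, 38, - 29, - 30, - 51, - 33, 20,
     86, 96, - 92, 28, - 23, 0, 12, - 162]"

definition C2_table :: "int list" where
  "C2_table = [0, 0, 1, - 3, - 3, 14, 0, - 15, - 2, - 15, 21, 25, 9, 0, - 69, 20, 3, - 43, 31, 33, 64, 2, 24,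
     - 90, - 88, - 3, 0, 69, - 86]"

definition C3_table :: "int list" where
  "C3_table = [0, 0, 0, 1, - 1, - 4, 3, 3, 1, 5, - 7, - 5, - 3, 0, 5, - 8, 9, 13, 11, - 9, - 13, - 8, - 22,
     30, 1, 1, 0, - 11, 33]"

definition C4_table :: "int list" where
  "C4_table = [0, 0, 0, 0, 1, - 3, - 1, 8, - 1, - 2, - 7, - 5, 7, 0, 17, - 3, - 9, 4, - 5, - 13, - 15, 17, 2,
     18, 7, 6, 0, - 30, 11]"

definition C5_table :: "int list" where
  "C5_table = [0, 0, 0, 0, 0, 1, - 1, - 2, 1, 0, 2, 1, 0, 0, - 2, 1, - 2, - 2, - 3, 5, 5, - 3, 2, - 6, - 1,
     0, 1, 6, - 3]"

definition C7_table :: "int list" where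
  "C7_table = [0, 0, 0, 0, 1, 1, - 1, 0, - 1, - 2, 1, - 1, - 1, 0, 1, 1, - 1, - 4, - 5, 7, 1, 5, 10, - 6, 7,
     6, 0, - 6, - 5]"

definition C8_table :: "int list" where
  "C8_table = [0, 0, 1, 1, - 3, - 2, 0, - 3, 6, 5, - 3, 5, 1, 0, - 5, - 12, - 5, 9, 15, - 3, 8, - 30, - 16,
     30, - 32, 1, 0, 25, 50]"

definition C9_table :: "int list" where
  "C9_table = [0, 0, 0, 0, 0, 0, 1, - 7, 17, - 14, 2, - 21, 36, 13, - 26, - 24, 10, 12, - 17, 37, 1, 70, -
     138, - 4, - 49, 146, 39, - 66, - 95]"


lemma int_sigma_nat:
  "int (sigma_nat k n) = sum_list (map (\<lambda>d. int d ^ k) (filter (\<lambda>d. d dvd n) [1..<Suc n]))"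
proof -
  have "{d \<in> {1..n}. d dvd n} = set (filter (\<lambda>d. d dvd n) [1..<Suc n])" by auto
  then show ?thesis
    unfolding sigma_nat_def by (subst sum_list_distinct_conv_sum_set) (auto simp del: upt_Suc)
qed

lemma sigma_tables:
  assumes "n < 29"
  shows "int (sigma_nat 1 n) = sigma_1_table ! n" "int (sigma_nat 3 n) = sigma_3_table ! n"
proof -
  have "\<forall>n\<in>set [0..<29]. sum_list (map (\<lambda>d. int d ^ 1) (filter (\<lambda>d. d dvd n) [1..<Suc n])) = sigma_1_table ! n \<and>
      sum_list (map (\<lambda>d. int d ^ 3) (filter (\<lambda>d. d dvd n) [1..<Suc n])) = sigma_3_table ! n"
    by code_simp
  then show "int (sigma_nat 1 n) = sigma_1_table ! n" "int (sigma_nat 3 n) = sigma_3_table ! n"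
    using assms unfolding int_sigma_nat by simp_all
qed

definition log_deriv_table :: "(nat \<times> int) list \<Rightarrow> int list" where
  "log_deriv_table l = map (\<lambda>m. \<Sum>(d, r)\<leftarrow>l. if d dvd m then - r * int d * sigma_1_table ! (m div d) else 0) [0..<29]"

lemma log_deriv_table:
  assumes "m < 29"
  shows "eta_log_deriv_coeff l m = log_deriv_table l ! m"
proof -
  have "int (sigma_nat 1 (m div d)) = sigma_1_table ! (m div d)" for d
    using assms div_le_dividend[of m d] by (intro sigma_tables) linarith
  then show ?thesis
    using assms unfolding eta_log_deriv_coeff_def log_deriv_table_def by (simp cong: if_cong)
qed

text \<open>Leading zeros, the initial coefficient \<open>1\<close> and the recurrence together
  determine the table. The range \<open>29 - s\<close> reflects the shift by
  \<open>q^s\<close>.\<close>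

definition eta_table_check :: "(nat \<times> int) list \<Rightarrow> nat \<Rightarrow> int list \<Rightarrow> bool" where
  "eta_table_check l s xs \<longleftrightarrow> length xs = 29 \<and> (\<forall>n\<in>set [0..<s]. xs ! n = 0) \<and> xs ! s = 1 \<and>
     (let hs = log_deriv_table l in \<forall>m\<in>set [0..<29 - s]. int m * xs ! (s + m) =
        sum_list (map (\<lambda>k. hs ! k * xs ! (s + (m - k))) [0..<Suc m]))"

lemma eta_table:
  assumes l: "\<forall>(d, r)\<in>set l. d > 0" and s: "(\<Sum>(d, r)\<leftarrow>l. int d * r) = 24 * int s"
    and check: "eta_table_check l s xs" and n: "n < 29"
  shows "eta_coeff l n = of_int (xs ! n)"
proof -
  obtain E :: "complex fps" where E: "\<And>n. fps_nth (fps_X ^ s * E) n = of_rat (eta_coeff l n)" "fps_nth E 0 = 1"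
    "\<And>m. of_nat m * fps_nth E m = (\<Sum>k\<le>m. of_int (eta_log_deriv_coeff l k) * fps_nth E (m - k))"
    by (rule eta_quotient_expansion[OF l s], rule that)
  have "of_rat (eta_coeff l n) = (of_int (xs ! n) :: complex)"
  proof (cases "s \<le> n")
    case False
    then show ?thesis using check E(1)[of n] by (simp add: eta_table_check_def fps_X_power_mult_nth)
  next
    case True
    have "fps_nth E (n - s) = of_int (xs ! (s + (n - s)))"
    proof (rule recurrence_unique[where n = "28 - s" and b = "\<lambda>m. of_int (xs ! (s + m))"
           and h' = "\<lambda>k. of_int (eta_log_deriv_coeff l k)"])
      show "of_nat m * of_int (xs ! (s + m)) =
          (\<Sum>k\<le>m. of_int (eta_log_deriv_coeff l k) * (of_int (xs ! (s + (m - k))) :: complex))" if "m \<le> 28 - s" for m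
      proof -
        have m: "m < 29 - s" using that True n by linarith
        have "int m * xs ! (s + m) = sum_list (map (\<lambda>k. log_deriv_table l ! k * xs ! (s + (m - k))) [0..<Suc m])"
          using check m unfolding eta_table_check_def Let_def by simp
        also have "\<dots> = (\<Sum>k\<le>m. log_deriv_table l ! k * xs ! (s + (m - k)))"
          by (subst sum_list_distinct_conv_sum_set)
            (simp_all add: atLeast0LessThan lessThan_Suc_atMost del: upt_Suc sum.lessThan_Suc)
        also have "\<dots> = (\<Sum>k\<le>m. eta_log_deriv_coeff l k * xs ! (s + (m - k)))"
          using m by (intro sum.cong refl) (simp add: log_deriv_table)
        finally have "of_int (int m * xs ! (s + m)) =
          (of_int (\<Sum>k\<le>m. eta_log_deriv_coeff l k * xs ! (s + (m - k))) :: complex)" by (simp only:)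
        then show ?thesis by simp
      qed
      have "eta_log_deriv_coeff l 0 = 0" by (induction l) (auto simp: eta_log_deriv_coeff_def)
      then show "(of_int (eta_log_deriv_coeff l 0) :: complex) = 0" by simp
    qed (use E(3) n True E(2) check in \<open>auto simp: eta_table_check_def\<close>)
    then show ?thesis using True E(1)[of n] by (simp add: fps_X_power_mult_nth)
  qed
  then have "of_rat (eta_coeff l n) = (of_rat (of_int (xs ! n)) :: complex)" by simp
  then show ?thesis by (simp only: of_rat_eq_iff)
qed

lemma c_tables:
  assumes "n < 29"
  shows "c1 n = of_int (C1_table ! n)"
    "c2 n = of_int (C2_table ! n)"
    "c3 n = of_int (C3_table ! n)"
    "c4 n = of_int (C4_table ! n)"
    "c5 n = of_int (C5_table ! n)"
    "c7 n = of_int (C7_table ! n)"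
    "c8 n = of_int (C8_table ! n)"
    "c9 n = of_int (C9_table ! n)"
proof -
  have "eta_table_check [(1, 1), (2, 5), (13, 3), (26, -1)] 1 C1_table" by code_simp
  then show "c1 n = of_int (C1_table ! n)"
    unfolding c1_def by (intro eta_table[OF _ _ _ assms]) auto
  have "eta_table_check [(1, 3), (2, 3), (13, 1), (26, 1)] 2 C2_table" by code_simp
  then show "c2 n = of_int (C2_table ! n)"
    unfolding c2_def by (intro eta_table[OF _ _ _ assms]) auto
  have "eta_table_check [(1, 1), (2, 3), (13, 3), (26, 1)] 3 C3_table" by code_simp
  then show "c3 n = of_int (C3_table ! n)"
    unfolding c3_def by (intro eta_table[OF _ _ _ assms]) auto
  have "eta_table_check [(1, 3), (2, 1), (13, 1), (26, 3)] 4 C4_table" by code_simp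
  then show "c4 n = of_int (C4_table ! n)"
    unfolding c4_def by (intro eta_table[OF _ _ _ assms]) auto
  have "eta_table_check [(1, 1), (2, 1), (13, 3), (26, 3)] 5 C5_table" by code_simp
  then show "c5 n = of_int (C5_table ! n)"
    unfolding c5_def by (intro eta_table[OF _ _ _ assms]) auto
  have "eta_table_check [(1, -1), (2, 3), (13, 5), (26, 1)] 4 C7_table" by code_simp
  then show "c7 n = of_int (C7_table ! n)"
    unfolding c7_def by (intro eta_table[OF _ _ _ assms]) auto
  have "eta_table_check [(1, -1), (2, 5), (13, 5), (26, -1)] 2 C8_table" by code_simp
  then show "c8 n = of_int (C8_table ! n)"
    unfolding c8_def by (intro eta_table[OF _ _ _ assms]) auto
  have "eta_table_check [(1, 7), (2, -3), (13, -3), (26, 7)] 6 C9_table" by code_simp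
  then show "c9 n = of_int (C9_table ! n)"
    unfolding c9_def by (intro eta_table[OF _ _ _ assms]) auto
qed


section \<open>The identity below \<open>q^29\<close>\<close>

definition dilated_table :: "nat \<Rightarrow> int list \<Rightarrow> nat \<Rightarrow> int" where
  "dilated_table d t n = (if d dvd n then t ! (n div d) else 0)"

text \<open>Multiplication by \<open>26520 = 8 * 3 * 5 * 13 * 17\<close>, a common denominator of
  all coefficients of the claim, leaves a computation with integers.\<close>

lemma identity_below_29:
  "\<forall>n\<in>set [0..<29]. 26520 * sum_list (map (\<lambda>i. dilated_table 2 sigma_1_table i * dilated_table 13 sigma_1_table (n - i)) [0..<Suc n]) =
     13 * dilated_table 1 sigma_3_table n + 52 * dilated_table 2 sigma_3_table n
     + 2197 * dilated_table 13 sigma_3_table n + 8788 * dilated_table 26 sigma_3_table n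
     + (1105 - 510 * int n) * dilated_table 2 sigma_1_table n
     + (1105 - 3315 * int n) * dilated_table 13 sigma_1_table n
     - 13 * C1_table ! n - 635 * C2_table ! n - 2715 * C3_table ! n - 1894 * C4_table ! n
     - 8255 * C5_table ! n - 169 * C7_table ! n + 368 * C8_table ! n + 863 * C9_table ! n"
  by code_simp

section \<open>The identity\<close>

lemma sigmaQ_of_nat_div:
  assumes "d > 0"
  shows "sigmaQ k (of_nat n / of_nat d) = (if d dvd n then of_nat (sigma_nat k (n div d)) else 0)"
proof (cases "d dvd n")
  case True
  then obtain m where "n = d * m" by (elim dvdE)
  then show ?thesis using assms by (auto simp: sigmaQ_def)
next
  case False
  have "(of_nat n / of_nat d :: rat) \<notin> \<nat>"
  proof
    assume "(of_nat n / of_nat d :: rat) \<in> \<nat>"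
    then obtain m where "(of_nat n / of_nat d :: rat) = of_nat m" by (auto elim: Nats_cases)
    then have "(of_nat n :: rat) = of_nat (m * d)" using assms by (simp add: field_simps)
    then have "n = m * d" by (simp only: of_nat_eq_iff)
    with False show False by simp
  qed
  then show ?thesis using False by (simp add: sigmaQ_def)
qed

lemma sigmaQ_simps:
  "sigmaQ k (of_nat n) = of_nat (sigma_nat k n)"
  "sigmaQ k (of_nat n / 2) = (if 2 dvd n then of_nat (sigma_nat k (n div 2)) else 0)"
  "sigmaQ k (of_nat n / 13) = (if 13 dvd n then of_nat (sigma_nat k (n div 13)) else 0)"
  "sigmaQ k (of_nat n / 26) = (if 26 dvd n then of_nat (sigma_nat k (n div 26)) else 0)"
  using sigmaQ_of_nat_div[of 1 k n] sigmaQ_of_nat_div[of 2 k n] sigmaQ_of_nat_div[of 13 k n]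
    sigmaQ_of_nat_div[of 26 k n] by simp_all

lemma W_eq_convolution:
  assumes "a > 0" "b > 0"
  shows "W a b n = (\<Sum>i\<le>n. (if a dvd i then sigma_nat 1 (i div a) else 0) *
     (if b dvd n - i then sigma_nat 1 ((n - i) div b) else 0))"
proof -
  have "W a b n = (\<Sum>i\<in>{i\<in>{..n}. a dvd i \<and> b dvd n - i}. sigma_nat 1 (i div a) * sigma_nat 1 ((n - i) div b))"
    unfolding W_def
  proof (rule sum.reindex_bij_witness[where i = "\<lambda>i. (i div a, (n - i) div b)" and j = "\<lambda>(l, m). a * l"], goal_cases)
    case (4 i)
    then show ?case using assms by (auto intro: order_trans[OF div_le_dividend])
  qed (use assms in auto)
  also have "\<dots> = (\<Sum>i\<le>n. (if a dvd i then sigma_nat 1 (i div a) else 0) *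
     (if b dvd n - i then sigma_nat 1 ((n - i) div b) else 0))"
    by (subst sum.inter_filter) (auto intro!: sum.cong)
  finally show ?thesis .
qed

section \<open>Generating functions of the two sides\<close>

definition divisor_sums :: "nat \<Rightarrow> rat" where
  "divisor_sums n = 1/2040 * sigmaQ 3 (of_nat n) + 1/510 * sigmaQ 3 (of_nat n / 2)
    + 169/2040 * sigmaQ 3 (of_nat n / 13) + 169/510 * sigmaQ 3 (of_nat n / 26)
    + (1/24 - of_nat n / 52) * sigmaQ 1 (of_nat n / 2)
    + (1/24 - of_nat n / 8) * sigmaQ 1 (of_nat n / 13)"

definition eta_quotient_sums :: "nat \<Rightarrow> rat" where
  "eta_quotient_sums n = - (1/2040) * c1 n - 127/5304 * c2 n - 181/1768 * c3 n - 947/13260 * c4 n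
    - 127/408 * c5 n - 13/2040 * c7 n + 46/3315 * c8 n + 863/26520 * c9 n"

text \<open>The constants \<open>1/26\<close> and \<open>13/8\<close> produce \<open>n / 52\<close>
  and \<open>n / 8\<close>, because \<open>q d/dq\<close> inside a dilation by \<open>d\<close>
  contributes \<open>n / d\<close>.\<close>

definition eisenstein_fps :: "complex fps" where
  "eisenstein_fps = dilate 2 (sigma_fps 1) * dilate 13 (sigma_fps 1)
     - fps_const (1/2040) * sigma_fps 3 - fps_const (1/510) * dilate 2 (sigma_fps 3)
     - fps_const (169/2040) * dilate 13 (sigma_fps 3) - fps_const (169/510) * dilate 26 (sigma_fps 3)
     - fps_const (1/24) * dilate 2 (sigma_fps 1) + fps_const (1/26) * dilate 2 (fps_X * fps_deriv (sigma_fps 1))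
     - fps_const (1/24) * dilate 13 (sigma_fps 1) + fps_const (13/8) * dilate 13 (fps_X * fps_deriv (sigma_fps 1))"

lemma eisenstein_fps_nth: "fps_nth eisenstein_fps n = of_rat (of_nat (W 2 13 n) - divisor_sums n)"
proof -
  let ?s = "\<lambda>k d. (if d dvd n then of_nat (sigma_nat k (n div d)) else 0) :: complex"
  have W: "fps_nth (dilate 2 (sigma_fps 1) * dilate 13 (sigma_fps 1)) n = of_nat (W 2 13 n)"
    unfolding W_eq_convolution[of 2 13 n, simplified] fps_mult_nth atLeast0AtMost of_nat_sum
    by (intro sum.cong refl) (simp add: dilate_def sigma_fps_def)
  have \<theta>: "fps_nth (dilate d (fps_X * fps_deriv (sigma_fps 1))) n = of_nat (n div d) * ?s 1 d" for d
    by (simp add: dilate_def theta_nth sigma_fps_def)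
  have q: "of_rat (if P then of_nat x else 0) = (if P then of_nat x else (0 :: complex))" for P x by simp
  have "fps_nth eisenstein_fps n = of_nat (W 2 13 n) - 1/2040 * of_nat (sigma_nat 3 n) - 1/510 * ?s 3 2 - 169/2040 * ?s 3 13
      - 169/510 * ?s 3 26 - 1/24 * ?s 1 2 + 1/26 * (of_nat (n div 2) * ?s 1 2)
      - 1/24 * ?s 1 13 + 13/8 * (of_nat (n div 13) * ?s 1 13)"
    unfolding eisenstein_fps_def fps_sub_nth fps_add_nth fps_mult_left_const_nth W \<theta>
    by (simp add: dilate_def sigma_fps_def)
  also have "1/26 * (of_nat (n div 2) * ?s 1 2) = of_nat n / 52 * ?s 1 2" by (auto elim!: dvdE)
  also have "13/8 * (of_nat (n div 13) * ?s 1 13) = of_nat n / 8 * ?s 1 13" by (auto elim!: dvdE)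
  also have "of_nat (W 2 13 n) - 1/2040 * of_nat (sigma_nat 3 n) - 1/510 * ?s 3 2 - 169/2040 * ?s 3 13
      - 169/510 * ?s 3 26 - 1/24 * ?s 1 2 + of_nat n / 52 * ?s 1 2
      - 1/24 * ?s 1 13 + of_nat n / 8 * ?s 1 13 = of_rat (of_nat (W 2 13 n) - divisor_sums n)"
    unfolding divisor_sums_def sigmaQ_simps
    by (simp only: of_rat_diff of_rat_add of_rat_mult of_rat_divide q of_rat_of_nat_eq of_rat_numeral_eq of_rat_1)
       (simp only: ring_distribs, simp)
  finally show ?thesis .
qed

lemma unit_radius_eisenstein_fps: "unit_radius eisenstein_fps"
  unfolding eisenstein_fps_def by (intro unit_radius_intros) auto

text \<open>The summands with \<open>1/24\<close> remove the terms linear in \<open>P\<close>,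
  leaving \<open>(P(2z) P(13z) - 1) / 576\<close>. The constant cancels because
  \<open>(1 + 4 + 169 + 676) / 489600 = 1 / 576\<close>, and the derivative terms, rewritten by
  Ramanujan's relation, complete the product to the square in
  \<open>eisenstein_part\<close>.\<close>

lemma qexp_eisenstein_fps:
  assumes z: "Im z > 0"
  shows "qexp eisenstein_fps z = eisenstein_part z"
proof -
  define s where "s = (\<lambda>N :: nat. qexp (sigma_fps 1) (of_nat N * z))"
  define t where "t = (\<lambda>N :: nat. qexp (sigma_fps 3) (of_nat N * z))"
  define \<theta> where "\<theta> = (\<lambda>N :: nat. qexp (fps_X * fps_deriv (sigma_fps 1)) (of_nat N * z))"
  have P: "P_at N z = 1 - 24 * s N" if "N > 0" for N
    unfolding P_at_def P_fps_def s_def using z that by (simp add: qexp_ring unit_radius_intros)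
  have Q: "Q_at N z = 1 + 240 * t N" if "N > 0" for N
    unfolding Q_at_def Q_fps_def t_def using z that by (simp add: qexp_ring unit_radius_intros)
  have R: "Q_at N z = P_at N z ^ 2 + 288 * \<theta> N" if "N > 0" for N
  proof -
    have Nz: "Im (of_nat N * z) > 0" using z that by simp
    have "fps_X * fps_deriv P_fps = fps_const (- 24) * (fps_X * fps_deriv (sigma_fps 1))"
      by (simp add: P_fps_def fps_eq_iff theta_nth del: fps_const_neg)
    then have "qexp (fps_X * fps_deriv P_fps) (of_nat N * z) = - 24 * \<theta> N"
      using Nz unfolding \<theta>_def by (simp only: qexp_ring(3)[OF unit_radius_const(1) unit_radius_mult[OF unit_radius_const(3) unit_radius_deriv[OF unit_radius_sigma_fps]] Nz] qexp_const)
    then show ?thesis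
      unfolding Q_at_def P_at_def qexp_Q_eq[OF Nz] by simp
  qed
  have D: "qexp (dilate N (sigma_fps 1)) z = s N" "qexp (dilate N (sigma_fps 3)) z = t N"
    "qexp (dilate N (fps_X * fps_deriv (sigma_fps 1))) z = \<theta> N" if "N > 0" for N
    using z that by (simp_all add: qexp_dilate unit_radius_intros s_def t_def \<theta>_def)
  have t1: "qexp (sigma_fps 3) z = t 1" by (simp add: t_def)
  have "qexp eisenstein_fps z = s 2 * s 13 - 1/2040 * t 1 - 1/510 * t 2 - 169/2040 * t 13 - 169/510 * t 26
     - 1/24 * s 2 + 1/26 * \<theta> 2 - 1/24 * s 13 + 13/8 * \<theta> 13"
    unfolding eisenstein_fps_def using z D[of 2] D[of 13] D[of 26] t1
    by (simp add: qexp_ring unit_radius_intros)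
  moreover have "s N = (1 - P_at N z) / 24" "t N = (Q_at N z - 1) / 240" "\<theta> N = (Q_at N z - P_at N z ^ 2) / 288"
    if "N > 0" for N
  proof -
    show "s N = (1 - P_at N z) / 24" using P[OF that] by simp
    show "t N = (Q_at N z - 1) / 240" using Q[OF that] by simp
    show "\<theta> N = (Q_at N z - P_at N z ^ 2) / 288" unfolding R[OF that] by simp
  qed
  ultimately have "qexp eisenstein_fps z = (1 - P_at 2 z) / 24 * ((1 - P_at 13 z) / 24)
     - 1/2040 * ((Q_at 1 z - 1) / 240) - 1/510 * ((Q_at 2 z - 1) / 240) - 169/2040 * ((Q_at 13 z - 1) / 240)
     - 169/510 * ((Q_at 26 z - 1) / 240) - 1/24 * ((1 - P_at 2 z) / 24) + 1/26 * ((Q_at 2 z - P_at 2 z ^ 2) / 288)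
     - 1/24 * ((1 - P_at 13 z) / 24) + 13/8 * ((Q_at 13 z - P_at 13 z ^ 2) / 288)"
    by simp
  also have "\<dots> = eisenstein_part z"
    unfolding eisenstein_part_def by (simp add: field_simps power2_eq_square)
  finally show ?thesis .
qed

lemma cusp_expansion:
  obtains F where "unit_radius F" "\<And>z. Im z > 0 \<Longrightarrow> qexp F z = cusp_part z"
    "\<And>n. fps_nth F n = of_rat (eta_quotient_sums n)"
proof -
  have ex: "\<exists>F. unit_radius F \<and> (\<forall>z. Im z > 0 \<longrightarrow> qexp F z = eta_quotient l z) \<and> (\<forall>n. fps_nth F n = of_rat (eta_coeff l n))"
    if l: "\<forall>(d, r)\<in>set l. d > 0" "(\<Sum>(d, r)\<leftarrow>l. int d * r) = 24 * int s" for l s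
  proof -
    obtain E where "unit_radius E" "\<And>z. Im z > 0 \<Longrightarrow> eta_quotient l z = qexp (fps_X ^ s * E) z"
      "\<And>n. fps_nth (fps_X ^ s * E) n = of_rat (eta_coeff l n)"
      by (rule eta_quotient_expansion[OF l], rule that)
    then show ?thesis by (intro exI[of _ "fps_X ^ s * E"]) (auto intro!: unit_radius_intros unit_radius_const)
  qed
  obtain F1 where F1: "unit_radius F1" "\<And>z. Im z > 0 \<Longrightarrow> qexp F1 z = eta_quotient [(1, 1), (2, 5), (13, 3), (26, -1)] z" "\<And>n. fps_nth F1 n = of_rat (c1 n)"
    using ex[of "[(1, 1), (2, 5), (13, 3), (26, -1)]" 1] unfolding c1_def by auto
  obtain F2 where F2: "unit_radius F2" "\<And>z. Im z > 0 \<Longrightarrow> qexp F2 z = eta_quotient [(1, 3), (2, 3), (13, 1), (26, 1)] z" "\<And>n. fps_nth F2 n = of_rat (c2 n)"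
    using ex[of "[(1, 3), (2, 3), (13, 1), (26, 1)]" 2] unfolding c2_def by auto
  obtain F3 where F3: "unit_radius F3" "\<And>z. Im z > 0 \<Longrightarrow> qexp F3 z = eta_quotient [(1, 1), (2, 3), (13, 3), (26, 1)] z" "\<And>n. fps_nth F3 n = of_rat (c3 n)"
    using ex[of "[(1, 1), (2, 3), (13, 3), (26, 1)]" 3] unfolding c3_def by auto
  obtain F4 where F4: "unit_radius F4" "\<And>z. Im z > 0 \<Longrightarrow> qexp F4 z = eta_quotient [(1, 3), (2, 1), (13, 1), (26, 3)] z" "\<And>n. fps_nth F4 n = of_rat (c4 n)"
    using ex[of "[(1, 3), (2, 1), (13, 1), (26, 3)]" 4] unfolding c4_def by auto
  obtain F5 where F5: "unit_radius F5" "\<And>z. Im z > 0 \<Longrightarrow> qexp F5 z = eta_quotient [(1, 1), (2, 1), (13, 3), (26, 3)] z" "\<And>n. fps_nth F5 n = of_rat (c5 n)"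
    using ex[of "[(1, 1), (2, 1), (13, 3), (26, 3)]" 5] unfolding c5_def by auto
  obtain F7 where F7: "unit_radius F7" "\<And>z. Im z > 0 \<Longrightarrow> qexp F7 z = eta_quotient [(1, -1), (2, 3), (13, 5), (26, 1)] z" "\<And>n. fps_nth F7 n = of_rat (c7 n)"
    using ex[of "[(1, -1), (2, 3), (13, 5), (26, 1)]" 4] unfolding c7_def by auto
  obtain F8 where F8: "unit_radius F8" "\<And>z. Im z > 0 \<Longrightarrow> qexp F8 z = eta_quotient [(1, -1), (2, 5), (13, 5), (26, -1)] z" "\<And>n. fps_nth F8 n = of_rat (c8 n)"
    using ex[of "[(1, -1), (2, 5), (13, 5), (26, -1)]" 2] unfolding c8_def by auto
  obtain F9 where F9: "unit_radius F9" "\<And>z. Im z > 0 \<Longrightarrow> qexp F9 z = eta_quotient [(1, 7), (2, -3), (13, -3), (26, 7)] z" "\<And>n. fps_nth F9 n = of_rat (c9 n)"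
    using ex[of "[(1, 7), (2, -3), (13, -3), (26, 7)]" 6] unfolding c9_def by auto
  define F where "F = fps_const (- 1/2040) * F1 - fps_const (127/5304) * F2 - fps_const (181/1768) * F3
     - fps_const (947/13260) * F4 - fps_const (127/408) * F5 - fps_const (13/2040) * F7
     + fps_const (46/3315) * F8 + fps_const (863/26520) * F9"
  note r = F1(1) F2(1) F3(1) F4(1) F5(1) F7(1) F8(1) F9(1)
  show ?thesis
  proof (rule that)
    show "unit_radius F" unfolding F_def by (intro unit_radius_intros r)
    show "qexp F z = cusp_part z" if z: "Im z > 0" for z
      unfolding F_def cusp_part_def
        F1(2)[OF z, symmetric] F2(2)[OF z, symmetric] F3(2)[OF z, symmetric] F4(2)[OF z, symmetric]
        F5(2)[OF z, symmetric] F7(2)[OF z, symmetric] F8(2)[OF z, symmetric] F9(2)[OF z, symmetric]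
      using z r by (simp add: qexp_ring unit_radius_intros del: fps_const_neg)
    show "fps_nth F n = of_rat (eta_quotient_sums n)" for n
      unfolding F_def eta_quotient_sums_def
      by (simp add: F1(3) F2(3) F3(3) F4(3) F5(3) F7(3) F8(3) F9(3) of_rat_diff of_rat_add of_rat_mult of_rat_divide of_rat_minus)
  qed
qed

lemma identity_initial:
  assumes n: "n < 29"
  shows "of_nat (W 2 13 n) - divisor_sums n = eta_quotient_sums n"
proof -
  have sig: "(if d dvd m then of_nat (sigma_nat 1 (m div d)) else 0) = (of_int (dilated_table d sigma_1_table m) :: rat)"
    "(if d dvd m then of_nat (sigma_nat 3 (m div d)) else 0) = (of_int (dilated_table d sigma_3_table m) :: rat)"
    if "m < 29" for d m
  proof -
    have "m div d < 29" using that div_le_dividend[of m d] by linarith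
    from sigma_tables[OF this]
    have "(of_int (int (sigma_nat 1 (m div d))) :: rat) = of_int (sigma_1_table ! (m div d))"
      "(of_int (int (sigma_nat 3 (m div d))) :: rat) = of_int (sigma_3_table ! (m div d))" by (simp_all only:)
    then show "(if d dvd m then of_nat (sigma_nat 1 (m div d)) else 0) = (of_int (dilated_table d sigma_1_table m) :: rat)"
      "(if d dvd m then of_nat (sigma_nat 3 (m div d)) else 0) = (of_int (dilated_table d sigma_3_table m) :: rat)"
      by (simp_all add: dilated_table_def)
  qed
  let ?w = "sum_list (map (\<lambda>i. dilated_table 2 sigma_1_table i * dilated_table 13 sigma_1_table (n - i)) [0..<Suc n])"
  have W: "(of_nat (W 2 13 n) :: rat) = of_int ?w"
  proof -
    have "(of_nat (W 2 13 n) :: rat) = (\<Sum>i\<le>n. (if 2 dvd i then of_nat (sigma_nat 1 (i div 2)) else 0) *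
       (if 13 dvd n - i then of_nat (sigma_nat 1 ((n - i) div 13)) else 0))"
      unfolding W_eq_convolution[of 2 13 n, simplified] of_nat_sum by (intro sum.cong) auto
    also have "\<dots> = (\<Sum>i\<le>n. of_int (dilated_table 2 sigma_1_table i) * of_int (dilated_table 13 sigma_1_table (n - i)))"
    proof (rule sum.cong[OF refl])
      fix i assume "i \<in> {..n}"
      then have "i < 29" "n - i < 29" using n by auto
      then show "(if 2 dvd i then of_nat (sigma_nat 1 (i div 2)) else 0) *
          (if 13 dvd n - i then of_nat (sigma_nat 1 ((n - i) div 13)) else 0) =
          (of_int (dilated_table 2 sigma_1_table i) * of_int (dilated_table 13 sigma_1_table (n - i)) :: rat)"
        by (simp only: sig(1))
    qed
    also have "\<dots> = of_int (\<Sum>i\<le>n. dilated_table 2 sigma_1_table i * dilated_table 13 sigma_1_table (n - i))"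
      by simp
    also have "(\<Sum>i\<le>n. dilated_table 2 sigma_1_table i * dilated_table 13 sigma_1_table (n - i)) = ?w"
      by (subst sum_list_distinct_conv_sum_set)
            (simp_all add: atLeast0LessThan lessThan_Suc_atMost del: upt_Suc sum.lessThan_Suc)
    finally show ?thesis .
  qed
  have s: "(of_nat (sigma_nat 3 n) :: rat) = of_int (dilated_table 1 sigma_3_table n)"
    using sig(2)[OF n, of 1] by simp
  have "26520 * ?w = 13 * dilated_table 1 sigma_3_table n + 52 * dilated_table 2 sigma_3_table n
     + 2197 * dilated_table 13 sigma_3_table n + 8788 * dilated_table 26 sigma_3_table n
     + (1105 - 510 * int n) * dilated_table 2 sigma_1_table n
     + (1105 - 3315 * int n) * dilated_table 13 sigma_1_table n
     - 13 * C1_table ! n - 635 * C2_table ! n - 2715 * C3_table ! n - 1894 * C4_table ! n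
     - 8255 * C5_table ! n - 169 * C7_table ! n + 368 * C8_table ! n + 863 * C9_table ! n"
    using identity_below_29 n by simp
  then have "(of_int (26520 * ?w) :: rat) = of_int (13 * dilated_table 1 sigma_3_table n + 52 * dilated_table 2 sigma_3_table n
     + 2197 * dilated_table 13 sigma_3_table n + 8788 * dilated_table 26 sigma_3_table n
     + (1105 - 510 * int n) * dilated_table 2 sigma_1_table n
     + (1105 - 3315 * int n) * dilated_table 13 sigma_1_table n
     - 13 * C1_table ! n - 635 * C2_table ! n - 2715 * C3_table ! n - 1894 * C4_table ! n
     - 8255 * C5_table ! n - 169 * C7_table ! n + 368 * C8_table ! n + 863 * C9_table ! n)"
    by (simp only:)
  then show ?thesis
    unfolding divisor_sums_def eta_quotient_sums_def sigmaQ_simps sig[OF n] s W c_tables[OF n]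
    unfolding of_int_mult of_int_add of_int_diff of_int_numeral of_int_of_nat_eq
    by (simp add: algebra_simps)
qed

theorem theorem3p3:
  fixes n :: nat
  assumes "n \<ge> 1"
  shows "of_nat (W 2 13 n) =
      1/2040 * sigmaQ 3 (of_nat n) + 1/510 * sigmaQ 3 (of_nat n / 2)
    + 169/2040 * sigmaQ 3 (of_nat n / 13) + 169/510 * sigmaQ 3 (of_nat n / 26)
    + (1/24 - of_nat n / 52) * sigmaQ 1 (of_nat n / 2)
    + (1/24 - of_nat n / 8) * sigmaQ 1 (of_nat n / 13)
    - 1/2040 * c1 n - 127/5304 * c2 n - 181/1768 * c3 n - 947/13260 * c4 n
    - 127/408 * c5 n - 13/2040 * c7 n + 46/3315 * c8 n + 863/26520 * c9 n"
proof -
  obtain F where F: "unit_radius F" "\<And>z. Im z > 0 \<Longrightarrow> qexp F z = cusp_part z"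
    "\<And>n. fps_nth F n = of_rat (eta_quotient_sums n)"
    by (rule cusp_expansion, rule that)
  note A = unit_radius_eisenstein_fps
  have "fps_nth (eisenstein_fps - F) m = 0" if "m < 29" for m
    using identity_initial[OF that] by (simp add: eisenstein_fps_nth F(3))
  then obtain K where K: "\<And>z. Im z \<ge> 1 \<Longrightarrow> norm (qexp (eisenstein_fps - F) z) \<le> K * norm (nome z) ^ 29"
    using qexp_decay[OF unit_radius_diff[OF A F(1)], of 29] by blast
  have "norm (eisenstein_part z - cusp_part z) \<le> K * norm (nome z) ^ 29" if "Im z \<ge> 1" for z
    using K[OF that] that by (simp add: qexp_ring A F qexp_eisenstein_fps)
  then have "(\<forall>z. Im z > 0 \<longrightarrow> eisenstein_part z - cusp_part z = 0) \<or>
         (\<forall>z. Im z > 0 \<longrightarrow> eisenstein_part z + cusp_part z = 0)"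
    by (intro eisenstein_part_eq_pm_cusp_part) blast
  then have "eisenstein_fps = F"
  proof
    assume "\<forall>z. Im z > 0 \<longrightarrow> eisenstein_part z - cusp_part z = 0"
    then have "eisenstein_fps - F = 0"
      by (intro qexp_eq_0_imp_eq_0 unit_radius_diff A F(1)) (simp add: qexp_ring A F qexp_eisenstein_fps)
    then show ?thesis by simp
  next
    \<comment> \<open>Only \<open>C_1\<close> starts at \<open>q\<close>, so the common coefficient
      of \<open>q\<close> is \<open>- 1/2040\<close>; the wrong sign would force it to
      vanish.\<close>
    assume "\<forall>z. Im z > 0 \<longrightarrow> eisenstein_part z + cusp_part z = 0"
    then have "eisenstein_fps + F = 0"
      by (intro qexp_eq_0_imp_eq_0 unit_radius_add A F(1)) (simp add: qexp_ring A F qexp_eisenstein_fps)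
    then have "fps_nth eisenstein_fps 1 + fps_nth F 1 = 0"
      by (metis fps_add_nth fps_zero_nth)
    then have "of_rat (2 * eta_quotient_sums 1) = (0 :: complex)"
      using identity_initial[of 1] by (simp add: eisenstein_fps_nth F(3) of_rat_mult)
    then have "eta_quotient_sums 1 = 0" by simp
    moreover have "eta_quotient_sums 1 = - (1/2040)"
      by (simp add: eta_quotient_sums_def c_tables C1_table_def C2_table_def C3_table_def C4_table_def
          C5_table_def C7_table_def C8_table_def C9_table_def)
    ultimately show ?thesis by simp
  qed
  then have "(of_rat (of_nat (W 2 13 n) - divisor_sums n) :: complex) = of_rat (eta_quotient_sums n)"
    using eisenstein_fps_nth[of n] F(3)[of n] by simp
  then have "of_nat (W 2 13 n) - divisor_sums n = eta_quotient_sums n" by (simp only: of_rat_eq_iff)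
  then show ?thesis
    unfolding divisor_sums_def eta_quotient_sums_def by (simp add: algebra_simps)
qed

end
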